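(* Let $(T,h)$, $(M,\varphi)$ be Riemannian manifolds and let $X^{(i)}_{(\alpha)}(t^\gamma,x^k)$ be a d-tensor field on $J^1(T,M)$ not depending on $x^m_\mu$. Consider the associated space $PDEsEDML^n_p$. (i) The gravitational $h$-potential on $J^1(T,M)$ induced by $PDEsEDML^n_p$ is the Sasakian-like metric $$G=h_{\alpha\beta}dt^\alpha\otimes dt^\beta+\varphi_{ij}dx^i\otimes dx^j+h^{\alpha\beta}\varphi_{ij}\,\delta x^i_\alpha\otimes\delta x^j_\beta.$$ (ii) The generalized Einstein equations governing $G$ are locally expressed by $$H_{\alpha\beta}-\tfrac{H+r}{2}h_{\alpha\beta}=\mathcal{K}\mathcal{T}_{\alpha\beta},\qquad r_{ij}-\tfrac{H+r}{2}\varphi_{ij}=\mathcal{K}\mathcal{T}_{ij},\qquad -\tfrac{H+r}{2}h^{\alpha\beta}\varphi_{ij}=\mathcal{K}\mathcal{T}^{(\alpha)(\beta)}_{(i)(j)},$$ $$0=\mathcal{T}_{\alpha i},\quad 0=\mathcal{T}_{i\alpha},\quad 0=\mathcal{T}^{(\alpha)}_{(i)\beta},\quad 0=\mathcal{T}^{\;(\beta)}_{\alpha(i)},\quad 0=\mathcal{T}^{\;(\alpha)}_{i(j)},\quad 0=\mathcal{T}^{(\alpha)}_{(i)j},$$ where $\mathcal{T}_{AB}$ (with $A,B$ each of type $\alpha$, $i$, or ${(\alpha)\atop(i)}$) are the adapted components of the stress-energy d-tensor $\mathcal{T}$, $H_{\alpha\beta}$ and $r_{ij}$ are the Ricci tensors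 of $h$ and $\varphi$, and $H$ and $r$ their scalar curvatures. (iii) The components $\mathcal{T}_{\mu\beta}$ and $\mathcal{T}_{mj}$ of the stress-energy d-tensor satisfy the conservation laws $$\mathcal{T}^\mu_{\beta//\mu}=0,\qquad \mathcal{T}^m_{j\Vert m}=0.$$
   Context: $T$, $M$ are smooth connected manifolds of dimensions $p$, $n$ with local coordinates $(t^\alpha)$, $(x^i)$; $J^1(T,M)$ has local coordinates $(t^\alpha,x^i,x^i_\alpha)$. Summation over repeated indices is understood. $H^\gamma_{\alpha\beta}$, $\gamma^i_{jk}$ are the Christoffel symbols of $h$, $\varphi$. A d-tensor $X^{(i)}_{(\alpha)}$ is a family of smooth local components transforming like those of a vertical vector field $X^{(i)}_{(\alpha)}\partial/\partial x^i_\alpha$; $X^{(i)}_{(\alpha)\Vert j}=\partial X^{(i)}_{(\alpha)}/\partial x^j+X^{(m)}_{(\alpha)}\gamma^i_{mj}$. The space $PDEsEDML^n_p$ attached to the PDE system $\partial x^i/\partial t^\alpha=X^{(i)}_{(\alpha)}(t,x(t))$ and the metrics $h,\varphi$ is the pair $(J^1(T,M),L)$ with $L=h^{\alpha\beta}\varphi_{ij}(x^i_\alpha-X^{(i)}_{(\alpha)})(x^j_\beta-X^{(j)}_{(\beta)})$. Its canonical nonlinear connection is $M^{(i)}_{(\alpha)\beta}=-H^\gamma_{\alpha\beta}x^i_\gamma$, $N^{(i)}_{(\alpha)j}=\gamma^i_{jk}x^k_\alpha-\frac12[X^{(i)}_{(\alpha)\Vert j}-\varphi^{ir}X^{(s)}_{(\alpha)\Vert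 r}\varphi_{sj}]$. The adapted frame is $\frac{\delta}{\delta t^\alpha}=\frac{\partial}{\partial t^\alpha}-M^{(j)}_{(\beta)\alpha}\frac{\partial}{\partial x^j_\beta}$, $\frac{\delta}{\delta x^i}=\frac{\partial}{\partial x^i}-N^{(j)}_{(\beta)i}\frac{\partial}{\partial x^j_\beta}$, $\frac{\partial}{\partial x^i_\alpha}$, with dual coframe $dt^\alpha$, $dx^i$, $\delta x^i_\alpha=dx^i_\alpha+M^{(i)}_{(\alpha)\beta}dt^\beta+N^{(i)}_{(\alpha)j}dx^j$. The vertical metric of the space is $\frac12\frac{\partial^2L}{\partial x^i_\alpha\partial x^j_\beta}=h^{\alpha\beta}\varphi_{ij}$, and the induced gravitational $h$-potential is the metric on $J^1(T,M)$ whose adapted components are $h_{\alpha\beta}$, $\varphi_{ij}$ and this vertical metric, with mutually orthogonal blocks. The generalized Cartan canonical connection $C\Gamma$ has adapted components $(H^\gamma_{\alpha\beta},0,\gamma^i_{jk},0)$, i.e. it is the linear connection $\nabla$ on $J^1(T,M)$ with $\nabla_{\delta/\delta t^\gamma}\frac{\delta}{\delta t^\beta}=H^\alpha_{\beta\gamma}\frac{\delta}{\delta t^\alpha}$, $\nabla_{\delta/\delta t^\gamma}\frac{\delta}{\delta x^i}=0$, $\nabla_{\delta/\delta t^\gamma}\frac{\partial}{\partial x^i_\beta}=-H^\beta_{\alpha\gamma}\frac{\partial}{\partial x^i_\alpha}$, $\nabla_{\delta/\delta x^k}\frac{\delta}{\delta t^\beta}=0$, $\nabla_{\delta/\delta x^k}\frac{\delta}{\delta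 x^j}=\gamma^i_{jk}\frac{\delta}{\delta x^i}$, $\nabla_{\delta/\delta x^k}\frac{\partial}{\partial x^j_\beta}=\gamma^i_{jk}\frac{\partial}{\partial x^i_\beta}$, and $\nabla_{\partial/\partial x^k_\gamma}$ vanishing on the whole adapted frame. The generalized Einstein equations are $\mathrm{Ric}(C\Gamma)-\frac12\mathrm{Sc}(C\Gamma)\,G=\mathcal{K}\mathcal{T}$, where $\mathrm{Ric}(U,V)$ is the trace of $Z\mapsto R(Z,V)U$ for the curvature $R$ of $C\Gamma$, $\mathrm{Sc}$ is its trace with respect to $G$, $\mathcal{K}$ is a nonzero constant and $\mathcal{T}$ is the stress-energy d-tensor, with adapted components $\mathcal{T}_{AB}$. Indices are raised by $\mathcal{T}^\mu_\beta=h^{\mu\nu}\mathcal{T}_{\nu\beta}$ and $\mathcal{T}^m_j=\varphi^{mr}\mathcal{T}_{rj}$; the derivatives are $\mathcal{T}^\mu_{\beta//\nu}=\frac{\partial\mathcal{T}^\mu_\beta}{\partial t^\nu}+\mathcal{T}^\lambda_\beta H^\mu_{\lambda\nu}-\mathcal{T}^\mu_\lambda H^\lambda_{\beta\nu}$ and $\mathcal{T}^m_{j\Vert k}=\frac{\partial\mathcal{T}^m_j}{\partial x^k}+\mathcal{T}^l_j\gamma^m_{lk}-\mathcal{T}^m_l\gamma^l_{jk}$. *)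

theory Defs
  imports "HOL-Analysis.Analysis"
begin

subsection \<open>Smooth maps and smooth manifolds\<close>

primrec Ck_on :: "nat \<Rightarrow> 'a::real_normed_vector set \<Rightarrow> ('a \<Rightarrow> 'b::real_normed_vector) \<Rightarrow> bool" where
  "Ck_on 0 S f \<longleftrightarrow> continuous_on S f"
| "Ck_on (Suc k) S f \<longleftrightarrow>
     f differentiable_on S \<and> (\<forall>v. Ck_on k S (\<lambda>x. frechet_derivative f (at x) v))"

text \<open>Only meaningful for open \<open>S\<close>: the derivatives are taken in the whole space.\<close>

definition smooth_on :: "'a::real_normed_vector set \<Rightarrow> ('a \<Rightarrow> 'b::real_normed_vector) \<Rightarrow> bool" where
  "smooth_on S f \<longleftrightarrow> (\<forall>k. Ck_on k S f)"

text \<open>A chart is a pair of its domain and its coordinate map.\<close>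

type_synonym ('a, 'i) chart = "'a set \<times> ('a \<Rightarrow> real^'i)"

abbreviation chart_image :: "('a, 'i::finite) chart \<Rightarrow> (real^'i) set" where
  "chart_image c \<equiv> snd c ` fst c"

definition overlap :: "('a, 'i::finite) chart \<Rightarrow> ('a, 'i) chart \<Rightarrow> (real^'i) set" where
  "overlap c c' = snd c ` (fst c \<inter> fst c')"

definition transition :: "('a, 'i::finite) chart \<Rightarrow> ('a, 'i) chart \<Rightarrow> real^'i \<Rightarrow> real^'i" where
  "transition c c' = snd c' \<circ> inv_into (fst c) (snd c)"

text \<open>The manifold is the whole (Hausdorff, second countable) type \<open>'a\<close>, of dimension
  \<open>CARD('i)\<close>; \<open>\<A>\<close> is any atlas of its smooth structure, for instance the maximal one.\<close>

definition connected_smooth_manifold ::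
    "('a::{t2_space,second_countable_topology}, 'i::finite) chart set \<Rightarrow> bool" where
  "connected_smooth_manifold \<A> \<longleftrightarrow>
     connected (UNIV :: 'a set) \<and>
     (\<Union>c\<in>\<A>. fst c) = UNIV \<and>
     (\<forall>c\<in>\<A>. open (fst c) \<and> open (chart_image c) \<and>
        homeomorphism (fst c) (chart_image c) (snd c) (inv_into (fst c) (snd c))) \<and>
     (\<forall>c\<in>\<A>. \<forall>c'\<in>\<A>. smooth_on (overlap c c') (transition c c'))"

text \<open>Tensor fields are families of local components, indexed by the charts and related by the
  transformation rule of the tensor type. For a metric, \<open>g c x $ i $ j\<close> is the component
  \<open>g\<^sub>i\<^sub>j\<close> in the chart \<open>c\<close> at the point with coordinates \<open>x\<close>.\<close>

definition riemannian_metric ::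
    "('a, 'i::finite) chart set \<Rightarrow> (('a, 'i) chart \<Rightarrow> real^'i \<Rightarrow> real^'i^'i) \<Rightarrow> bool" where
  "riemannian_metric \<A> g \<longleftrightarrow>
     (\<forall>c\<in>\<A>. smooth_on (chart_image c) (g c)) \<and>
     (\<forall>c\<in>\<A>. \<forall>x\<in>chart_image c.
        transpose (g c x) = g c x \<and> (\<forall>u. u \<noteq> 0 \<longrightarrow> u \<bullet> (g c x *v u) > 0)) \<and>
     (\<forall>c\<in>\<A>. \<forall>c'\<in>\<A>. \<forall>x\<in>overlap c c'.
        g c x = transpose (jacobian (transition c c') (at x)) ** g c' (transition c c' x)
                  ** jacobian (transition c c') (at x))"


subsection \<open>Christoffel symbols and Ricci tensor of a metric in a chart\<close>

definition pd :: "'i::finite \<Rightarrow> (real^'i \<Rightarrow> real) \<Rightarrow> real^'i \<Rightarrow> real" where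
  "pd i f x = frechet_derivative f (at x) (axis i 1)"

text \<open>\<open>christoffel g x k i j\<close> is \<open>\<Gamma>\<^sup>k\<^sub>i\<^sub>j\<close> at \<open>x\<close>.\<close>

definition christoffel ::
    "(real^'i::finite \<Rightarrow> real^'i^'i) \<Rightarrow> real^'i \<Rightarrow> 'i \<Rightarrow> 'i \<Rightarrow> 'i \<Rightarrow> real" where
  "christoffel g x k i j =
     (1/2) * (\<Sum>l\<in>UNIV. matrix_inv (g x) $ k $ l *
       (pd i (\<lambda>y. g y $ l $ j) x + pd j (\<lambda>y. g y $ l $ i) x - pd l (\<lambda>y. g y $ i $ j) x))"

text \<open>Sign convention: the Ricci tensor is \<open>Ric(U,V) = tr (Z \<mapsto> R(Z,V)U)\<close>, as for the Cartan
  connection below; it is positive on round spheres.\<close>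

definition ricci ::
    "(real^'i::finite \<Rightarrow> real^'i^'i) \<Rightarrow> real^'i \<Rightarrow> 'i \<Rightarrow> 'i \<Rightarrow> real" where
  "ricci g x j k =
     (\<Sum>i\<in>UNIV. pd i (\<lambda>y. christoffel g y i j k) x - pd k (\<lambda>y. christoffel g y i j i) x
       + (\<Sum>l\<in>UNIV. christoffel g x l j k * christoffel g x i l i
                 - christoffel g x l j i * christoffel g x i l k))"

definition scalar_curvature :: "(real^'i::finite \<Rightarrow> real^'i^'i) \<Rightarrow> real^'i \<Rightarrow> real" where
  "scalar_curvature g x = (\<Sum>i\<in>UNIV. \<Sum>j\<in>UNIV. matrix_inv (g x) $ i $ j * ricci g x i j)"


subsection \<open>The 1-jet space\<close>

text \<open>Each pair of charts induces coordinates \<open>z = (t, x, v)\<close> on \<open>J\<^sup>1(T,M)\<close>, where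
  \<open>v $ i $ \<alpha>\<close> is the fibre coordinate \<open>x\<^sup>i\<^sub>\<alpha>\<close>. Tangent vectors in these coordinates have the same
  type.\<close>

type_synonym ('p, 'n) jet = "(real^'p) \<times> (real^'n) \<times> (real^'p^'n)"

definition jet_dom ::
    "('a, 'p::finite) chart \<Rightarrow> ('b, 'n::finite) chart \<Rightarrow> ('p, 'n) jet set" where
  "jet_dom c d = chart_image c \<times> chart_image d \<times> UNIV"

definition jet_overlap ::
    "('a, 'p::finite) chart \<Rightarrow> ('b, 'n::finite) chart \<Rightarrow> ('a, 'p) chart \<Rightarrow> ('b, 'n) chart
      \<Rightarrow> ('p, 'n) jet set" where
  "jet_overlap c d c' d' = overlap c c' \<times> overlap d d' \<times> UNIV"

text \<open>The transformation \<open>w\<^sup>i\<^sub>\<alpha> \<mapsto> (\<partial>x'\<^sup>i/\<partial>x\<^sup>j) (\<partial>t\<^sup>\<beta>/\<partial>t'\<^sup>\<alpha>) w\<^sup>j\<^sub>\<beta>\<close>.\<close>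

definition vertical_change ::
    "('a, 'p::finite) chart \<Rightarrow> ('b, 'n::finite) chart \<Rightarrow> ('a, 'p) chart \<Rightarrow> ('b, 'n) chart
      \<Rightarrow> real^'p \<Rightarrow> real^'n \<Rightarrow> real^'p^'n \<Rightarrow> real^'p^'n" where
  "vertical_change c d c' d' t x w =
     jacobian (transition d d') (at x) ** w ** jacobian (transition c' c) (at (transition c c' t))"

definition jet_transition ::
    "('a, 'p::finite) chart \<Rightarrow> ('b, 'n::finite) chart \<Rightarrow> ('a, 'p) chart \<Rightarrow> ('b, 'n) chart
      \<Rightarrow> ('p, 'n) jet \<Rightarrow> ('p, 'n) jet" where
  "jet_transition c d c' d' = (\<lambda>(t, x, v).
     (transition c c' t, transition d d' x, vertical_change c d c' d' t x v))"

definition vertical_dtensor ::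
    "('a, 'p::finite) chart set \<Rightarrow> ('b, 'n::finite) chart set
      \<Rightarrow> (('a, 'p) chart \<Rightarrow> ('b, 'n) chart \<Rightarrow> ('p, 'n) jet \<Rightarrow> real^'p^'n) \<Rightarrow> bool" where
  "vertical_dtensor \<A> \<B> X \<longleftrightarrow>
     (\<forall>c\<in>\<A>. \<forall>d\<in>\<B>. smooth_on (jet_dom c d) (X c d)) \<and>
     (\<forall>c\<in>\<A>. \<forall>d\<in>\<B>. \<forall>c'\<in>\<A>. \<forall>d'\<in>\<B>. \<forall>t x v. (t, x, v) \<in> jet_overlap c d c' d' \<longrightarrow>
        X c' d' (jet_transition c d c' d' (t, x, v)) = vertical_change c d c' d' t x (X c d (t, x, v)))"

definition covariant_2tensor ::
    "('a, 'p::finite) chart set \<Rightarrow> ('b, 'n::finite) chart set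
      \<Rightarrow> (('a, 'p) chart \<Rightarrow> ('b, 'n) chart
           \<Rightarrow> ('p, 'n) jet \<Rightarrow> ('p, 'n) jet \<Rightarrow> ('p, 'n) jet \<Rightarrow> real) \<Rightarrow> bool" where
  "covariant_2tensor \<A> \<B> S \<longleftrightarrow>
     (\<forall>c\<in>\<A>. \<forall>d\<in>\<B>.
        (\<forall>z\<in>jet_dom c d. bilinear (S c d z)) \<and>
        (\<forall>U V. smooth_on (jet_dom c d) (\<lambda>z. S c d z U V))) \<and>
     (\<forall>c\<in>\<A>. \<forall>d\<in>\<B>. \<forall>c'\<in>\<A>. \<forall>d'\<in>\<B>. \<forall>z\<in>jet_overlap c d c' d'. \<forall>U V.
        S c d z U V =
        (let F = jet_transition c d c' d'; D = frechet_derivative F (at z)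
         in S c' d' (F z) (D U) (D V)))"

definition riemannian_metric_jet ::
    "('a, 'p::finite) chart set \<Rightarrow> ('b, 'n::finite) chart set
      \<Rightarrow> (('a, 'p) chart \<Rightarrow> ('b, 'n) chart
           \<Rightarrow> ('p, 'n) jet \<Rightarrow> ('p, 'n) jet \<Rightarrow> ('p, 'n) jet \<Rightarrow> real) \<Rightarrow> bool" where
  "riemannian_metric_jet \<A> \<B> g \<longleftrightarrow>
     covariant_2tensor \<A> \<B> g \<and>
     (\<forall>c\<in>\<A>. \<forall>d\<in>\<B>. \<forall>z\<in>jet_dom c d.
        (\<forall>U V. g c d z U V = g c d z V U) \<and> (\<forall>U. U \<noteq> 0 \<longrightarrow> g c d z U U > 0))"


subsection \<open>Local geometry of the space attached to the PDE system\<close>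

text \<open>In this subsection \<open>h\<close>, \<open>\<phi>\<close> and \<open>X\<close> are the components in one fixed pair of charts.\<close>

type_synonym 'i local_metric = "real^'i \<Rightarrow> real^'i^'i"
type_synonym ('p, 'n) local_dtensor = "('p, 'n) jet \<Rightarrow> real^'p^'n"

abbreviation vert :: "'n::finite \<Rightarrow> 'p::finite \<Rightarrow> ('p, 'n) jet" where
  "vert i \<alpha> \<equiv> (0, 0, axis i (axis \<alpha> 1))"

definition lagrangian ::
    "'p::finite local_metric \<Rightarrow> 'n::finite local_metric \<Rightarrow> ('p, 'n) local_dtensor
      \<Rightarrow> ('p, 'n) jet \<Rightarrow> real" where
  "lagrangian h \<phi> X = (\<lambda>(t, x, v).
     \<Sum>\<alpha>\<in>UNIV. \<Sum>\<beta>\<in>UNIV. \<Sum>i\<in>UNIV. \<Sum>j\<in>UNIV.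
       matrix_inv (h t) $ \<alpha> $ \<beta> * \<phi> x $ i $ j
         * (v $ i $ \<alpha> - X (t, x, v) $ i $ \<alpha>) * (v $ j $ \<beta> - X (t, x, v) $ j $ \<beta>))"

definition vertical_metric ::
    "'p::finite local_metric \<Rightarrow> 'n::finite local_metric \<Rightarrow> ('p, 'n) local_dtensor
      \<Rightarrow> ('p, 'n) jet \<Rightarrow> 'n \<Rightarrow> 'p \<Rightarrow> 'n \<Rightarrow> 'p \<Rightarrow> real" where
  "vertical_metric h \<phi> X z i \<alpha> j \<beta> =
     (1/2) * frechet_derivative
       (\<lambda>z'. frechet_derivative (lagrangian h \<phi> X) (at z') (vert j \<beta>)) (at z) (vert i \<alpha>)"

text \<open>The covariant derivative of \<open>X\<close> on \<open>M\<close>; the last index is the index of differentiation.\<close>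

definition X_cov ::
    "'n::finite local_metric \<Rightarrow> ('p::finite, 'n) local_dtensor \<Rightarrow> ('p, 'n) jet
      \<Rightarrow> 'n \<Rightarrow> 'p \<Rightarrow> 'n \<Rightarrow> real" where
  "X_cov \<phi> X z i \<alpha> j =
     frechet_derivative (\<lambda>z'. X z' $ i $ \<alpha>) (at z) (0, axis j 1, 0)
     + (\<Sum>m\<in>UNIV. X z $ m $ \<alpha> * christoffel \<phi> (fst (snd z)) i m j)"

definition M_conn ::
    "'p::finite local_metric \<Rightarrow> ('p, 'n::finite) jet \<Rightarrow> 'n \<Rightarrow> 'p \<Rightarrow> 'p \<Rightarrow> real" where
  "M_conn h = (\<lambda>(t, x, v) i \<alpha> \<beta>. - (\<Sum>\<gamma>\<in>UNIV. christoffel h t \<gamma> \<alpha> \<beta> * v $ i $ \<gamma>))"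

definition N_conn ::
    "'n::finite local_metric \<Rightarrow> ('p::finite, 'n) local_dtensor
      \<Rightarrow> ('p, 'n) jet \<Rightarrow> 'n \<Rightarrow> 'p \<Rightarrow> 'n \<Rightarrow> real" where
  "N_conn \<phi> X = (\<lambda>(t, x, v) i \<alpha> j.
     (\<Sum>k\<in>UNIV. christoffel \<phi> x i j k * v $ k $ \<alpha>)
     - (1/2) * (X_cov \<phi> X (t, x, v) i \<alpha> j
        - (\<Sum>r\<in>UNIV. \<Sum>s\<in>UNIV.
             matrix_inv (\<phi> x) $ i $ r * X_cov \<phi> X (t, x, v) s \<alpha> r * \<phi> x $ s $ j)))"

text \<open>Adapted indices: \<open>tI \<alpha>\<close>, \<open>xI i\<close>, \<open>vI i \<alpha>\<close> stand for the index types
  \<open>\<alpha>\<close>, \<open>i\<close> and \<open>(\<alpha>),(i)\<close>.\<close>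

type_synonym ('p, 'n) adapted_index = "'p + 'n + 'n \<times> 'p"

abbreviation tI :: "'p \<Rightarrow> ('p, 'n) adapted_index" where "tI \<alpha> \<equiv> Inl \<alpha>"
abbreviation xI :: "'n \<Rightarrow> ('p, 'n) adapted_index" where "xI i \<equiv> Inr (Inl i)"
abbreviation vI :: "'n \<Rightarrow> 'p \<Rightarrow> ('p, 'n) adapted_index" where "vI i \<alpha> \<equiv> Inr (Inr (i, \<alpha>))"

fun frame ::
    "'p::finite local_metric \<Rightarrow> 'n::finite local_metric \<Rightarrow> ('p, 'n) local_dtensor
      \<Rightarrow> ('p, 'n) adapted_index \<Rightarrow> ('p, 'n) jet \<Rightarrow> ('p, 'n) jet" where
  "frame h \<phi> X (tI \<alpha>) z = (axis \<alpha> 1, 0, \<chi> j \<beta>. - M_conn h z j \<beta> \<alpha>)"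
| "frame h \<phi> X (xI i) z = (0, axis i 1, \<chi> j \<beta>. - N_conn \<phi> X z j \<beta> i)"
| "frame h \<phi> X (vI i \<alpha>) z = vert i \<alpha>"

fun coframe ::
    "'p::finite local_metric \<Rightarrow> 'n::finite local_metric \<Rightarrow> ('p, 'n) local_dtensor
      \<Rightarrow> ('p, 'n) adapted_index \<Rightarrow> ('p, 'n) jet \<Rightarrow> ('p, 'n) jet \<Rightarrow> real" where
  "coframe h \<phi> X (tI \<alpha>) z (a, b, w) = a $ \<alpha>"
| "coframe h \<phi> X (xI i) z (a, b, w) = b $ i"
| "coframe h \<phi> X (vI i \<alpha>) z (a, b, w) =
     w $ i $ \<alpha> + (\<Sum>\<beta>\<in>UNIV. M_conn h z i \<alpha> \<beta> * a $ \<beta>) + (\<Sum>j\<in>UNIV. N_conn \<phi> X z i \<alpha> j * b $ j)"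

fun potential_component ::
    "'p::finite local_metric \<Rightarrow> 'n::finite local_metric \<Rightarrow> ('p, 'n) local_dtensor
      \<Rightarrow> ('p, 'n) jet \<Rightarrow> ('p, 'n) adapted_index \<Rightarrow> ('p, 'n) adapted_index \<Rightarrow> real" where
  "potential_component h \<phi> X z (tI \<alpha>) (tI \<beta>) = h (fst z) $ \<alpha> $ \<beta>"
| "potential_component h \<phi> X z (xI i) (xI j) = \<phi> (fst (snd z)) $ i $ j"
| "potential_component h \<phi> X z (vI i \<alpha>) (vI j \<beta>) = vertical_metric h \<phi> X z i \<alpha> j \<beta>"
| "potential_component h \<phi> X z _ _ = 0"

definition gravitational_h_potential ::
    "('a, 'p::finite) chart set \<Rightarrow> ('b, 'n::finite) chart set
      \<Rightarrow> (('a, 'p) chart \<Rightarrow> 'p local_metric) \<Rightarrow> (('b, 'n) chart \<Rightarrow> 'n local_metric)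
      \<Rightarrow> (('a, 'p) chart \<Rightarrow> ('b, 'n) chart \<Rightarrow> ('p, 'n) local_dtensor)
      \<Rightarrow> (('a, 'p) chart \<Rightarrow> ('b, 'n) chart
           \<Rightarrow> ('p, 'n) jet \<Rightarrow> ('p, 'n) jet \<Rightarrow> ('p, 'n) jet \<Rightarrow> real) \<Rightarrow> bool" where
  "gravitational_h_potential \<A> \<B> h \<phi> X g \<longleftrightarrow>
     riemannian_metric_jet \<A> \<B> g \<and>
     (\<forall>c\<in>\<A>. \<forall>d\<in>\<B>. \<forall>z\<in>jet_dom c d. \<forall>A B.
        g c d z (frame (h c) (\<phi> d) (X c d) A z) (frame (h c) (\<phi> d) (X c d) B z)
          = potential_component (h c) (\<phi> d) (X c d) z A B)"

definition sasaki_metric ::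
    "'p::finite local_metric \<Rightarrow> 'n::finite local_metric \<Rightarrow> ('p, 'n) local_dtensor
      \<Rightarrow> ('p, 'n) jet \<Rightarrow> ('p, 'n) jet \<Rightarrow> ('p, 'n) jet \<Rightarrow> real" where
  "sasaki_metric h \<phi> X z U V =
     (let \<theta> = (\<lambda>A. coframe h \<phi> X A z) in
       (\<Sum>\<alpha>\<in>UNIV. \<Sum>\<beta>\<in>UNIV. h (fst z) $ \<alpha> $ \<beta> * \<theta> (tI \<alpha>) U * \<theta> (tI \<beta>) V)
     + (\<Sum>i\<in>UNIV. \<Sum>j\<in>UNIV. \<phi> (fst (snd z)) $ i $ j * \<theta> (xI i) U * \<theta> (xI j) V)
     + (\<Sum>\<alpha>\<in>UNIV. \<Sum>\<beta>\<in>UNIV. \<Sum>i\<in>UNIV. \<Sum>j\<in>UNIV.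
          matrix_inv (h (fst z)) $ \<alpha> $ \<beta> * \<phi> (fst (snd z)) $ i $ j
            * \<theta> (vI i \<alpha>) U * \<theta> (vI j \<beta>) V))"


subsection \<open>Curvature of the generalized Cartan canonical connection\<close>

text \<open>\<open>cartan_frame h \<phi> X A B\<close> is the covariant derivative of the frame field \<open>B\<close> along the frame
  field \<open>A\<close>.\<close>

fun cartan_frame ::
    "'p::finite local_metric \<Rightarrow> 'n::finite local_metric \<Rightarrow> ('p, 'n) local_dtensor
      \<Rightarrow> ('p, 'n) adapted_index \<Rightarrow> ('p, 'n) adapted_index \<Rightarrow> ('p, 'n) jet \<Rightarrow> ('p, 'n) jet" where
  "cartan_frame h \<phi> X (tI \<gamma>) (tI \<beta>) z =
     (\<Sum>\<alpha>\<in>UNIV. christoffel h (fst z) \<alpha> \<beta> \<gamma> *\<^sub>R frame h \<phi> X (tI \<alpha>) z)"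
| "cartan_frame h \<phi> X (tI \<gamma>) (xI i) z = 0"
| "cartan_frame h \<phi> X (tI \<gamma>) (vI i \<beta>) z =
     - (\<Sum>\<alpha>\<in>UNIV. christoffel h (fst z) \<beta> \<alpha> \<gamma> *\<^sub>R frame h \<phi> X (vI i \<alpha>) z)"
| "cartan_frame h \<phi> X (xI k) (tI \<beta>) z = 0"
| "cartan_frame h \<phi> X (xI k) (xI j) z =
     (\<Sum>i\<in>UNIV. christoffel \<phi> (fst (snd z)) i j k *\<^sub>R frame h \<phi> X (xI i) z)"
| "cartan_frame h \<phi> X (xI k) (vI j \<beta>) z =
     (\<Sum>i\<in>UNIV. christoffel \<phi> (fst (snd z)) i j k *\<^sub>R frame h \<phi> X (vI i \<beta>) z)"
| "cartan_frame h \<phi> X (vI k \<gamma>) B z = 0"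

text \<open>The connection with these values on the frame, extended to all vector fields by linearity and
  the Leibniz rule; \<open>cartan h \<phi> X Y W\<close> is the derivative of \<open>W\<close> along \<open>Y\<close>.\<close>

definition cartan ::
    "'p::finite local_metric \<Rightarrow> 'n::finite local_metric \<Rightarrow> ('p, 'n) local_dtensor
      \<Rightarrow> (('p, 'n) jet \<Rightarrow> ('p, 'n) jet) \<Rightarrow> (('p, 'n) jet \<Rightarrow> ('p, 'n) jet)
      \<Rightarrow> ('p, 'n) jet \<Rightarrow> ('p, 'n) jet" where
  "cartan h \<phi> X Y W z =
     (\<Sum>B\<in>UNIV. frechet_derivative (\<lambda>z'. coframe h \<phi> X B z' (W z')) (at z) (Y z)
                  *\<^sub>R frame h \<phi> X B z)
   + (\<Sum>A\<in>UNIV. \<Sum>B\<in>UNIV. (coframe h \<phi> X A z (Y z) * coframe h \<phi> X B z (W z))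
                  *\<^sub>R cartan_frame h \<phi> X A B z)"

definition lie_bracket ::
    "('v::real_normed_vector \<Rightarrow> 'v) \<Rightarrow> ('v \<Rightarrow> 'v) \<Rightarrow> 'v \<Rightarrow> 'v" where
  "lie_bracket Y Z z =
     frechet_derivative Z (at z) (Y z) - frechet_derivative Y (at z) (Z z)"

definition curvature ::
    "(('v::real_normed_vector \<Rightarrow> 'v) \<Rightarrow> ('v \<Rightarrow> 'v) \<Rightarrow> 'v \<Rightarrow> 'v)
      \<Rightarrow> ('v \<Rightarrow> 'v) \<Rightarrow> ('v \<Rightarrow> 'v) \<Rightarrow> ('v \<Rightarrow> 'v) \<Rightarrow> 'v \<Rightarrow> 'v" where
  "curvature D Y Z W z = D Y (D Z W) z - D Z (D Y W) z - D (lie_bracket Y Z) W z"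

text \<open>By tensoriality the curvature at a point may be evaluated on any extensions of the tangent
  vectors to vector fields; we take the ones with constant coordinates.\<close>

definition ricci_of_connection ::
    "(('v::euclidean_space \<Rightarrow> 'v) \<Rightarrow> ('v \<Rightarrow> 'v) \<Rightarrow> 'v \<Rightarrow> 'v) \<Rightarrow> 'v \<Rightarrow> 'v \<Rightarrow> 'v \<Rightarrow> real" where
  "ricci_of_connection D z U V =
     (\<Sum>e\<in>Basis. curvature D (\<lambda>_. e) (\<lambda>_. V) (\<lambda>_. U) z \<bullet> e)"

definition adapted_component ::
    "'p::finite local_metric \<Rightarrow> 'n::finite local_metric \<Rightarrow> ('p, 'n) local_dtensor
      \<Rightarrow> (('p, 'n) jet \<Rightarrow> ('p, 'n) jet \<Rightarrow> ('p, 'n) jet \<Rightarrow> real)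
      \<Rightarrow> ('p, 'n) jet \<Rightarrow> ('p, 'n) adapted_index \<Rightarrow> ('p, 'n) adapted_index \<Rightarrow> real" where
  "adapted_component h \<phi> X S z A B = S z (frame h \<phi> X A z) (frame h \<phi> X B z)"

definition cartan_scalar ::
    "'p::finite local_metric \<Rightarrow> 'n::finite local_metric \<Rightarrow> ('p, 'n) local_dtensor
      \<Rightarrow> (('p, 'n) jet \<Rightarrow> ('p, 'n) jet \<Rightarrow> ('p, 'n) jet \<Rightarrow> real) \<Rightarrow> ('p, 'n) jet \<Rightarrow> real" where
  "cartan_scalar h \<phi> X G z =
     (\<Sum>A\<in>UNIV. \<Sum>B\<in>UNIV. matrix_inv (\<chi> A B. adapted_component h \<phi> X G z A B) $ A $ B
        * adapted_component h \<phi> X (ricci_of_connection (cartan h \<phi> X)) z A B)"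

definition einstein_equations ::
    "'p::finite local_metric \<Rightarrow> 'n::finite local_metric \<Rightarrow> ('p, 'n) local_dtensor
      \<Rightarrow> (('p, 'n) jet \<Rightarrow> ('p, 'n) jet \<Rightarrow> ('p, 'n) jet \<Rightarrow> real) \<Rightarrow> real
      \<Rightarrow> (('p, 'n) jet \<Rightarrow> ('p, 'n) jet \<Rightarrow> ('p, 'n) jet \<Rightarrow> real) \<Rightarrow> ('p, 'n) jet set \<Rightarrow> bool" where
  "einstein_equations h \<phi> X G K S D \<longleftrightarrow>
     (\<forall>z\<in>D. \<forall>U V. ricci_of_connection (cartan h \<phi> X) z U V
        - (1/2) * cartan_scalar h \<phi> X G z * G z U V = K * S z U V)"


subsection \<open>Divergences of the stress-energy components\<close>

text \<open>In the following two definitions \<open>S z \<mu> \<beta>\<close> is a mixed component \<open>S\<^sup>\<mu>\<^sub>\<beta>\<close> at \<open>z\<close>, and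
  the last index is the index of differentiation.\<close>

definition t_cov ::
    "'p::finite local_metric \<Rightarrow> (('p, 'n::finite) jet \<Rightarrow> 'p \<Rightarrow> 'p \<Rightarrow> real)
      \<Rightarrow> ('p, 'n) jet \<Rightarrow> 'p \<Rightarrow> 'p \<Rightarrow> 'p \<Rightarrow> real" where
  "t_cov h S z \<mu> \<beta> \<nu> =
     frechet_derivative (\<lambda>z'. S z' \<mu> \<beta>) (at z) (axis \<nu> 1, 0, 0)
     + (\<Sum>\<kappa>\<in>UNIV. S z \<kappa> \<beta> * christoffel h (fst z) \<mu> \<kappa> \<nu>)
     - (\<Sum>\<kappa>\<in>UNIV. S z \<mu> \<kappa> * christoffel h (fst z) \<kappa> \<beta> \<nu>)"

definition x_cov ::
    "'n::finite local_metric \<Rightarrow> (('p::finite, 'n) jet \<Rightarrow> 'n \<Rightarrow> 'n \<Rightarrow> real)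
      \<Rightarrow> ('p, 'n) jet \<Rightarrow> 'n \<Rightarrow> 'n \<Rightarrow> 'n \<Rightarrow> real" where
  "x_cov \<phi> S z m j k =
     frechet_derivative (\<lambda>z'. S z' m j) (at z) (0, axis k 1, 0)
     + (\<Sum>l\<in>UNIV. S z l j * christoffel \<phi> (fst (snd z)) m l k)
     - (\<Sum>l\<in>UNIV. S z m l * christoffel \<phi> (fst (snd z)) l j k)"

definition t_raised ::
    "'p::finite local_metric \<Rightarrow> (('p, 'n::finite) jet \<Rightarrow> ('p, 'n) adapted_index \<Rightarrow> ('p, 'n) adapted_index \<Rightarrow> real)
      \<Rightarrow> ('p, 'n) jet \<Rightarrow> 'p \<Rightarrow> 'p \<Rightarrow> real" where
  "t_raised h S z \<mu> \<beta> = (\<Sum>\<nu>\<in>UNIV. matrix_inv (h (fst z)) $ \<mu> $ \<nu> * S z (tI \<nu>) (tI \<beta>))"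

definition x_raised ::
    "'n::finite local_metric \<Rightarrow> (('p::finite, 'n) jet \<Rightarrow> ('p, 'n) adapted_index \<Rightarrow> ('p, 'n) adapted_index \<Rightarrow> real)
      \<Rightarrow> ('p, 'n) jet \<Rightarrow> 'n \<Rightarrow> 'n \<Rightarrow> real" where
  "x_raised \<phi> S z m j =
     (\<Sum>r\<in>UNIV. matrix_inv (\<phi> (fst (snd z))) $ m $ r * S z (xI r) (xI j))"

end

theory Submission
  imports Defs
begin

text \<open>
  On the adapted frame the connection forms of the Cartan connection are pulled back from the
  Levi-Civita connections of \<open>h\<close> and \<open>\<phi>\<close>, so its Ricci tensor is the sum of the two Ricci
  tensors, without vertical or mixed part, and its trace with respect to \<open>G\<close> is \<open>H + r\<close>. Reading
  the Einstein equations on the frame gives (ii). In (iii) the derivative along \<open>T\<close> does not see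
  \<open>r\<close>, nor the one along \<open>M\<close> the scalar \<open>H\<close>, so both laws are contracted Bianchi identities. In (i)
  the Lagrangian is quadratic in the fibre coordinates because \<open>X\<close> does not depend on them, and the
  inhomogeneous transformation of the Christoffel symbols is what makes the vertical coframe, hence
  the metric, independent of the charts.
\<close>

subsection \<open>Calculus of smooth maps\<close>

text \<open>The adapted frame is not holonomic: its brackets carry the curvature of the nonlinear
  connection and hence derivatives of \<open>X\<close>. None of this reaches Ric. Curvature is
  evaluated on fields with constant coordinates, whose brackets vanish, and comes out as d\<omega> +
  \<omega> \<and> \<omega> for the connection forms \<omega>. The vertical block of \<omega> is not
  zero, yet it adds nothing to Ric: the trace puts a vertical frame vector into a curvature form
  that is pulled back from the bases. Local Riemannian geometry is done with matrix-valued forms: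
  the direction is an argument and the two tensor indices are matrix indices, so metric
  compatibility, the Bianchi identity and the transformation law are matrix algebra. Indices return
  only in the double contraction. There the curvature carries both matrix indices raised; skewness
  in this pair comes from differentiating the inverse metric twice. Positivity of the vertical block
  of G, a tensor product of two positive matrices, comes from a factorisation of the inverse of
  \<open>h\<close> as B times its transpose.\<close>

lemma frechet_derivative_eqI: "(f has_derivative f') (at x) \<Longrightarrow> frechet_derivative f (at x) = f'"
  using frechet_derivative_at by metis

lemma differentiable_on_has_derivative:
  assumes "f differentiable_on S" "open S" "x \<in> S"
  shows "(f has_derivative frechet_derivative f (at x)) (at x)"
  using assms by (metis at_within_open differentiable_on_def frechet_derivative_works)

lemma differentiable_onI:
  assumes "\<And>x. x \<in> S \<Longrightarrow> (f has_derivative f' x) (at x)"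
  shows "f differentiable_on S"
  using assms by (meson differentiable_at_imp_differentiable_on differentiableI)

text \<open>Derivatives are taken in the whole space, so openness of \<open>S\<close> is what lets
  equality on \<open>S\<close> pass to the derivatives and the induction continue.\<close>

lemma Ck_on_cong:
  assumes "open S" "\<And>x. x \<in> S \<Longrightarrow> f x = g x"
  shows "Ck_on k S f \<longleftrightarrow> Ck_on k S g"
proof -
  have "Ck_on k S g" if "Ck_on k S f" "\<And>x. x \<in> S \<Longrightarrow> f x = g x" for k and f g :: "'a \<Rightarrow> 'b"
    using that
  proof (induction k arbitrary: f g)
    case 0
    then show ?case by (metis Ck_on.simps(1) continuous_on_cong)
  next
    case (Suc k)
    have d: "(g has_derivative frechet_derivative f (at x)) (at x)" if "x \<in> S" for x
      using differentiable_on_has_derivative[of f S x] Suc.prems that assms(1)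
        has_derivative_transform_within_open[of f _ x UNIV S g] by auto
    then have "frechet_derivative f (at x) = frechet_derivative g (at x)" if "x \<in> S" for x
      using that frechet_derivative_eqI by metis
    then have "Ck_on k S (\<lambda>x. frechet_derivative g (at x) v)" for v
      using Suc.prems(1) Suc.IH[of "\<lambda>x. frechet_derivative f (at x) v"
          "\<lambda>x. frechet_derivative g (at x) v"] by simp
    with differentiable_onI[OF d] show ?case by simp
  qed
  then show ?thesis using assms by metis
qed

text \<open>The closure rules for sums, products and compositions go through this form, in which an
  explicitly computed derivative replaces \<open>frechet_derivative\<close>.\<close>

lemma Ck_on_SucI:
  assumes "open S" and d: "\<And>x. x \<in> S \<Longrightarrow> (f has_derivative f' x) (at x)"
    and "\<And>v. Ck_on k S (\<lambda>x. f' x v)"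
  shows "Ck_on (Suc k) S f"
proof -
  have "Ck_on k S (\<lambda>x. frechet_derivative f (at x) v)" for v
    using Ck_on_cong[OF assms(1), of "\<lambda>x. frechet_derivative f (at x) v" "\<lambda>x. f' x v"]
      assms(3) frechet_derivative_eqI[OF d] by simp
  then show ?thesis using differentiable_onI[OF d] by simp
qed

lemma Ck_on_SucD: "Ck_on (Suc k) S f \<Longrightarrow> Ck_on k S f"
  by (induction k arbitrary: f) (auto intro: differentiable_imp_continuous_on)

lemma smooth_on_cong:
  assumes "open S" "\<And>x. x \<in> S \<Longrightarrow> f x = g x"
  shows "smooth_on S f \<longleftrightarrow> smooth_on S g"
  using Ck_on_cong[OF assms] by (simp add: smooth_on_def)

lemma smooth_on_frechet_derivative: "smooth_on S f \<Longrightarrow> smooth_on S (\<lambda>x. frechet_derivative f (at x) v)"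
  unfolding smooth_on_def using Ck_on.simps(2) by blast

lemma smooth_on_differentiable_on: "smooth_on S f \<Longrightarrow> f differentiable_on S"
  unfolding smooth_on_def by (meson Ck_on.simps(2))

lemma smooth_on_has_derivative:
  "smooth_on S f \<Longrightarrow> open S \<Longrightarrow> x \<in> S \<Longrightarrow> (f has_derivative frechet_derivative f (at x)) (at x)"
  using differentiable_on_has_derivative smooth_on_differentiable_on by blast

lemma Ck_on_const: "Ck_on k S (\<lambda>x. c)"
  by (induction k arbitrary: c) auto

lemma smooth_on_const [intro, simp]: "smooth_on S (\<lambda>x. c)"
  by (simp add: smooth_on_def Ck_on_const)

lemma smooth_on_bounded_linear: "bounded_linear f \<Longrightarrow> smooth_on S f"
proof -
  assume f: "bounded_linear f"
  have "Ck_on k S f" for k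
  proof (cases k)
    case 0
    then show ?thesis using f by (simp add: linear_continuous_on)
  next
    case (Suc k')
    have d: "(f has_derivative f) (at x)" for x
      using f by (simp add: bounded_linear_imp_has_derivative)
    have "f differentiable_on S"
      using d by (rule differentiable_onI)
    then show ?thesis
      unfolding Suc by (simp add: frechet_derivative_eqI[OF d] Ck_on_const)
  qed
  then show ?thesis by (simp add: smooth_on_def)
qed

lemma Ck_on_linear_compose:
  assumes "open S" "bounded_linear L" "Ck_on k S f"
  shows "Ck_on k S (\<lambda>x. L (f x))"
  using assms(3)
proof (induction k arbitrary: f)
  case 0
  then show ?case using assms(2) by (simp add: bounded_linear.continuous_on)
next
  case (Suc k)
  have d: "((\<lambda>x. L (f x)) has_derivative (\<lambda>v. L (frechet_derivative f (at x) v))) (at x)" if "x \<in> S" for x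
    using Suc.prems that assms
    by (auto intro: bounded_linear.has_derivative differentiable_on_has_derivative)
  show ?case
    using Suc by (intro Ck_on_SucI[OF assms(1) d]) auto
qed

lemma smooth_on_linear_compose:
  "bounded_linear L \<Longrightarrow> open S \<Longrightarrow> smooth_on S f \<Longrightarrow> smooth_on S (\<lambda>x. L (f x))"
  by (simp add: smooth_on_def Ck_on_linear_compose)

lemma Ck_on_compose_linear:
  assumes "open S" "open T" "bounded_linear L" "\<And>x. x \<in> T \<Longrightarrow> L x \<in> S" "Ck_on k S f"
  shows "Ck_on k T (\<lambda>x. f (L x))"
  using assms(5)
proof (induction k arbitrary: f)
  case 0
  then show ?case using assms(3,4)
    by (auto intro: continuous_on_compose2 simp: linear_continuous_on)
next
  case (Suc k)
  have d: "((\<lambda>x. f (L x)) has_derivative (\<lambda>v. frechet_derivative f (at (L x)) (L v))) (at x)"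
    if "x \<in> T" for x
    using Suc.prems that assms
    by (auto intro!: has_derivative_compose[of L L x UNIV f "frechet_derivative f (at (L x))"]
        bounded_linear_imp_has_derivative differentiable_on_has_derivative)
  have "Ck_on k T (\<lambda>x. frechet_derivative f (at (L x)) (L v))" for v
    using Suc.IH[of "\<lambda>y. frechet_derivative f (at y) (L v)"] Suc.prems by simp
  then show ?case by (intro Ck_on_SucI[OF assms(2) d])
qed

lemma smooth_on_compose_linear:
  assumes "smooth_on S f" "bounded_linear L" "open S" "open T" "\<And>x. x \<in> T \<Longrightarrow> L x \<in> S"
  shows "smooth_on T (\<lambda>x. f (L x))"
  unfolding smooth_on_def
proof
  show "Ck_on k T (\<lambda>x. f (L x))" for k
    using Ck_on_compose_linear[OF assms(3,4,2)] assms(1,5) unfolding smooth_on_def by blast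
qed

lemma Ck_on_add:
  assumes "open S" "Ck_on k S f" "Ck_on k S g"
  shows "Ck_on k S (\<lambda>x. f x + g x)"
  using assms(2,3)
proof (induction k arbitrary: f g)
  case 0
  then show ?case by (simp add: continuous_on_add)
next
  case (Suc k)
  have d: "((\<lambda>x. f x + g x) has_derivative
      (\<lambda>v. frechet_derivative f (at x) v + frechet_derivative g (at x) v)) (at x)" if "x \<in> S" for x
    using Suc.prems that assms by (auto intro: has_derivative_add differentiable_on_has_derivative)
  show ?case
    using Suc by (intro Ck_on_SucI[OF assms(1) d]) auto
qed

lemma Ck_on_bilinear:
  assumes "open S" "bounded_bilinear m" "Ck_on k S f" "Ck_on k S g"
  shows "Ck_on k S (\<lambda>x. m (f x) (g x))"
  using assms(3,4)
proof (induction k arbitrary: f g)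
  case 0
  then show ?case using assms(2) by (simp add: bounded_bilinear.continuous_on)
next
  case (Suc k)
  have d: "((\<lambda>x. m (f x) (g x)) has_derivative
      (\<lambda>v. m (f x) (frechet_derivative g (at x) v) + m (frechet_derivative f (at x) v) (g x))) (at x)"
    if "x \<in> S" for x
    using Suc.prems that assms by (auto intro: bounded_bilinear.FDERIV differentiable_on_has_derivative)
  \<comment> \<open>The product rule leaves one factor undifferentiated; \<open>Ck_on_SucD\<close>
    weakens its class from k+1 to k, so that the induction hypothesis covers both summands.\<close>
  have "Ck_on k S (\<lambda>x. m (f x) (frechet_derivative g (at x) v) + m (frechet_derivative f (at x) v) (g x))" for v
    using Suc.prems Ck_on_SucD[OF Suc.prems(1)] Ck_on_SucD[OF Suc.prems(2)]
    by (intro Ck_on_add[OF assms(1)]) (rule Suc.IH; simp)+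
  then show ?case by (intro Ck_on_SucI[OF assms(1) d])
qed

lemma smooth_on_add: "open S \<Longrightarrow> smooth_on S f \<Longrightarrow> smooth_on S g \<Longrightarrow> smooth_on S (\<lambda>x. f x + g x)"
  by (simp add: smooth_on_def Ck_on_add)

lemma smooth_on_bilinear:
  "bounded_bilinear m \<Longrightarrow> open S \<Longrightarrow> smooth_on S f \<Longrightarrow> smooth_on S g \<Longrightarrow> smooth_on S (\<lambda>x. m (f x) (g x))"
  by (simp add: smooth_on_def Ck_on_bilinear)

lemma smooth_on_minus: "open S \<Longrightarrow> smooth_on S f \<Longrightarrow> smooth_on S (\<lambda>x. - f x)"
  using smooth_on_linear_compose[OF bounded_linear_minus[OF bounded_linear_ident]] .

lemma smooth_on_diff: "open S \<Longrightarrow> smooth_on S f \<Longrightarrow> smooth_on S g \<Longrightarrow> smooth_on S (\<lambda>x. f x - g x)"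
  using smooth_on_add[of S f "\<lambda>x. - g x"] smooth_on_minus by auto

lemma smooth_on_mult:
  fixes f g :: "'a::real_normed_vector \<Rightarrow> 'b::real_normed_algebra"
  shows "open S \<Longrightarrow> smooth_on S f \<Longrightarrow> smooth_on S g \<Longrightarrow> smooth_on S (\<lambda>x. f x * g x)"
  by (rule smooth_on_bilinear[OF bounded_bilinear_mult])

lemma smooth_on_sum:
  assumes "open S" "\<And>i. i \<in> I \<Longrightarrow> smooth_on S (f i)"
  shows "smooth_on S (\<lambda>x. \<Sum>i\<in>I. f i x)"
  using assms by (induction I rule: infinite_finite_induct) (auto intro: smooth_on_add)

lemma smooth_on_prod:
  fixes f :: "'i \<Rightarrow> 'a::real_normed_vector \<Rightarrow> real"
  assumes "open S" "\<And>i. i \<in> I \<Longrightarrow> smooth_on S (f i)"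
  shows "smooth_on S (\<lambda>x. \<Prod>i\<in>I. f i x)"
  using assms by (induction I rule: infinite_finite_induct) (auto intro: smooth_on_mult)

text \<open>The derivative of 1/f is a polynomial in 1/f and the derivative of f, so class k of 1/f
  already gives class k+1.\<close>

lemma smooth_on_inverse:
  fixes f :: "'a::real_normed_vector \<Rightarrow> real"
  assumes "open S" "smooth_on S f" "\<And>x. x \<in> S \<Longrightarrow> f x \<noteq> 0"
  shows "smooth_on S (\<lambda>x. inverse (f x))"
proof -
  have d: "((\<lambda>x. inverse (f x)) has_derivative
      (\<lambda>v. - (inverse (f x) * frechet_derivative f (at x) v * inverse (f x)))) (at x)" if "x \<in> S" for x
    using assms that by (intro Deriv.has_derivative_inverse smooth_on_has_derivative)
  have diff: "(\<lambda>x. inverse (f x)) differentiable_on S"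
    using d by (rule differentiable_onI)
  have "Ck_on k S (\<lambda>x. inverse (f x))" for k
  proof (induction k)
    case 0
    then show ?case using diff by (simp add: differentiable_imp_continuous_on)
  next
    case (Suc k)
    have "Ck_on k S (\<lambda>x. - (inverse (f x) * frechet_derivative f (at x) v * inverse (f x)))" for v
      using smooth_on_frechet_derivative[OF assms(2)] unfolding smooth_on_def
      by (intro Ck_on_linear_compose[OF assms(1) bounded_linear_minus[OF bounded_linear_ident]]
          Ck_on_bilinear[OF assms(1) bounded_bilinear_mult] Suc) auto
    then show ?case by (intro Ck_on_SucI[OF assms(1) d])
  qed
  then show ?thesis by (simp add: smooth_on_def)
qed

lemma smooth_on_vec_nth: "open S \<Longrightarrow> smooth_on S f \<Longrightarrow> smooth_on S (\<lambda>x. f x $ i)"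
  by (rule smooth_on_linear_compose[OF bounded_linear_vec_nth])

lemma bounded_linear_axis: "bounded_linear (axis i :: 'a::euclidean_space \<Rightarrow> 'a^'i::finite)"
  by (auto simp: linear_conv_bounded_linear[symmetric] vec_eq_iff axis_def intro!: linearI)

lemma smooth_on_vec_lambda:
  fixes f :: "'a::real_normed_vector \<Rightarrow> 'i::finite \<Rightarrow> 'b::euclidean_space"
  assumes "open S" "\<And>i. smooth_on S (\<lambda>x. f x i)"
  shows "smooth_on S (\<lambda>x. \<chi> i. f x i)"
proof -
  have "(\<chi> i. f x i) = (\<Sum>i\<in>UNIV. axis i (f x i))" for x
    by (simp add: vec_eq_iff axis_def sum.delta')
  then show ?thesis
    using assms by (simp add: smooth_on_sum smooth_on_linear_compose[OF bounded_linear_axis])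
qed

lemma smooth_on_det:
  fixes A :: "'a::real_normed_vector \<Rightarrow> real^'i^'i"
  assumes "open S" "smooth_on S A"
  shows "smooth_on S (\<lambda>x. det (A x))"
  unfolding det_def using assms
  by (auto intro!: smooth_on_sum smooth_on_mult smooth_on_prod smooth_on_vec_nth)

lemma matrix_inv:
  fixes A :: "real^'i^'i"
  assumes "invertible A"
  shows "A ** matrix_inv A = mat 1" "matrix_inv A ** A = mat 1"
  using assms someI_ex[of "\<lambda>A'. A ** A' = mat 1 \<and> A' ** A = mat 1"]
  by (auto simp: invertible_def matrix_inv_def)

text \<open>Cramer's rule for the entries of the inverse.\<close>

lemma smooth_on_matrix_inv:
  fixes A :: "'a::real_normed_vector \<Rightarrow> real^'i^'i"
  assumes "open S" "smooth_on S A" "\<And>x. x \<in> S \<Longrightarrow> invertible (A x)"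
  shows "smooth_on S (\<lambda>x. matrix_inv (A x))"
proof -
  let ?B = "\<lambda>x k l. det (\<chi> i j. if j = k then axis l 1 $ i else A x $ i $ j) * inverse (det (A x))"
  have eq: "matrix_inv (A x) = (\<chi> k l. ?B x k l)" if "x \<in> S" for x
  proof -
    have inv: "A x ** matrix_inv (A x) = mat 1" "det (A x) \<noteq> 0"
      using assms(3)[OF that] by (auto simp: matrix_inv(1) invertible_det_nz)
    have "column l (matrix_inv (A x)) = (\<chi> k. ?B x k l)" for l
    proof -
      \<comment> \<open>Column l of the inverse solves A y = e_l, the kind of linear system to which
        \<open>cramer\<close> applies.\<close>
      have "A x *v column l (matrix_inv (A x)) = column l (A x ** matrix_inv (A x))"
        by (simp add: vec_eq_iff column_def matrix_vector_mult_def matrix_matrix_mult_def)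
      also have "\<dots> = axis l 1"
        using inv by (simp add: vec_eq_iff column_def mat_def axis_def)
      finally show ?thesis
        using cramer[OF inv(2), of "column l (matrix_inv (A x))" "axis l 1"]
        by (simp add: vec_eq_iff divide_inverse)
    qed
    then show ?thesis by (simp add: vec_eq_iff column_def)
  qed
  have "smooth_on S (\<lambda>x. if j = k then axis l 1 $ i else A x $ i $ j)" for i j k l
    using assms by (cases "j = k") (auto intro!: smooth_on_vec_nth)
  then have "smooth_on S (\<lambda>x. \<chi> k l. ?B x k l)"
    using assms by (intro smooth_on_vec_lambda smooth_on_mult smooth_on_det smooth_on_inverse)
      (auto simp: invertible_det_nz)
  then show ?thesis
    by (subst smooth_on_cong[OF assms(1), of _ "\<lambda>x. \<chi> k l. ?B x k l"]) (simp_all add: eq)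
qed

section \<open>Symmetry of second derivatives\<close>

lemma DERIV_along_line:
  fixes f :: "'a::real_normed_vector \<Rightarrow> real"
  assumes "(f has_derivative f') (at (p + r *\<^sub>R u))"
  shows "DERIV (\<lambda>\<sigma>. f (p + \<sigma> *\<^sub>R u)) r :> f' u"
proof -
  have "((\<lambda>\<sigma>. p + \<sigma> *\<^sub>R u) has_derivative (\<lambda>\<sigma>. \<sigma> *\<^sub>R u)) (at r)"
    using has_derivative_add[OF has_derivative_const has_derivative_scaleR_left[OF has_derivative_ident]]
    by simp
  from has_derivative_compose[OF this assms]
  have "((\<lambda>\<sigma>. f (p + \<sigma> *\<^sub>R u)) has_derivative (\<lambda>\<sigma>. f' (\<sigma> *\<^sub>R u))) (at r)" .
  moreover have "(\<lambda>\<sigma>. f' (\<sigma> *\<^sub>R u)) = (*) (f' u)"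
    using has_derivative_linear[OF assms] by (auto simp: linear_cmul)
  ultimately show ?thesis by (simp add: has_field_derivative_def)
qed

text \<open>Two applications of the mean value theorem to the second difference of \<open>f\<close>.\<close>

lemma second_difference_mean_value:
  fixes f :: "'a::real_normed_vector \<Rightarrow> real"
  assumes "open S" "Ck_on 2 S f" "s > 0"
    and S: "\<And>\<sigma> \<tau>. 0 \<le> \<sigma> \<Longrightarrow> \<sigma> \<le> s \<Longrightarrow> 0 \<le> \<tau> \<Longrightarrow> \<tau> \<le> s \<Longrightarrow> x + \<sigma> *\<^sub>R u + \<tau> *\<^sub>R v \<in> S"
  shows "\<exists>\<sigma> \<tau>. 0 \<le> \<sigma> \<and> \<sigma> \<le> s \<and> 0 \<le> \<tau> \<and> \<tau> \<le> s \<and>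
    f (x + s *\<^sub>R u + s *\<^sub>R v) - f (x + s *\<^sub>R u) - f (x + s *\<^sub>R v) + f x
      = s\<^sup>2 * frechet_derivative (\<lambda>y. frechet_derivative f (at y) u) (at (x + \<sigma> *\<^sub>R u + \<tau> *\<^sub>R v)) v"
proof -
  have diff: "f differentiable_on S" "(\<lambda>y. frechet_derivative f (at y) u) differentiable_on S"
    using assms(2) by (auto simp: numeral_2_eq_2)
  have swap: "x + \<tau> *\<^sub>R v + \<sigma> *\<^sub>R u = x + \<sigma> *\<^sub>R u + \<tau> *\<^sub>R v" for \<sigma> \<tau>
    by (simp add: ac_simps)
  \<comment> \<open>The second difference is g(s) - g(0), with the increment along v kept inside g;
    the first mean value makes it s times an increment along v of the u-derivative.\<close>
  define g where "g \<sigma> = f (x + s *\<^sub>R v + \<sigma> *\<^sub>R u) - f (x + \<sigma> *\<^sub>R u)" for \<sigma>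
  define g' where "g' \<sigma> = frechet_derivative f (at (x + s *\<^sub>R v + \<sigma> *\<^sub>R u)) u
    - frechet_derivative f (at (x + \<sigma> *\<^sub>R u)) u" for \<sigma>
  have "DERIV g \<sigma> :> g' \<sigma>" if "0 \<le> \<sigma>" "\<sigma> \<le> s" for \<sigma>
  proof -
    have "x + s *\<^sub>R v + \<sigma> *\<^sub>R u \<in> S" "x + \<sigma> *\<^sub>R u \<in> S"
      using S[OF that, of s] S[OF that, of 0] \<open>s > 0\<close> by (auto simp: swap)
    then show ?thesis
      unfolding g_def g'_def
      by (intro DERIV_diff DERIV_along_line differentiable_on_has_derivative[OF diff(1) assms(1)])
  qed
  then obtain \<sigma> where \<sigma>: "0 < \<sigma>" "\<sigma> < s" "g s - g 0 = s * g' \<sigma>"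
    using MVT2[of 0 s g g'] \<open>s > 0\<close> by auto
  \<comment> \<open>The remaining increment of the u-derivative, taken at the \<sigma> just found,
    is where the mean value theorem is used again.\<close>
  define k where "k \<tau> = frechet_derivative f (at (x + \<sigma> *\<^sub>R u + \<tau> *\<^sub>R v)) u" for \<tau>
  define k' where "k' \<tau> = frechet_derivative (\<lambda>y. frechet_derivative f (at y) u)
    (at (x + \<sigma> *\<^sub>R u + \<tau> *\<^sub>R v)) v" for \<tau>
  have "DERIV k \<tau> :> k' \<tau>" if "0 \<le> \<tau>" "\<tau> \<le> s" for \<tau>
    unfolding k_def k'_def using S[of \<sigma> \<tau>] \<sigma> that
    by (intro DERIV_along_line differentiable_on_has_derivative[OF diff(2) assms(1)]) auto
  then obtain \<tau> where \<tau>: "0 < \<tau>" "\<tau> < s" "k s - k 0 = s * k' \<tau>"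
    using MVT2[of 0 s k k'] \<open>s > 0\<close> by auto
  have "g s - g 0 = s\<^sup>2 * k' \<tau>"
    using \<sigma>(3) \<tau>(3) by (simp add: g'_def k_def power2_eq_square swap)
  moreover have "g s - g 0 = f (x + s *\<^sub>R u + s *\<^sub>R v) - f (x + s *\<^sub>R u) - f (x + s *\<^sub>R v) + f x"
    by (simp add: g_def swap)
  ultimately show ?thesis
    unfolding k'_def using \<sigma>(1,2) \<tau>(1,2) less_imp_le by metis
qed

text \<open>The second difference is unchanged when u and v are exchanged. Each mixed derivative
  reproduces it at some point of a small parallelogram, up to the common factor s^2, so by
  continuity the two cannot differ at x.\<close>

lemma second_derivative_symmetric_real:
  fixes f :: "'a::real_normed_vector \<Rightarrow> real"
  assumes S: "open S" "x \<in> S" and f: "Ck_on 2 S f"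
  shows "frechet_derivative (\<lambda>y. frechet_derivative f (at y) u) (at x) v
       = frechet_derivative (\<lambda>y. frechet_derivative f (at y) v) (at x) u"
proof (rule ccontr)
  let ?H = "\<lambda>u v y. frechet_derivative (\<lambda>y. frechet_derivative f (at y) u) (at y) v"
  assume "?H u v x \<noteq> ?H v u x"
  \<comment> \<open>Half of the supposed gap: two numbers within this distance of the two
    derivatives cannot coincide.\<close>
  then have e: "\<bar>?H u v x - ?H v u x\<bar> / 2 > 0" (is "?e > 0") by simp
  have cont: "isCont (?H u v) x" for u v
    using f S by (auto simp: numeral_2_eq_2 continuous_on_eq_continuous_at)
  obtain d1 where d1: "d1 > 0" "\<And>y. dist y x < d1 \<Longrightarrow> \<bar>?H u v y - ?H u v x\<bar> < ?e"
    using cont[of u v, unfolded continuous_at_eps_delta, rule_format, OF e] by (auto simp: dist_real_def)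
  obtain d2 where d2: "d2 > 0" "\<And>y. dist y x < d2 \<Longrightarrow> \<bar>?H v u y - ?H v u x\<bar> < ?e"
    using cont[of v u, unfolded continuous_at_eps_delta, rule_format, OF e] by (auto simp: dist_real_def)
  obtain d3 where d3: "d3 > 0" "ball x d3 \<subseteq> S"
    using S openE by blast
  define d where "d = min d1 (min d2 d3)"
  \<comment> \<open>Small enough that the parallelogram spanned by s u and s v stays within d of x;
    the summand 1 keeps the denominator positive when both vectors are 0.\<close>
  define s where "s = d / (2 * (norm u + norm v + 1))"
  have d: "d > 0" using d1 d2 d3 by (simp add: d_def)
  have s: "s > 0" using d by (simp add: s_def add_nonneg_pos)
  have near: "dist (x + \<sigma> *\<^sub>R u + \<tau> *\<^sub>R v) x < d"
    if "0 \<le> \<sigma>" "\<sigma> \<le> s" "0 \<le> \<tau>" "\<tau> \<le> s" for \<sigma> \<tau>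
  proof -
    have "dist (x + \<sigma> *\<^sub>R u + \<tau> *\<^sub>R v) x \<le> \<sigma> * norm u + \<tau> * norm v"
      using norm_triangle_ineq[of "\<sigma> *\<^sub>R u" "\<tau> *\<^sub>R v"] that by (simp add: dist_norm)
    also have "\<dots> \<le> s * norm u + s * norm v"
      using that by (intro add_mono mult_right_mono) auto
    also have "\<dots> < s * (2 * (norm u + norm v + 1))"
    proof -
      have "0 < s * (norm u + norm v + 2)"
        using s by (intro mult_pos_pos) (simp_all add: add_nonneg_pos)
      then show ?thesis by (simp add: algebra_simps)
    qed
    also have "\<dots> = d"
    proof -
      have "norm u + norm v + 1 \<noteq> 0"
        by (metis add_nonneg_pos add_nonneg_nonneg less_irrefl norm_ge_zero zero_less_one)
      then show ?thesis by (simp add: s_def)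
    qed
    finally show ?thesis .
  qed
  then have inS: "x + \<sigma> *\<^sub>R u + \<tau> *\<^sub>R v \<in> S"
    if "0 \<le> \<sigma>" "\<sigma> \<le> s" "0 \<le> \<tau>" "\<tau> \<le> s" for \<sigma> \<tau>
    using that d3 by (force simp: d_def dist_commute)
  obtain \<sigma> \<tau> where 1: "0 \<le> \<sigma>" "\<sigma> \<le> s" "0 \<le> \<tau>" "\<tau> \<le> s"
    "f (x + s *\<^sub>R u + s *\<^sub>R v) - f (x + s *\<^sub>R u) - f (x + s *\<^sub>R v) + f x
      = s\<^sup>2 * ?H u v (x + \<sigma> *\<^sub>R u + \<tau> *\<^sub>R v)"
    using second_difference_mean_value[OF S(1) f s inS] by blast
  have swap: "x + \<tau> *\<^sub>R v + \<sigma> *\<^sub>R u = x + \<sigma> *\<^sub>R u + \<tau> *\<^sub>R v" for \<sigma> \<tau>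
    by (simp add: ac_simps)
  have inS': "x + \<tau> *\<^sub>R v + \<sigma> *\<^sub>R u \<in> S"
    if "0 \<le> \<tau>" "\<tau> \<le> s" "0 \<le> \<sigma>" "\<sigma> \<le> s" for \<sigma> \<tau>
    unfolding swap using inS that by blast
  obtain \<sigma>' \<tau>' where 2: "0 \<le> \<sigma>'" "\<sigma>' \<le> s" "0 \<le> \<tau>'" "\<tau>' \<le> s"
    "f (x + s *\<^sub>R v + s *\<^sub>R u) - f (x + s *\<^sub>R v) - f (x + s *\<^sub>R u) + f x
      = s\<^sup>2 * ?H v u (x + \<sigma>' *\<^sub>R v + \<tau>' *\<^sub>R u)"
    using second_difference_mean_value[OF S(1) f s inS'] by blast
  have "s\<^sup>2 * ?H u v (x + \<sigma> *\<^sub>R u + \<tau> *\<^sub>R v) = s\<^sup>2 * ?H v u (x + \<tau>' *\<^sub>R u + \<sigma>' *\<^sub>R v)"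
    using 1(5) 2(5) unfolding swap by linarith
  then have 3: "?H u v (x + \<sigma> *\<^sub>R u + \<tau> *\<^sub>R v) = ?H v u (x + \<tau>' *\<^sub>R u + \<sigma>' *\<^sub>R v)"
    using s by simp
  have 4: "\<bar>?H u v (x + \<sigma> *\<^sub>R u + \<tau> *\<^sub>R v) - ?H u v x\<bar> < ?e"
    using d1(2) near[OF 1(1-4)] by (simp add: d_def)
  have 5: "\<bar>?H v u (x + \<tau>' *\<^sub>R u + \<sigma>' *\<^sub>R v) - ?H v u x\<bar> < ?e"
    using d2(2) near[OF 2(3,4,1,2)] by (simp add: d_def)
  have "p \<noteq> q" if "\<bar>p - a\<bar> < \<bar>a - b\<bar> / 2" "\<bar>q - b\<bar> < \<bar>a - b\<bar> / 2" for a b p q :: real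
    using that by (auto simp: abs_if split: if_splits)
  from this[OF 4 5] 3 show False by (rule notE)
qed

text \<open>Pairing with a fixed vector commutes with differentiation, which reduces the claim to
  real-valued functions.\<close>

lemma second_derivative_symmetric:
  fixes f :: "'a::real_normed_vector \<Rightarrow> 'b::real_inner"
  assumes S: "open S" "x \<in> S" and f: "smooth_on S f"
  shows "frechet_derivative (\<lambda>y. frechet_derivative f (at y) u) (at x) v
       = frechet_derivative (\<lambda>y. frechet_derivative f (at y) v) (at x) u"
proof -
  have inner: "frechet_derivative (\<lambda>y. g y \<bullet> e) (at y) w = frechet_derivative g (at y) w \<bullet> e"
    if "smooth_on S g" "y \<in> S" for g :: "'a \<Rightarrow> 'b" and e y w
    using frechet_derivative_eqI[OF has_derivative_inner_left[OF
          smooth_on_has_derivative[OF that(1) S(1) that(2)]]] by simp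
  have "frechet_derivative (\<lambda>y. frechet_derivative f (at y) u) (at x) v \<bullet> e
      = frechet_derivative (\<lambda>y. frechet_derivative (\<lambda>y. f y \<bullet> e) (at y) u) (at x) v" for e u v
  proof -
    have D: "smooth_on S (\<lambda>y. frechet_derivative f (at y) u)"
      using f by (rule smooth_on_frechet_derivative)
    have "((\<lambda>y. frechet_derivative (\<lambda>y. f y \<bullet> e) (at y) u) has_derivative
        (\<lambda>w. frechet_derivative (\<lambda>y. frechet_derivative f (at y) u) (at x) w \<bullet> e)) (at x)"
      using has_derivative_inner_left[OF smooth_on_has_derivative[OF D S], of e] S
      by (rule has_derivative_transform_within_open) (simp add: inner[OF f])
    then show ?thesis by (subst frechet_derivative_eqI) simp_all
  qed
  moreover have "smooth_on S (\<lambda>y. f y \<bullet> e)" for e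
    using smooth_on_linear_compose[OF bounded_linear_inner_left S(1) f] .
  ultimately have "(frechet_derivative (\<lambda>y. frechet_derivative f (at y) u) (at x) v
       - frechet_derivative (\<lambda>y. frechet_derivative f (at y) v) (at x) u) \<bullet> e = 0" for e
    using second_derivative_symmetric_real[OF S, of "\<lambda>y. f y \<bullet> e" u v]
    unfolding smooth_on_def by (simp add: inner_diff_left)
  \<comment> \<open>Pairing the difference with itself makes its norm vanish.\<close>
  from this[of "frechet_derivative (\<lambda>y. frechet_derivative f (at y) u) (at x) v
       - frechet_derivative (\<lambda>y. frechet_derivative f (at y) v) (at x) u"]
  show ?thesis by simp
qed

subsection \<open>Matrices\<close>

lemma bounded_bilinear_matrix_mult:
  "bounded_bilinear ((**) :: real^'n::finite^'m::finite \<Rightarrow> real^'k::finite^'n \<Rightarrow> real^'k^'m)"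
proof -
  have "bilinear ((**) :: real^'n^'m \<Rightarrow> real^'k^'n \<Rightarrow> real^'k^'m)"
    unfolding bilinear_def
    by (auto intro!: linearI simp: matrix_add_ldistrib vec_eq_iff matrix_matrix_mult_def
        sum.distrib sum_distrib_left algebra_simps)
  then show ?thesis by (simp add: bilinear_conv_bounded_bilinear)
qed

interpretation matrix_mult: bounded_bilinear "(**) :: real^'n::finite^'m::finite \<Rightarrow> real^'k::finite^'n \<Rightarrow> real^'k^'m"
  by (rule bounded_bilinear_matrix_mult)

lemmas matrix_algebra = matrix_mult.add_left matrix_mult.add_right matrix_mult.diff_left
  matrix_mult.diff_right matrix_mult.minus_left matrix_mult.minus_right matrix_mult.zero_left
  matrix_mult.zero_right matrix_mul_assoc

lemma bounded_linear_transpose: "bounded_linear (transpose :: real^'n::finite^'m::finite \<Rightarrow> real^'m^'n)"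
  by (auto simp: linear_conv_bounded_linear[symmetric] vec_eq_iff transpose_def intro!: linearI)

lemmas transpose_algebra = bounded_linear.linear[OF bounded_linear_transpose, THEN linear_add]
  bounded_linear.linear[OF bounded_linear_transpose, THEN linear_diff]
  bounded_linear.linear[OF bounded_linear_transpose, THEN linear_neg]

lemma smooth_on_matrix_mult:
  fixes A :: "'a::real_normed_vector \<Rightarrow> real^'n::finite^'m::finite" and B :: "'a \<Rightarrow> real^'k::finite^'n"
  shows "open S \<Longrightarrow> smooth_on S A \<Longrightarrow> smooth_on S B \<Longrightarrow> smooth_on S (\<lambda>x. A x ** B x)"
  by (rule smooth_on_bilinear[OF bounded_bilinear_matrix_mult])

text \<open>Differentiate G A = 1 and solve for G'. That G is differentiable at all comes from
  Cramer's rule.\<close>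

lemma matrix_inv_has_derivative:
  fixes A :: "'a::real_normed_vector \<Rightarrow> real^'n::finite^'n"
  assumes U: "open U" "x \<in> U" and A: "smooth_on U A" "\<And>y. y \<in> U \<Longrightarrow> invertible (A y)"
  shows "((\<lambda>y. matrix_inv (A y)) has_derivative
    (\<lambda>a. - (matrix_inv (A x) ** frechet_derivative A (at x) a ** matrix_inv (A x)))) (at x)"
proof -
  let ?G = "matrix_inv (A x)" and ?G' = "frechet_derivative (\<lambda>y. matrix_inv (A y)) (at x)"
    and ?A' = "frechet_derivative A (at x)"
  have G: "((\<lambda>y. matrix_inv (A y)) has_derivative ?G') (at x)"
    using smooth_on_has_derivative[OF smooth_on_matrix_inv[OF U(1) A] U] .
  have "((\<lambda>y. matrix_inv (A y) ** A y) has_derivative (\<lambda>a. ?G ** ?A' a + ?G' a ** A x)) (at x)"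
    using matrix_mult.FDERIV[OF G smooth_on_has_derivative[OF A(1) U]] .
  then have "((\<lambda>y. mat 1) has_derivative (\<lambda>a. ?G ** ?A' a + ?G' a ** A x)) (at x)"
    using U by (rule has_derivative_transform_within_open) (rule matrix_inv(2)[OF A(2)])
  from has_derivative_unique[OF this has_derivative_const]
  have eq: "?G ** ?A' a + ?G' a ** A x = 0" for a by metis
  have "?G' a = - (?G ** ?A' a ** ?G)" for a
  proof -
    have "?G' a = ?G' a ** A x ** ?G"
      by (simp add: matrix_mul_assoc[symmetric] matrix_inv(1) A(2) U(2))
    also have "?G' a ** A x = - (?G ** ?A' a)"
      using eq[of a] by (simp add: eq_neg_iff_add_eq_0 add.commute)
    finally show ?thesis by (simp add: matrix_algebra)
  qed
  then show ?thesis by (intro has_derivative_eq_rhs[OF G] ext)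
qed

lemma transpose_nth: "transpose A $ i $ j = A $ j $ i"
  by (simp add: transpose_def)

lemma matrix_eq_zeroI:
  fixes A :: "real^'n::finite^'m::finite"
  assumes "\<And>u v. u \<bullet> (A *v v) = 0"
  shows "A = 0"
proof -
  have "A *v v = 0" for v using assms[of "A *v v" v] by simp
  then show ?thesis by (simp add: matrix_eq)
qed

lemma inner_matrix_transpose: "(u::real^'n::finite) \<bullet> (transpose A *v v) = (A *v u) \<bullet> v"
  by (metis dot_lmul_matrix transpose_matrix_vector inner_commute)

lemma frechet_derivative_vec_nth:
  fixes f :: "'a::real_normed_vector \<Rightarrow> ('b::real_normed_vector)^'i::finite"
  assumes "(f has_derivative f') (at x)"
  shows "frechet_derivative (\<lambda>y. f y $ i) (at x) v = f' v $ i"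
  using frechet_derivative_eqI[OF bounded_linear.has_derivative[OF bounded_linear_vec_nth assms]] by simp

lemma pd_matrix_entry:
  fixes f :: "real^'i::finite \<Rightarrow> real^'n::finite^'m::finite"
  assumes "(f has_derivative f') (at x)"
  shows "pd k (\<lambda>y. f y $ i $ j) x = f' (axis k 1) $ i $ j"
  unfolding pd_def
  by (rule frechet_derivative_vec_nth) (rule bounded_linear.has_derivative[OF bounded_linear_vec_nth assms])

lemma smooth_on_pd: "smooth_on S f \<Longrightarrow> smooth_on S (pd i f)"
  unfolding pd_def by (rule smooth_on_frechet_derivative)

lemma linear_axis_expansion:
  fixes f :: "real^'i::finite \<Rightarrow> 'b::real_vector"
  assumes "linear f"
  shows "f v = (\<Sum>j\<in>UNIV. v $ j *\<^sub>R f (axis j 1))"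
proof -
  have "f v = f (\<Sum>j\<in>UNIV. v $ j *\<^sub>R axis j 1)"
    using basis_expansion[of v] by (simp add: scalar_mult_eq_scaleR)
  also have "\<dots> = (\<Sum>j\<in>UNIV. v $ j *\<^sub>R f (axis j 1))"
    using assms by (simp add: linear_sum linear_cmul)
  finally show ?thesis .
qed

subsection \<open>The Levi-Civita connection of a metric in a chart\<close>

text \<open>The connection form \<Gamma>(a) as an endomorphism. With the direction of
  differentiation as argument, contracted products of Christoffel symbols become matrix
  products.\<close>

definition christoffel_matrix :: "(real^'i::finite \<Rightarrow> real^'i^'i) \<Rightarrow> real^'i \<Rightarrow> real^'i \<Rightarrow> real^'i^'i" where
  "christoffel_matrix g x a = (\<chi> k i. \<Sum>j\<in>UNIV. christoffel g x k i j * a $ j)"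

text \<open>The curvature form d\<Gamma> + \<Gamma> \<and> \<Gamma> on the constant fields a and b,
  that is, the endomorphism R(a,b).\<close>

definition curvature_matrix :: "(real^'i::finite \<Rightarrow> real^'i^'i) \<Rightarrow> real^'i \<Rightarrow> real^'i \<Rightarrow> real^'i \<Rightarrow> real^'i^'i" where
  "curvature_matrix g x a b =
     frechet_derivative (\<lambda>y. christoffel_matrix g y b) (at x) a
     - frechet_derivative (\<lambda>y. christoffel_matrix g y a) (at x) b
     + christoffel_matrix g x a ** christoffel_matrix g x b
     - christoffel_matrix g x b ** christoffel_matrix g x a"

lemma christoffel_matrix_axis: "christoffel_matrix g x (axis j 1) $ k $ i = christoffel g x k i j"
  by (simp add: christoffel_matrix_def axis_def if_distrib[of "(*) _"] cong: if_cong)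

lemma linear_christoffel_matrix: "linear (christoffel_matrix g x)"
  by (auto intro!: linearI simp: christoffel_matrix_def vec_eq_iff algebra_simps sum.distrib sum_distrib_left)

lemma curvature_matrix_antisym: "curvature_matrix g x b a = - curvature_matrix g x a b"
  by (simp add: curvature_matrix_def)

text \<open>One interface for both factors: it is instantiated by \<open>h\<close> in charts of T
  and by \<phi> in charts of M.\<close>

locale chart_metric =
  fixes g :: "real^'i::finite \<Rightarrow> real^'i^'i" and S :: "(real^'i) set"
  assumes open_domain: "open S"
    and smooth: "smooth_on S g"
    and symmetric: "x \<in> S \<Longrightarrow> transpose (g x) = g x"
    and positive: "x \<in> S \<Longrightarrow> u \<noteq> 0 \<Longrightarrow> u \<bullet> (g x *v u) > 0"
begin

lemma invertible: assumes "x \<in> S" shows "invertible (g x)"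
proof -
  have "u = 0" if "g x *v u = 0" for u
    using positive[OF assms, of u] that by force
  then show ?thesis
    by (simp add: invertible_left_inverse matrix_left_invertible_ker)
qed

lemmas inverse_right = matrix_inv(1)[OF invertible]
lemmas inverse_left = matrix_inv(2)[OF invertible]

lemma inverse_symmetric: assumes "x \<in> S" shows "transpose (matrix_inv (g x)) = matrix_inv (g x)"
proof -
  have "transpose (matrix_inv (g x)) ** g x = mat 1"
    using arg_cong[OF inverse_right[OF assms], of transpose] symmetric[OF assms]
    by (simp add: matrix_transpose_mul)
  then have "transpose (matrix_inv (g x)) ** (g x ** matrix_inv (g x)) = matrix_inv (g x)"
    by (simp add: matrix_mul_assoc)
  then show ?thesis by (simp add: inverse_right assms)
qed

lemma inverse_entries_symmetric: "x \<in> S \<Longrightarrow> matrix_inv (g x) $ i $ j = matrix_inv (g x) $ j $ i"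
  using inverse_symmetric[of x] by (metis transpose_nth)

lemma entries_symmetric: "x \<in> S \<Longrightarrow> g x $ i $ j = g x $ j $ i"
  using symmetric[of x] by (metis transpose_nth)

lemma smooth_inverse: "smooth_on S (\<lambda>x. matrix_inv (g x))"
  using smooth_on_matrix_inv[OF open_domain smooth] invertible .

lemma has_derivative: "x \<in> S \<Longrightarrow> (g has_derivative frechet_derivative g (at x)) (at x)"
  using smooth_on_has_derivative[OF smooth open_domain] .

lemma pd_eq: "x \<in> S \<Longrightarrow> pd k (\<lambda>y. g y $ i $ j) x = frechet_derivative g (at x) (axis k 1) $ i $ j"
  using pd_matrix_entry[OF has_derivative] .

lemma derivative_symmetric:
  assumes "x \<in> S" shows "transpose (frechet_derivative g (at x) a) = frechet_derivative g (at x) a"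
proof -
  have "((\<lambda>y. transpose (g y)) has_derivative (\<lambda>a. transpose (frechet_derivative g (at x) a))) (at x)"
    using bounded_linear.has_derivative[OF bounded_linear_transpose has_derivative[OF assms]] .
  then have "(g has_derivative (\<lambda>a. transpose (frechet_derivative g (at x) a))) (at x)"
    using open_domain assms by (rule has_derivative_transform_within_open) (rule symmetric)
  from frechet_derivative_eqI[OF this] show ?thesis by metis
qed

lemma smooth_christoffel: "smooth_on S (\<lambda>x. christoffel g x k i j)"
proof -
  have "smooth_on S (pd a (\<lambda>y. g y $ b $ c))" for a b c
    using smooth open_domain by (intro smooth_on_pd smooth_on_vec_nth)
  moreover have "smooth_on S (\<lambda>x. matrix_inv (g x) $ b $ c)" for b c
    using smooth_inverse open_domain by (intro smooth_on_vec_nth)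
  ultimately show ?thesis
    unfolding christoffel_def using open_domain
    by (intro smooth_on_mult smooth_on_sum smooth_on_add smooth_on_diff smooth_on_const)
qed

lemma smooth_christoffel_matrix: "smooth_on S (\<lambda>x. christoffel_matrix g x a)"
  unfolding christoffel_matrix_def using smooth_christoffel open_domain
  by (intro smooth_on_vec_lambda smooth_on_sum smooth_on_mult smooth_on_const)

lemma christoffel_symmetric: assumes "x \<in> S" shows "christoffel g x k i j = christoffel g x k j i"
proof -
  have "frechet_derivative g (at x) a $ i $ j = frechet_derivative g (at x) a $ j $ i" for a
    using derivative_symmetric[OF assms] by (metis transpose_nth)
  then show ?thesis
    unfolding christoffel_def by (simp add: pd_eq assms add.commute)
qed

text \<open>Vanishing torsion, in the form used to recognise the Levi-Civita connection.\<close>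

lemma christoffel_matrix_commute:
  assumes "x \<in> S" shows "christoffel_matrix g x a *v b = christoffel_matrix g x b *v a"
proof -
  have "(\<Sum>i\<in>UNIV. \<Sum>j\<in>UNIV. christoffel g x k i j * a $ j * b $ i)
      = (\<Sum>i\<in>UNIV. \<Sum>j\<in>UNIV. christoffel g x k i j * b $ j * a $ i)" for k
    by (subst sum.swap) (simp add: christoffel_symmetric[OF assms, of k] mult_ac)
  then show ?thesis
    by (simp add: vec_eq_iff matrix_vector_mult_def christoffel_matrix_def sum_distrib_right)
qed

text \<open>Lowering the upper index cancels the inverse matrix and leaves the Christoffel symbol of
  the first kind.\<close>

lemma christoffel_lower:
  assumes "x \<in> S"
  shows "(\<Sum>k\<in>UNIV. g x $ l $ k * christoffel g x k i j)
    = 1/2 * (pd i (\<lambda>y. g y $ l $ j) x + pd j (\<lambda>y. g y $ l $ i) x - pd l (\<lambda>y. g y $ i $ j) x)"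
proof -
  let ?c = "\<lambda>m. pd i (\<lambda>y. g y $ m $ j) x + pd j (\<lambda>y. g y $ m $ i) x - pd m (\<lambda>y. g y $ i $ j) x"
  have "(\<Sum>k\<in>UNIV. g x $ l $ k * christoffel g x k i j)
      = (\<Sum>k\<in>UNIV. \<Sum>m\<in>UNIV. g x $ l $ k * matrix_inv (g x) $ k $ m * (1/2 * ?c m))"
    unfolding christoffel_def sum_distrib_left by (intro sum.cong refl) (simp add: mult_ac)
  also have "\<dots> = (\<Sum>m\<in>UNIV. (g x ** matrix_inv (g x)) $ l $ m * (1/2 * ?c m))"
    by (subst sum.swap) (simp add: matrix_matrix_mult_def sum_distrib_right sum_divide_distrib)
  also have "\<dots> = (\<Sum>m\<in>UNIV. if m = l then 1/2 * ?c m else 0)"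
    by (intro sum.cong refl) (simp add: inverse_right assms mat_def)
  finally show ?thesis by simp
qed

text \<open>Metric compatibility, \<nabla>g = 0. Adding the lowered symbol to its transpose cancels
  the two derivatives that are not along a, because g is symmetric.\<close>

lemma derivative_metric:
  assumes "x \<in> S"
  shows "frechet_derivative g (at x) a
    = g x ** christoffel_matrix g x a + transpose (g x ** christoffel_matrix g x a)"
proof -
  let ?d = "\<lambda>k i j. pd k (\<lambda>y. g y $ i $ j) x"
  have low: "(g x ** christoffel_matrix g x a) $ l $ i
      = (\<Sum>j\<in>UNIV. 1/2 * (?d i l j + ?d j l i - ?d l i j) * a $ j)" for l i
  proof -
    have "(g x ** christoffel_matrix g x a) $ l $ i
        = (\<Sum>k\<in>UNIV. \<Sum>j\<in>UNIV. g x $ l $ k * christoffel g x k i j * a $ j)"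
      by (simp add: matrix_matrix_mult_def christoffel_matrix_def sum_distrib_left mult_ac)
    also have "\<dots> = (\<Sum>j\<in>UNIV. (\<Sum>k\<in>UNIV. g x $ l $ k * christoffel g x k i j) * a $ j)"
      by (subst sum.swap) (simp add: sum_distrib_right)
    finally show ?thesis by (simp add: christoffel_lower assms)
  qed
  have sym: "?d k i j = ?d k j i" for k i j
    using derivative_symmetric[OF assms] unfolding pd_eq[OF assms] by (metis transpose_nth)
  have "frechet_derivative g (at x) a $ l $ i = (\<Sum>j\<in>UNIV. ?d j l i * a $ j)" for l i
    by (subst linear_axis_expansion[OF has_derivative_linear[OF has_derivative[OF assms]]])
      (simp add: pd_eq assms mult.commute)
  moreover have "(g x ** christoffel_matrix g x a + transpose (g x ** christoffel_matrix g x a)) $ l $ i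
      = (\<Sum>j\<in>UNIV. ?d j l i * a $ j)" for l i
  proof -
    have "(g x ** christoffel_matrix g x a + transpose (g x ** christoffel_matrix g x a)) $ l $ i
        = (\<Sum>j\<in>UNIV. 1/2 * (?d i l j + ?d j l i - ?d l i j) * a $ j + 1/2 * (?d l i j + ?d j i l - ?d i l j) * a $ j)"
      by (simp only: vector_add_component transpose_def vec_lambda_beta low sum.distrib)
    also have "\<dots> = (\<Sum>j\<in>UNIV. ?d j l i * a $ j)"
    proof (intro sum.cong refl)
      show "1/2 * (?d i l j + ?d j l i - ?d l i j) * a $ j + 1/2 * (?d l i j + ?d j i l - ?d i l j) * a $ j
          = ?d j l i * a $ j" for j
        using sym[of j i l] by (simp add: algebra_simps)
    qed
    finally show ?thesis .
  qed
  ultimately show ?thesis by (simp add: vec_eq_iff)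
qed

text \<open>The difference of two torsion-free metric connections, lowered, is a trilinear form that is
  symmetric in two slots and antisymmetric in two others.\<close>

lemma levi_civita_unique:
  assumes x: "x \<in> S" and commute: "\<And>a b. A a *v b = A b *v a"
    and metric: "\<And>a. frechet_derivative g (at x) a = g x ** A a + transpose (g x ** A a)"
  shows "A a = christoffel_matrix g x a"
proof -
  define B where "B a = g x ** (A a - christoffel_matrix g x a)" for a
  have sym: "B a *v b = B b *v a" for a b
    by (simp add: B_def matrix_vector_mul_assoc[symmetric] matrix_vector_mult_diff_rdistrib
        commute[of a b] christoffel_matrix_commute[OF x, of a b])
  have "B a + transpose (B a) = 0" for a
    using metric[of a] derivative_metric[OF x, of a]
    by (simp add: B_def matrix_algebra transpose_algebra algebra_simps)
  then have skew: "transpose (B a) = - B a" for a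
    by (metis add.inverse_unique)
  define c where "c a b e = e \<bullet> (B a *v b)" for a b e
  have c1: "c a b e = c b a e" for a b e by (simp add: c_def sym)
  have c2: "c a b e = - c a e b" for a b e
  proof -
    have "c a b e = (transpose (B a) *v e) \<bullet> b"
      unfolding c_def by (metis inner_commute inner_matrix_transpose transpose_transpose)
    also have "\<dots> = - c a e b"
    proof -
      have "- B a *v e = - (B a *v e)"
        by (simp add: vec_eq_iff matrix_vector_mult_def sum_negf)
      then show ?thesis unfolding skew c_def by (simp add: inner_commute)
    qed
    finally show ?thesis .
  qed
  \<comment> \<open>Alternately exchanging the first two and the last two slots, six times in all,
    returns to the start with three sign changes, so c equals its own negative.\<close>
  have "c a b e = 0" for a b e
    using c1[of a b e] c2[of b a e] c1[of b e a] c2[of e b a] c1[of e a b] c2[of a e b] by simp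
  then have "B a = 0" by (intro matrix_eq_zeroI) (simp add: c_def)
  then have "matrix_inv (g x) ** B a = 0" by (simp add: matrix_algebra)
  then show ?thesis by (simp add: B_def matrix_mul_assoc inverse_left x)
qed

text \<open>The inverse metric G is parallel as well: substitute \<open>derivative_metric\<close>
  into -G g' G.\<close>

lemma inverse_has_derivative:
  assumes "x \<in> S"
  shows "((\<lambda>y. matrix_inv (g y)) has_derivative
    (\<lambda>a. - (christoffel_matrix g x a ** matrix_inv (g x))
       - matrix_inv (g x) ** transpose (christoffel_matrix g x a))) (at x)"
proof -
  let ?G = "matrix_inv (g x)"
  have "- (?G ** frechet_derivative g (at x) a ** ?G)
      = - ((?G ** g x) ** christoffel_matrix g x a ** ?G) - ?G ** transpose (christoffel_matrix g x a) ** (g x ** ?G)" for a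
    unfolding derivative_metric[OF assms] matrix_transpose_mul symmetric[OF assms]
    by (simp add: matrix_algebra)
  then have "- (?G ** frechet_derivative g (at x) a ** ?G)
      = - (christoffel_matrix g x a ** ?G) - ?G ** transpose (christoffel_matrix g x a)" for a
    by (simp add: inverse_right inverse_left assms)
  then show ?thesis
    by (intro has_derivative_eq_rhs[OF matrix_inv_has_derivative[OF open_domain assms smooth invertible]] ext)
qed

section \<open>Curvature of a metric and the Bianchi identity\<close>

lemma christoffel_matrix_has_derivative:
  "x \<in> S \<Longrightarrow> ((\<lambda>y. christoffel_matrix g y a) has_derivative
     frechet_derivative (\<lambda>y. christoffel_matrix g y a) (at x)) (at x)"
  using smooth_on_has_derivative[OF smooth_christoffel_matrix open_domain] .

lemma second_derivative_christoffel_matrix: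
  assumes "x \<in> S"
  shows "frechet_derivative (\<lambda>y. frechet_derivative (\<lambda>y. christoffel_matrix g y a) (at y) b) (at x) c
       = frechet_derivative (\<lambda>y. frechet_derivative (\<lambda>y. christoffel_matrix g y a) (at y) c) (at x) b"
  using second_derivative_symmetric[OF open_domain assms smooth_christoffel_matrix] .

lemma smooth_curvature_matrix: "smooth_on S (\<lambda>x. curvature_matrix g x a b)"
  unfolding curvature_matrix_def using open_domain smooth_christoffel_matrix
  by (intro smooth_on_add smooth_on_diff smooth_on_matrix_mult smooth_on_frechet_derivative)

text \<open>The derivative of \<open>g\<^sup>-\<^sup>1\<close> is \<open>- \<Gamma> g\<^sup>-\<^sup>1 - g\<^sup>-\<^sup>1 \<Gamma>\<^sup>T\<close>; compare its two mixed second derivatives.\<close>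

lemma curvature_matrix_raised_skew:
  assumes x: "x \<in> S"
  shows "transpose (curvature_matrix g x a b ** matrix_inv (g x)) = - (curvature_matrix g x a b ** matrix_inv (g x))"
proof -
  let ?G = "\<lambda>y. matrix_inv (g y)" and ?C = "christoffel_matrix g"
  let ?D = "\<lambda>b. frechet_derivative (\<lambda>y. ?C y b) (at x)"
  let ?G' = "\<lambda>a. - (?C x a ** ?G x) - ?G x ** transpose (?C x a)"
  have "frechet_derivative (\<lambda>y. frechet_derivative ?G (at y) b) (at x) a
      = - (?C x b ** ?G' a + ?D b a ** ?G x) - (?G x ** transpose (?D b a) + ?G' a ** transpose (?C x b))"
    for a b
  proof -
    note C = christoffel_matrix_has_derivative[OF x, of b]
    note CT = bounded_linear.has_derivative[OF bounded_linear_transpose C]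
    note G = inverse_has_derivative[OF x]
    have "((\<lambda>y. - (?C y b ** ?G y) - ?G y ** transpose (?C y b)) has_derivative
        (\<lambda>a. - (?C x b ** ?G' a + ?D b a ** ?G x) - (?G x ** transpose (?D b a) + ?G' a ** transpose (?C x b)))) (at x)"
      by (intro has_derivative_diff has_derivative_minus matrix_mult.FDERIV[OF C G] matrix_mult.FDERIV[OF G CT])
    then have "((\<lambda>y. frechet_derivative ?G (at y) b) has_derivative
        (\<lambda>a. - (?C x b ** ?G' a + ?D b a ** ?G x) - (?G x ** transpose (?D b a) + ?G' a ** transpose (?C x b)))) (at x)"
      using open_domain x
      by (rule has_derivative_transform_within_open)
        (simp add: frechet_derivative_eqI[OF inverse_has_derivative])
    from frechet_derivative_eqI[OF this] show ?thesis by metis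
  qed
  with second_derivative_symmetric[OF open_domain x smooth_inverse, of b a]
  have "- (?C x b ** ?G' a + ?D b a ** ?G x) - (?G x ** transpose (?D b a) + ?G' a ** transpose (?C x b))
      = - (?C x a ** ?G' b + ?D a b ** ?G x) - (?G x ** transpose (?D a b) + ?G' b ** transpose (?C x a))"
    by simp
  \<comment> \<open>The terms \<Gamma>(a) G \<Gamma>(b)^T + \<Gamma>(b) G \<Gamma>(a)^T occur on
    both sides and drop out; the rest assembles into the curvature and its transpose.\<close>
  then have "curvature_matrix g x a b ** ?G x + ?G x ** transpose (curvature_matrix g x a b) = 0"
    by (simp add: curvature_matrix_def matrix_algebra transpose_algebra matrix_transpose_mul algebra_simps)
  then show ?thesis
    by (simp add: matrix_transpose_mul inverse_symmetric x eq_neg_iff_add_eq_0 add.commute)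
qed

lemma curvature_matrix_has_derivative:
  assumes x: "x \<in> S"
  shows "((\<lambda>y. curvature_matrix g y a b) has_derivative (\<lambda>c.
      frechet_derivative (\<lambda>y. frechet_derivative (\<lambda>y. christoffel_matrix g y b) (at y) a) (at x) c
      - frechet_derivative (\<lambda>y. frechet_derivative (\<lambda>y. christoffel_matrix g y a) (at y) b) (at x) c
      + (christoffel_matrix g x a ** frechet_derivative (\<lambda>y. christoffel_matrix g y b) (at x) c
         + frechet_derivative (\<lambda>y. christoffel_matrix g y a) (at x) c ** christoffel_matrix g x b)
      - (christoffel_matrix g x b ** frechet_derivative (\<lambda>y. christoffel_matrix g y a) (at x) c
         + frechet_derivative (\<lambda>y. christoffel_matrix g y b) (at x) c ** christoffel_matrix g x a))) (at x)"
proof -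
  have D: "((\<lambda>y. frechet_derivative (\<lambda>y. christoffel_matrix g y b) (at y) a) has_derivative
      frechet_derivative (\<lambda>y. frechet_derivative (\<lambda>y. christoffel_matrix g y b) (at y) a) (at x)) (at x)" for a b
    using smooth_on_has_derivative[OF smooth_on_frechet_derivative[OF smooth_christoffel_matrix] open_domain x] .
  note C = christoffel_matrix_has_derivative[OF x]
  show ?thesis
    unfolding curvature_matrix_def
    by (intro has_derivative_add has_derivative_diff D matrix_mult.FDERIV[OF C C])
qed

text \<open>\<open>D\<close> differentiates covariantly in the matrix indices only; the Christoffel
  terms for the arguments a and b would cancel in the cyclic sum by vanishing torsion. Second
  derivatives cancel by symmetry, terms with one derivative cancel against the commutators, and the
  cubic terms are the Jacobi identity.\<close>

lemma second_bianchi: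
  assumes x: "x \<in> S"
  defines "D \<equiv> \<lambda>c a b. frechet_derivative (\<lambda>y. curvature_matrix g y a b) (at x) c
    + christoffel_matrix g x c ** curvature_matrix g x a b
    - curvature_matrix g x a b ** christoffel_matrix g x c"
  shows "D c a b + D a b c + D b c a = 0"
  using second_derivative_christoffel_matrix[OF x, of a b c] second_derivative_christoffel_matrix[OF x, of b c a]
    second_derivative_christoffel_matrix[OF x, of c a b]
  unfolding D_def frechet_derivative_eqI[OF curvature_matrix_has_derivative[OF x]]
  by (simp add: curvature_matrix_def matrix_algebra algebra_simps)

text \<open>Since the inverse metric is parallel, \<open>E\<close> is the corresponding term of
  \<open>second_bianchi\<close> multiplied by it. With both matrix indices up,
  \<open>curvature_matrix_raised_skew\<close> can be used in the contraction.\<close>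

lemma second_bianchi_raised:
  assumes x: "x \<in> S"
  defines "R \<equiv> \<lambda>y a b. curvature_matrix g y a b ** matrix_inv (g y)"
  defines "E \<equiv> \<lambda>c a b. frechet_derivative (\<lambda>y. R y a b) (at x) c
    + christoffel_matrix g x c ** R x a b + R x a b ** transpose (christoffel_matrix g x c)"
  shows "E c a b + E a b c + E b c a = 0"
proof -
  let ?G = "matrix_inv (g x)"
  let ?D = "\<lambda>c a b. frechet_derivative (\<lambda>y. curvature_matrix g y a b) (at x) c
    + christoffel_matrix g x c ** curvature_matrix g x a b
    - curvature_matrix g x a b ** christoffel_matrix g x c"
  have E: "E c a b = ?D c a b ** ?G" for c a b
  proof -
    note C = smooth_on_has_derivative[OF smooth_curvature_matrix open_domain x, of a b]
    note R = matrix_mult.FDERIV[OF C inverse_has_derivative[OF x]]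
    show ?thesis
      unfolding E_def R_def frechet_derivative_eqI[OF R] by (simp add: matrix_algebra)
  qed
  have "E c a b + E a b c + E b c a = (?D c a b + ?D a b c + ?D b c a) ** ?G"
    unfolding E matrix_mult.add_left ..
  also have "\<dots> = 0"
    unfolding second_bianchi[OF x] by (rule matrix_mult.zero_left)
  finally show ?thesis .
qed

lemma pd_christoffel:
  assumes "x \<in> S"
  shows "pd a (\<lambda>y. christoffel g y k i j) x
    = frechet_derivative (\<lambda>y. christoffel_matrix g y (axis j 1)) (at x) (axis a 1) $ k $ i"
  using pd_matrix_entry[OF christoffel_matrix_has_derivative[OF assms, of "axis j 1"], of a k i]
  by (simp add: christoffel_matrix_axis)

text \<open>The trace pairs the first direction with the upper index. Smoothness and the Bianchi
  identity pass through it from the curvature form to the Ricci tensor.\<close>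

lemma ricci_eq_trace:
  assumes "x \<in> S"
  shows "ricci g x j k = (\<Sum>i\<in>UNIV. curvature_matrix g x (axis i 1) (axis k 1) $ i $ j)"
  unfolding ricci_def curvature_matrix_def
  by (simp add: pd_christoffel assms matrix_matrix_mult_def christoffel_matrix_axis sum_subtractf mult.commute algebra_simps)

lemma smooth_ricci: "smooth_on S (\<lambda>x. ricci g x j k)"
proof -
  have "smooth_on S (\<lambda>x. \<Sum>i\<in>UNIV. curvature_matrix g x (axis i 1) (axis k 1) $ i $ j)"
    using open_domain smooth_curvature_matrix by (intro smooth_on_sum smooth_on_vec_nth)
  then show ?thesis
    using smooth_on_cong[OF open_domain, of "\<lambda>x. ricci g x j k"] ricci_eq_trace by simp
qed

lemma smooth_scalar_curvature: "smooth_on S (scalar_curvature g)"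
  unfolding scalar_curvature_def using open_domain smooth_ricci smooth_inverse
  by (intro smooth_on_sum smooth_on_mult smooth_on_vec_nth)

end

section \<open>Double contraction of the Bianchi identity\<close>

lemma sum_antisymmetric:
  fixes f :: "'i \<Rightarrow> 'i \<Rightarrow> real"
  assumes "\<And>i j. f i j = - f j i"
  shows "(\<Sum>i\<in>I. \<Sum>j\<in>I. f i j) = 0"
proof -
  have "(\<Sum>i\<in>I. \<Sum>j\<in>I. f i j) = (\<Sum>j\<in>I. \<Sum>i\<in>I. f i j)"
    by (rule sum.swap)
  also have "\<dots> = (\<Sum>j\<in>I. \<Sum>i\<in>I. - f j i)"
    by (intro sum.cong refl assms)
  finally have "(\<Sum>i\<in>I. \<Sum>j\<in>I. f i j) = (\<Sum>i\<in>I. \<Sum>j\<in>I. - f i j)" .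
  then show ?thesis by (simp add: sum_negf)
qed

text \<open>Here \<open>s i j a b\<close> stands for the curvature \<open>R\<^sup>a\<^sup>b\<^sub>i\<^sub>j\<close>, \<open>d c\<close> for its derivative along the
  \<open>c\<close>-th coordinate, and \<open>\<Gamma> k i j\<close> for \<open>\<Gamma>\<^sup>k\<^sub>i\<^sub>j\<close>.\<close>

lemma contract_bianchi:
  fixes d :: "'i::finite \<Rightarrow> 'i \<Rightarrow> 'i \<Rightarrow> 'i \<Rightarrow> 'i \<Rightarrow> real"
    and s :: "'i \<Rightarrow> 'i \<Rightarrow> 'i \<Rightarrow> 'i \<Rightarrow> real" and \<Gamma> :: "'i \<Rightarrow> 'i \<Rightarrow> 'i \<Rightarrow> real"
  assumes s1: "\<And>i j a b. s j i a b = - s i j a b" and s2: "\<And>i j a b. s i j b a = - s i j a b"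
    and d1: "\<And>c i j a b. d c j i a b = - d c i j a b" and d2: "\<And>c i j a b. d c i j b a = - d c i j a b"
    and \<Gamma>: "\<And>k i j. \<Gamma> k i j = \<Gamma> k j i"
  defines "E \<equiv> \<lambda>m i j a b. d m i j a b + (\<Sum>c\<in>UNIV. \<Gamma> a c m * s i j c b) + (\<Sum>c\<in>UNIV. s i j a c * \<Gamma> b c m)"
  assumes cyc: "\<And>m i j a b. E m i j a b + E i j m a b + E j m i a b = 0"
  shows "(\<Sum>j\<in>UNIV. \<Sum>i\<in>UNIV. d m i j i j)
    = 2 * (\<Sum>i\<in>UNIV. (\<Sum>j\<in>UNIV. d i j m j i)
        + (\<Sum>c\<in>UNIV. (\<Sum>j\<in>UNIV. s j m j c) * \<Gamma> i c i - (\<Sum>j\<in>UNIV. s j c j i) * \<Gamma> c m i))"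
proof -
  have s12: "s j i b a = s i j a b" for i j a b
    using s1[of j i b a] s2[of i j b a] by simp
  \<comment> \<open>Let \<rho>^c_m be the sum over j of \<open>s j m j c\<close>, the raised Ricci
    tensor. Then A is the sum of the partial derivatives of \<rho>^i_m along i, B and C are its two
    Christoffel corrections, and the goal says that the divergence A + B - C is half the derivative
    of the trace of \<rho>.\<close>
  let ?A = "\<Sum>i\<in>UNIV. \<Sum>j\<in>UNIV. d i j m j i"
  let ?B = "\<Sum>i\<in>UNIV. \<Sum>c\<in>UNIV. (\<Sum>j\<in>UNIV. s j m j c) * \<Gamma> i c i"
  let ?C = "\<Sum>i\<in>UNIV. \<Sum>c\<in>UNIV. (\<Sum>j\<in>UNIV. s j c j i) * \<Gamma> c m i"
  have A2: "(\<Sum>i\<in>UNIV. \<Sum>j\<in>UNIV. d i j m i j) = - ?A"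
    unfolding sum_negf[symmetric] by (intro sum.cong refl d2)
  have A3: "(\<Sum>i\<in>UNIV. \<Sum>j\<in>UNIV. d j m i i j) = - ?A"
    unfolding sum_negf[symmetric] by (subst sum.swap) (intro sum.cong refl d1)
  have B1: "(\<Sum>i\<in>UNIV. \<Sum>j\<in>UNIV. \<Sum>c\<in>UNIV. \<Gamma> i c m * s i j c j) = ?C"
  proof -
    have "(\<Sum>i\<in>UNIV. \<Sum>j\<in>UNIV. \<Sum>c\<in>UNIV. \<Gamma> i c m * s i j c j)
        = (\<Sum>i\<in>UNIV. \<Sum>c\<in>UNIV. \<Sum>j\<in>UNIV. \<Gamma> i c m * s i j c j)"
      by (intro sum.cong refl sum.swap)
    also have "\<dots> = (\<Sum>c\<in>UNIV. \<Sum>i\<in>UNIV. \<Sum>j\<in>UNIV. \<Gamma> i c m * s i j c j)"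
      by (rule sum.swap)
    also have "\<dots> = ?C"
      unfolding sum_distrib_right
      by (intro sum.cong refl) (simp add: s12[of j i j c for i j c] \<Gamma>[of _ m] mult.commute)
    finally show ?thesis .
  qed
  have B2: "(\<Sum>i\<in>UNIV. \<Sum>j\<in>UNIV. \<Sum>c\<in>UNIV. s i j i c * \<Gamma> j c m) = ?C"
  proof -
    have "(\<Sum>i\<in>UNIV. \<Sum>j\<in>UNIV. \<Sum>c\<in>UNIV. s i j i c * \<Gamma> j c m)
        = (\<Sum>j\<in>UNIV. \<Sum>i\<in>UNIV. \<Sum>c\<in>UNIV. s i j i c * \<Gamma> j c m)"
      by (rule sum.swap)
    also have "\<dots> = (\<Sum>j\<in>UNIV. \<Sum>c\<in>UNIV. \<Sum>i\<in>UNIV. s i j i c * \<Gamma> j c m)"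
      by (intro sum.cong refl sum.swap)
    also have "\<dots> = (\<Sum>c\<in>UNIV. \<Sum>j\<in>UNIV. \<Sum>i\<in>UNIV. s i j i c * \<Gamma> j c m)"
      by (rule sum.swap)
    also have "\<dots> = ?C"
      unfolding sum_distrib_right by (intro sum.cong refl) (simp add: \<Gamma>[of _ m])
    finally show ?thesis .
  qed
  have B3: "(\<Sum>i\<in>UNIV. \<Sum>j\<in>UNIV. \<Sum>c\<in>UNIV. \<Gamma> i c i * s j m c j) = - ?B"
  proof -
    have "(\<Sum>i\<in>UNIV. \<Sum>j\<in>UNIV. \<Sum>c\<in>UNIV. \<Gamma> i c i * s j m c j)
        = (\<Sum>i\<in>UNIV. \<Sum>c\<in>UNIV. \<Sum>j\<in>UNIV. \<Gamma> i c i * s j m c j)"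
      by (intro sum.cong refl sum.swap)
    also have "\<dots> = - ?B"
      unfolding sum_negf[symmetric] sum_distrib_right
      by (intro sum.cong refl) (simp add: s2[of j m j c for j c] mult.commute)
    finally show ?thesis .
  qed
  \<comment> \<open>Here and in \<open>B5\<close> the skew upper pair of s meets the symmetric lower
    pair of \<Gamma>.\<close>
  have B4: "(\<Sum>i\<in>UNIV. \<Sum>j\<in>UNIV. \<Sum>c\<in>UNIV. s j m i c * \<Gamma> j c i) = 0"
  proof -
    have "(\<Sum>i\<in>UNIV. \<Sum>j\<in>UNIV. \<Sum>c\<in>UNIV. s j m i c * \<Gamma> j c i)
        = (\<Sum>j\<in>UNIV. \<Sum>i\<in>UNIV. \<Sum>c\<in>UNIV. s j m i c * \<Gamma> j c i)"
      by (rule sum.swap)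
    also have "\<dots> = (\<Sum>j\<in>(UNIV::'i set). 0)"
    proof (intro sum.cong refl sum_antisymmetric)
      show "s j m i c * \<Gamma> j c i = - (s j m c i * \<Gamma> j i c)" for i j c
        using s2[of j m c i] \<Gamma>[of j c i] by simp
    qed
    finally show ?thesis by simp
  qed
  have B5: "(\<Sum>i\<in>UNIV. \<Sum>j\<in>UNIV. \<Sum>c\<in>UNIV. \<Gamma> i c j * s m i c j) = 0"
  proof -
    have "(\<Sum>i\<in>UNIV. \<Sum>j\<in>UNIV. \<Sum>c\<in>UNIV. \<Gamma> i c j * s m i c j) = (\<Sum>i\<in>(UNIV::'i set). 0)"
    proof (intro sum.cong refl sum_antisymmetric)
      show "\<Gamma> i c j * s m i c j = - (\<Gamma> i j c * s m i j c)" for i j c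
        using s2[of m i c j] \<Gamma>[of i c j] by simp
    qed
    then show ?thesis by simp
  qed
  have B6: "(\<Sum>i\<in>UNIV. \<Sum>j\<in>UNIV. \<Sum>c\<in>UNIV. s m i i c * \<Gamma> j c j) = - ?B"
  proof -
    have "(\<Sum>i\<in>UNIV. \<Sum>j\<in>UNIV. \<Sum>c\<in>UNIV. s m i i c * \<Gamma> j c j)
        = (\<Sum>j\<in>UNIV. \<Sum>i\<in>UNIV. \<Sum>c\<in>UNIV. s m i i c * \<Gamma> j c j)"
      by (rule sum.swap)
    also have "\<dots> = (\<Sum>j\<in>UNIV. \<Sum>c\<in>UNIV. \<Sum>i\<in>UNIV. s m i i c * \<Gamma> j c j)"
      by (intro sum.cong refl sum.swap)
    also have "\<dots> = - ?B"
      unfolding sum_negf[symmetric] sum_distrib_right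
      by (intro sum.cong refl) (simp add: s1[of i m i c for i c])
    finally show ?thesis .
  qed
  \<comment> \<open>Putting a = i and b = j and summing contracts twice. The first cyclic term
    yields the derivative of the scalar curvature, and the other two yield the divergence with the
    opposite sign.\<close>
  have "0 = (\<Sum>i\<in>UNIV. \<Sum>j\<in>UNIV. E m i j i j + E i j m i j + E j m i i j)"
    by (simp add: cyc)
  also have "\<dots> = (\<Sum>i\<in>UNIV. \<Sum>j\<in>UNIV. d m i j i j) - 2 * ?A + 2 * ?C - 2 * ?B"
    unfolding E_def by (simp add: sum.distrib A2 A3 B1 B2 B3 B4 B5 B6)
  also have "(\<Sum>i\<in>UNIV. \<Sum>j\<in>UNIV. d m i j i j) = (\<Sum>j\<in>UNIV. \<Sum>i\<in>UNIV. d m i j i j)"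
    by (rule sum.swap)
  finally show ?thesis
    by (simp add: sum.distrib sum_subtractf)
qed

definition raised_ricci :: "(real^'i::finite \<Rightarrow> real^'i^'i) \<Rightarrow> real^'i \<Rightarrow> 'i \<Rightarrow> 'i \<Rightarrow> real" where
  "raised_ricci g x c m = (\<Sum>a\<in>UNIV. matrix_inv (g x) $ c $ a * ricci g x a m)"

context chart_metric
begin

lemma smooth_raised_ricci: "smooth_on S (\<lambda>x. raised_ricci g x c m)"
  unfolding raised_ricci_def using open_domain smooth_ricci smooth_inverse
  by (intro smooth_on_sum smooth_on_mult smooth_on_vec_nth)

lemma scalar_curvature_eq_trace:
  assumes "x \<in> S"
  shows "scalar_curvature g x = (\<Sum>c\<in>UNIV. raised_ricci g x c c)"
  unfolding scalar_curvature_def raised_ricci_def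
  by (subst sum.swap) (simp add: inverse_entries_symmetric[OF assms])

text \<open>By its symmetry the inverse metric can multiply the curvature from the right, which
  makes the raised Ricci tensor a trace of the raised curvature.\<close>

lemma raised_ricci_eq_trace:
  assumes "x \<in> S"
  shows "raised_ricci g x c m
    = (\<Sum>j\<in>UNIV. (curvature_matrix g x (axis j 1) (axis m 1) ** matrix_inv (g x)) $ j $ c)"
proof -
  have "raised_ricci g x c m
      = (\<Sum>a\<in>UNIV. \<Sum>j\<in>UNIV. curvature_matrix g x (axis j 1) (axis m 1) $ j $ a * matrix_inv (g x) $ a $ c)"
    unfolding raised_ricci_def ricci_eq_trace[OF assms] sum_distrib_left
    by (intro sum.cong refl) (simp add: inverse_entries_symmetric[OF assms, of c])
  then show ?thesis
    by (subst (asm) sum.swap) (simp add: matrix_matrix_mult_def)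
qed

lemma contracted_bianchi:
  assumes x: "x \<in> S"
  shows "pd m (scalar_curvature g) x = 2 * (\<Sum>i\<in>UNIV. pd i (\<lambda>y. raised_ricci g y i m) x
    + (\<Sum>c\<in>UNIV. raised_ricci g x c m * christoffel g x i c i - raised_ricci g x i c * christoffel g x c m i))"
proof -
  define R where "R y i j = curvature_matrix g y (axis i 1) (axis j 1) ** matrix_inv (g y)" for y i j
  define R' where "R' i j = frechet_derivative (\<lambda>y. R y i j) (at x)" for i j
  define s where "s i j a b = R x i j $ a $ b" for i j a b
  define d where "d c i j a b = R' i j (axis c 1) $ a $ b" for c i j a b
  have RD: "((\<lambda>y. R y i j) has_derivative R' i j) (at x)" for i j
    unfolding R_def R'_def
    using smooth_on_has_derivative[OF smooth_on_matrix_mult[OF open_domain smooth_curvature_matrix smooth_inverse] open_domain x] .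
  have comp: "((\<lambda>y. R y i j $ a $ b) has_derivative (\<lambda>v. R' i j v $ a $ b)) (at x)" for i j a b
    by (intro bounded_linear.has_derivative[OF bounded_linear_vec_nth] RD)
  have s1: "s j i a b = - s i j a b" for i j a b
    unfolding s_def R_def by (subst curvature_matrix_antisym) (simp add: matrix_algebra)
  \<comment> \<open>Stated on all of \<open>S\<close> rather than at x alone, so that it can be
    differentiated to give \<open>d2\<close>.\<close>
  have skew: "R y i j $ b $ a = - R y i j $ a $ b" if "y \<in> S" for y i j a b
    using arg_cong[OF curvature_matrix_raised_skew[OF that, of "axis i 1" "axis j 1"], of "\<lambda>A. A $ a $ b"]
    by (simp add: R_def transpose_nth)
  have s2: "s i j b a = - s i j a b" for i j a b
    unfolding s_def by (rule skew[OF x])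
  have d1: "d c j i a b = - d c i j a b" for c i j a b
  proof -
    have "(\<lambda>y. R y j i) = (\<lambda>y. - R y i j)"
      unfolding R_def by (subst curvature_matrix_antisym) (simp add: matrix_algebra)
    then have "R' j i = (\<lambda>v. - R' i j v)"
      using has_derivative_unique[OF RD[of j i]] has_derivative_minus[OF RD[of i j]] by simp
    then show ?thesis by (simp add: d_def)
  qed
  have d2: "d c i j b a = - d c i j a b" for c i j a b
  proof -
    have "((\<lambda>y. R y i j $ b $ a) has_derivative (\<lambda>v. - R' i j v $ a $ b)) (at x)"
      using has_derivative_minus[OF comp[of i j a b]] open_domain x
      by (rule has_derivative_transform_within_open) (simp add: skew[of _ i j b a])
    from has_derivative_unique[OF comp this] show ?thesis unfolding d_def by metis
  qed
  have cyc: "(d m i j a b + (\<Sum>c\<in>UNIV. christoffel g x a c m * s i j c b) + (\<Sum>c\<in>UNIV. s i j a c * christoffel g x b c m))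
      + (d i j m a b + (\<Sum>c\<in>UNIV. christoffel g x a c i * s j m c b) + (\<Sum>c\<in>UNIV. s j m a c * christoffel g x b c i))
      + (d j m i a b + (\<Sum>c\<in>UNIV. christoffel g x a c j * s m i c b) + (\<Sum>c\<in>UNIV. s m i a c * christoffel g x b c j)) = 0"
    for m i j a b
    using arg_cong[OF second_bianchi_raised[OF x, of "axis m 1" "axis i 1" "axis j 1"], of "\<lambda>A. A $ a $ b"]
    unfolding d_def R'_def s_def R_def
    by (simp add: matrix_matrix_mult_def transpose_def christoffel_matrix_axis)
  have raised_eq: "raised_ricci g y c m = (\<Sum>j\<in>UNIV. R y j m $ j $ c)" if "y \<in> S" for y c m
    using raised_ricci_eq_trace[OF that] by (simp add: R_def)
  have raised_D: "((\<lambda>y. raised_ricci g y c m) has_derivative (\<lambda>v. \<Sum>j\<in>UNIV. R' j m v $ j $ c)) (at x)" for c m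
    using has_derivative_sum[OF comp] open_domain x
    by (rule has_derivative_transform_within_open) (simp add: raised_eq)
  have "((\<lambda>y. scalar_curvature g y) has_derivative (\<lambda>v. \<Sum>c\<in>UNIV. \<Sum>j\<in>UNIV. R' j c v $ j $ c)) (at x)"
    using has_derivative_sum[OF raised_D] open_domain x
    by (rule has_derivative_transform_within_open) (simp add: scalar_curvature_eq_trace)
  then have "pd m (scalar_curvature g) x = (\<Sum>j\<in>UNIV. \<Sum>i\<in>UNIV. d m i j i j)"
    unfolding pd_def by (simp add: d_def frechet_derivative_eqI[of "\<lambda>y. scalar_curvature g y"])
  moreover have "pd i (\<lambda>y. raised_ricci g y i m) x = (\<Sum>j\<in>UNIV. d i j m j i)" for i
    unfolding pd_def frechet_derivative_eqI[OF raised_D] by (simp add: d_def)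
  ultimately show ?thesis
    using contract_bianchi[of s d "christoffel g x", OF s1 s2 d1 d2 christoffel_symmetric[OF x] cyc, of m]
    by (simp add: raised_eq x s_def)
qed

end

section \<open>Christoffel symbols under a change of coordinates\<close>

lemma jacobian_nth: "jacobian F (at y) $ i $ j = frechet_derivative F (at y) (axis j 1) $ i"
  by (simp add: jacobian_def matrix_def)

lemma smooth_on_jacobian:
  fixes F :: "real^'i::finite \<Rightarrow> real^'j::finite"
  assumes "open U" "smooth_on U F"
  shows "smooth_on U (\<lambda>y. jacobian F (at y))"
proof -
  have "smooth_on U (\<lambda>y. \<chi> i j. frechet_derivative F (at y) (axis j 1) $ i)"
    using assms by (intro smooth_on_vec_lambda smooth_on_vec_nth smooth_on_frechet_derivative)
  moreover have "(\<lambda>y. jacobian F (at y)) = (\<lambda>y. \<chi> i j. frechet_derivative F (at y) (axis j 1) $ i)"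
    by (simp add: fun_eq_iff vec_eq_iff jacobian_nth)
  ultimately show ?thesis by simp
qed

lemma smooth_on_has_derivative_jacobian:
  fixes F :: "real^'i::finite \<Rightarrow> real^'j::finite"
  assumes "open U" "smooth_on U F" "x \<in> U"
  shows "(F has_derivative (\<lambda>v. jacobian F (at x) *v v)) (at x)"
  using smooth_on_has_derivative[OF assms(2,1,3)] by (simp add: jacobian_works[symmetric] differentiable_def) blast

text \<open>The Hessian of F is symmetric, so the inhomogeneous term of the transformation law
  contributes no torsion.\<close>

lemma second_derivative_jacobian_commute:
  fixes F :: "real^'i::finite \<Rightarrow> real^'j::finite"
  assumes U: "open U" "x \<in> U" and F: "smooth_on U F"
  shows "frechet_derivative (\<lambda>y. jacobian F (at y)) (at x) a *v b
       = frechet_derivative (\<lambda>y. jacobian F (at y)) (at x) b *v a"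
proof -
  let ?J' = "frechet_derivative (\<lambda>y. jacobian F (at y)) (at x)"
  have "frechet_derivative (\<lambda>y. frechet_derivative F (at y) b) (at x) a = ?J' a *v b" for a b
  proof -
    have lin: "bounded_linear (\<lambda>A::real^'i^'j. A *v b)"
      by (auto simp: linear_conv_bounded_linear[symmetric] matrix_vector_mult_add_rdistrib
          scaleR_matrix_vector_assoc intro!: linearI)
    have "((\<lambda>y. jacobian F (at y) *v b) has_derivative (\<lambda>a. ?J' a *v b)) (at x)"
      using bounded_linear.has_derivative[OF lin smooth_on_has_derivative[OF smooth_on_jacobian[OF U(1) F] U]] .
    then have "((\<lambda>y. frechet_derivative F (at y) b) has_derivative (\<lambda>a. ?J' a *v b)) (at x)"
      using U by (rule has_derivative_transform_within_open)
        (simp add: frechet_derivative_eqI[OF smooth_on_has_derivative_jacobian[OF U(1) F]])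
    from frechet_derivative_eqI[OF this] show ?thesis by metis
  qed
  then show ?thesis using second_derivative_symmetric[OF U F] by metis
qed

text \<open>The connection pulled back along a change of coordinates is torsion-free and metric, hence is
  the Levi-Civita connection.\<close>

lemma christoffel_matrix_transform:
  fixes F :: "real^'i::finite \<Rightarrow> real^'i"
  assumes "chart_metric g S" "chart_metric g' S'"
    and U: "open U" "U \<subseteq> S" "x \<in> U" and F: "smooth_on U F" "\<And>y. y \<in> U \<Longrightarrow> F y \<in> S'"
    and inv: "invertible (jacobian F (at x))"
    and pull: "\<And>y. y \<in> U \<Longrightarrow> g y = transpose (jacobian F (at y)) ** g' (F y) ** jacobian F (at y)"
  shows "jacobian F (at x) ** christoffel_matrix g x a
    = frechet_derivative (\<lambda>y. jacobian F (at y)) (at x) a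
      + christoffel_matrix g' (F x) (jacobian F (at x) *v a) ** jacobian F (at x)"
proof -
  interpret g: chart_metric g S by fact
  interpret g': chart_metric g' S' by fact
  let ?J = "jacobian F (at x)" and ?J' = "frechet_derivative (\<lambda>y. jacobian F (at y)) (at x)"
  let ?C = "\<lambda>a. ?J' a + christoffel_matrix g' (F x) (?J *v a) ** ?J"
  have xS: "x \<in> S" and FxS: "F x \<in> S'" using U F by auto
  have J: "((\<lambda>y. jacobian F (at y)) has_derivative ?J') (at x)"
    using smooth_on_has_derivative[OF smooth_on_jacobian[OF U(1) F(1)] U(1,3)] .
  note JT = bounded_linear.has_derivative[OF bounded_linear_transpose J]
  have gF: "((\<lambda>y. g' (F y)) has_derivative (\<lambda>a. frechet_derivative g' (at (F x)) (?J *v a))) (at x)"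
    using has_derivative_compose[OF smooth_on_has_derivative_jacobian[OF U(1) F(1) U(3)] g'.has_derivative[OF FxS]] .
  have "((\<lambda>y. transpose (jacobian F (at y)) ** g' (F y) ** jacobian F (at y)) has_derivative
      (\<lambda>a. transpose ?J ** g' (F x) ** ?J' a
        + (transpose ?J ** frechet_derivative g' (at (F x)) (?J *v a) + transpose (?J' a) ** g' (F x)) ** ?J)) (at x)"
    using matrix_mult.FDERIV[OF matrix_mult.FDERIV[OF JT gF] J] .
  then have "(g has_derivative
      (\<lambda>a. transpose ?J ** g' (F x) ** ?J' a
        + (transpose ?J ** frechet_derivative g' (at (F x)) (?J *v a) + transpose (?J' a) ** g' (F x)) ** ?J)) (at x)"
    using U(1,3) by (rule has_derivative_transform_within_open) (simp add: pull)
  note D = frechet_derivative_eqI[OF this]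
  \<comment> \<open>The pulled-back connection form J^-1 (dJ + \<Gamma>' J).\<close>
  define A where "A a = matrix_inv ?J ** ?C a" for a
  have JA: "?J ** A a = ?C a" for a
    by (simp add: A_def matrix_mul_assoc matrix_inv[OF inv])
  have "A a = christoffel_matrix g x a" for a
  proof (rule g.levi_civita_unique[OF xS])
    show "A a *v b = A b *v a" for a b
      using g'.christoffel_matrix_commute[OF FxS, of "?J *v a" "?J *v b"]
        second_derivative_jacobian_commute[OF U(1,3) F(1), of a b]
      by (simp add: A_def matrix_vector_mul_assoc[symmetric] matrix_vector_mult_add_rdistrib)
    show "frechet_derivative g (at x) a = g x ** A a + transpose (g x ** A a)" for a
    proof -
      have "g x ** A a = transpose ?J ** g' (F x) ** ?C a"
        unfolding pull[OF U(3)] by (simp add: matrix_mul_assoc[symmetric] JA)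
      then show ?thesis
        unfolding D g'.derivative_metric[OF FxS]
        by (simp add: matrix_algebra matrix_transpose_mul transpose_algebra g'.symmetric[OF FxS])
    qed
  qed
  then show ?thesis using JA by metis
qed

subsection \<open>Curvature of a connection given in a moving frame\<close>

text \<open>A curvature form differentiates a form with one vector fixed inside it; this provides
  linearity in that inner vector.\<close>

lemma linear_frechet_derivative_family:
  assumes lin: "\<And>y. linear (f y)" and d: "\<And>v. ((\<lambda>y. f y v) has_derivative f' v) (at x)"
  shows "linear (\<lambda>v. frechet_derivative (\<lambda>y. f y v) (at x) a)"
proof (rule linearI)
  have D: "frechet_derivative (\<lambda>y. f y v) (at x) = f' v" for v
    using frechet_derivative_eqI[OF d] .
  show "frechet_derivative (\<lambda>y. f y (u + v)) (at x) a
      = frechet_derivative (\<lambda>y. f y u) (at x) a + frechet_derivative (\<lambda>y. f y v) (at x) a" for u v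
    using frechet_derivative_eqI[OF has_derivative_add[OF d[of u] d[of v]]] by (simp add: D linear_add[OF lin])
  show "frechet_derivative (\<lambda>y. f y (r *\<^sub>R v)) (at x) a = r *\<^sub>R frechet_derivative (\<lambda>y. f y v) (at x) a" for r v
    using frechet_derivative_eqI[OF has_derivative_scaleR_right[OF d[of v], of r]] by (simp add: D linear_cmul[OF lin])
qed

text \<open>\<open>\<omega> C B z Y\<close> is the value on \<open>Y\<close> of the connection form \<open>\<omega>\<^sup>C\<^sub>B\<close>.\<close>

locale framed_connection =
  fixes E :: "'A::finite \<Rightarrow> 'v::euclidean_space \<Rightarrow> 'v" and \<theta> :: "'A \<Rightarrow> 'v \<Rightarrow> 'v \<Rightarrow> real"
    and \<omega> :: "'A \<Rightarrow> 'A \<Rightarrow> 'v \<Rightarrow> 'v \<Rightarrow> real" and D :: "'v set"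
    and nabla :: "('v \<Rightarrow> 'v) \<Rightarrow> ('v \<Rightarrow> 'v) \<Rightarrow> 'v \<Rightarrow> 'v"
  assumes open_D: "open D"
    and dual: "\<theta> A z (E B z) = (if A = B then 1 else 0)"
    and linear_coframe: "linear (\<theta> A z)"
    and smooth_coframe: "smooth_on D (\<lambda>z. \<theta> A z U)"
    and linear_form: "linear (\<omega> C B z)"
    and smooth_form: "smooth_on D (\<lambda>z. \<omega> C B z U)"
    and nabla: "nabla Y W z = (\<Sum>C\<in>UNIV. (frechet_derivative (\<lambda>z'. \<theta> C z' (W z')) (at z) (Y z)
        + (\<Sum>B\<in>UNIV. \<omega> C B z (Y z) * \<theta> B z (W z))) *\<^sub>R E C z)"
begin

text \<open>Cartan's second structure equation: d\<omega> + \<omega> \<and> \<omega> on the constant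
  fields Y and Z.\<close>

definition curvature_form :: "'A \<Rightarrow> 'A \<Rightarrow> 'v \<Rightarrow> 'v \<Rightarrow> 'v \<Rightarrow> real" where
  "curvature_form C B z Y Z = frechet_derivative (\<lambda>z. \<omega> C B z Z) (at z) Y
     - frechet_derivative (\<lambda>z. \<omega> C B z Y) (at z) Z
     + (\<Sum>A\<in>UNIV. \<omega> C A z Y * \<omega> A B z Z - \<omega> C A z Z * \<omega> A B z Y)"

definition nabla_component :: "'v \<Rightarrow> 'v \<Rightarrow> 'A \<Rightarrow> 'v \<Rightarrow> real" where
  "nabla_component Z W C z = frechet_derivative (\<lambda>z. \<theta> C z W) (at z) Z + (\<Sum>B\<in>UNIV. \<omega> C B z Z * \<theta> B z W)"

lemma coframe_sum: "\<theta> A z (\<Sum>C\<in>UNIV. r C *\<^sub>R E C z) = r A"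
  by (simp add: linear_sum[OF linear_coframe] linear_cmul[OF linear_coframe] dual
      if_distrib[of "(*) _"] cong: if_cong)

lemma nabla_const: "nabla (\<lambda>_. Z) (\<lambda>_. W) z = (\<Sum>C\<in>UNIV. nabla_component Z W C z *\<^sub>R E C z)"
  unfolding nabla nabla_component_def ..

lemma nabla_component_has_derivative:
  assumes z: "z \<in> D"
  shows "((\<lambda>z. nabla_component Z W C z) has_derivative
    (\<lambda>Y. frechet_derivative (\<lambda>z. frechet_derivative (\<lambda>z. \<theta> C z W) (at z) Z) (at z) Y
      + (\<Sum>B\<in>UNIV. \<omega> C B z Z * frechet_derivative (\<lambda>z. \<theta> B z W) (at z) Y
           + frechet_derivative (\<lambda>z. \<omega> C B z Z) (at z) Y * \<theta> B z W))) (at z)"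
  unfolding nabla_component_def
  by (intro has_derivative_add has_derivative_sum has_derivative_mult
      smooth_on_has_derivative[OF _ open_D z] smooth_on_frechet_derivative smooth_coframe smooth_form)

lemma nabla_nabla_const:
  assumes z: "z \<in> D"
  shows "nabla (\<lambda>_. Y) (nabla (\<lambda>_. Z) (\<lambda>_. W)) z = (\<Sum>C\<in>UNIV.
    (frechet_derivative (\<lambda>z. frechet_derivative (\<lambda>z. \<theta> C z W) (at z) Z) (at z) Y
      + (\<Sum>B\<in>UNIV. \<omega> C B z Z * frechet_derivative (\<lambda>z. \<theta> B z W) (at z) Y
           + frechet_derivative (\<lambda>z. \<omega> C B z Z) (at z) Y * \<theta> B z W)
      + (\<Sum>B\<in>UNIV. \<omega> C B z Y * nabla_component Z W B z)) *\<^sub>R E C z)"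
  unfolding nabla[of "\<lambda>_. Y"] unfolding nabla_const coframe_sum
    frechet_derivative_eqI[OF nabla_component_has_derivative[OF z]] ..

lemma nabla_zero:
  assumes z: "z \<in> D"
  shows "nabla (\<lambda>_. 0) (\<lambda>_. W) z = 0"
proof -
  have "frechet_derivative (\<lambda>z. \<theta> C z W) (at z) 0 = 0" for C
    using smooth_on_has_derivative[OF smooth_coframe open_D z] by (intro linear_0 has_derivative_linear)
  then show ?thesis
    unfolding nabla by (simp add: linear_0[OF linear_form])
qed

text \<open>Constant fields commute, so the bracket term drops and no bracket of frame fields has to
  be computed. Antisymmetrising in Y and Z removes the derivatives of the coframe and leaves the
  curvature form.\<close>

lemma curvature_const:
  assumes z: "z \<in> D"
  shows "curvature nabla (\<lambda>_. Y) (\<lambda>_. Z) (\<lambda>_. W) z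
    = (\<Sum>C\<in>UNIV. (\<Sum>B\<in>UNIV. curvature_form C B z Y Z * \<theta> B z W) *\<^sub>R E C z)"
proof -
  let ?t = "\<lambda>Y B. frechet_derivative (\<lambda>z. \<theta> B z W) (at z) Y"
  let ?w = "\<lambda>Y Z C B. frechet_derivative (\<lambda>z. \<omega> C B z Z) (at z) Y"
  let ?q = "\<lambda>Y Z C. (\<Sum>B\<in>UNIV. \<omega> C B z Z * ?t Y B + ?w Y Z C B * \<theta> B z W)
      + (\<Sum>B\<in>UNIV. \<omega> C B z Y * nabla_component Z W B z)"
  \<comment> \<open>Separates the part with derivatives of the coframe, symmetric in Y and Z, from
    the part that becomes the curvature form.\<close>
  have q: "?q Y Z C = (\<Sum>B\<in>UNIV. \<omega> C B z Z * ?t Y B + \<omega> C B z Y * ?t Z B)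
      + (\<Sum>B\<in>UNIV. (?w Y Z C B + (\<Sum>A\<in>UNIV. \<omega> C A z Y * \<omega> A B z Z)) * \<theta> B z W)" for Y Z C
  proof -
    have "(\<Sum>A\<in>UNIV. \<omega> C A z Y * (\<Sum>B\<in>UNIV. \<omega> A B z Z * \<theta> B z W))
        = (\<Sum>B\<in>UNIV. (\<Sum>A\<in>UNIV. \<omega> C A z Y * \<omega> A B z Z) * \<theta> B z W)"
      unfolding sum_distrib_left sum_distrib_right by (subst sum.swap) (simp add: mult.assoc)
    then show ?thesis
      by (simp add: nabla_component_def distrib_left distrib_right sum.distrib)
  qed
  have sym: "frechet_derivative (\<lambda>z. frechet_derivative (\<lambda>z. \<theta> C z W) (at z) Z) (at z) Y
      = frechet_derivative (\<lambda>z. frechet_derivative (\<lambda>z. \<theta> C z W) (at z) Y) (at z) Z" for C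
    using second_derivative_symmetric[OF open_D z smooth_coframe] .
  have bracket: "lie_bracket (\<lambda>_. Y) (\<lambda>_. Z) = (\<lambda>_. 0)"
    by (simp add: lie_bracket_def fun_eq_iff)
  have form: "?q Y Z C - ?q Z Y C = (\<Sum>B\<in>UNIV. curvature_form C B z Y Z * \<theta> B z W)" for C
    unfolding q curvature_form_def
    by (simp add: sum.distrib sum_subtractf algebra_simps)
  have "curvature nabla (\<lambda>_. Y) (\<lambda>_. Z) (\<lambda>_. W) z = (\<Sum>C\<in>UNIV. (?q Y Z C - ?q Z Y C) *\<^sub>R E C z)"
    unfolding curvature_def bracket nabla_zero[OF z] nabla_nabla_const[OF z] sym
    by (simp only: diff_zero sum_subtractf[symmetric] scaleR_left_diff_distrib[symmetric])
      (simp add: algebra_simps)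
  then show ?thesis by (simp only: form)
qed

lemma linear_curvature_form:
  assumes z: "z \<in> D" shows "linear (\<lambda>Y. curvature_form C B z Y Z)"
proof -
  note d = smooth_on_has_derivative[OF smooth_form open_D z]
  have 1: "linear (\<lambda>Y. frechet_derivative (\<lambda>z. \<omega> C B z Y) (at z) Z)"
    using linear_frechet_derivative_family[OF linear_form d] .
  have 2: "linear (frechet_derivative (\<lambda>z. \<omega> C B z Z) (at z))"
    using d by (rule has_derivative_linear)
  have 3: "linear (\<lambda>Y. \<Sum>A\<in>UNIV. \<omega> C A z Y * \<omega> A B z Z - \<omega> C A z Z * \<omega> A B z Y)"
    by (rule linearI)
      (simp_all add: linear_add[OF linear_form] linear_cmul[OF linear_form]
        algebra_simps sum.distrib sum_subtractf sum_distrib_left)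
  show ?thesis
    unfolding curvature_form_def by (intro linear_compose_add linear_compose_sub 1 2 3)
qed

text \<open>Tracing over the coordinate basis leaves the coefficients
  \<open>E C z \<bullet> e\<close>; linearity of the curvature form in its first vector reassembles
  them into the frame vector.\<close>

lemma ricci_frame_trace:
  assumes z: "z \<in> D"
  shows "ricci_of_connection nabla z U V
    = (\<Sum>C\<in>UNIV. \<Sum>B\<in>UNIV. curvature_form C B z (E C z) V * \<theta> B z U)"
proof -
  have expand: "curvature_form C B z (E C z) V = (\<Sum>e\<in>Basis. (E C z \<bullet> e) * curvature_form C B z e V)" for C B
  proof -
    have "curvature_form C B z (\<Sum>e\<in>Basis. (E C z \<bullet> e) *\<^sub>R e) V
        = (\<Sum>e\<in>Basis. (E C z \<bullet> e) * curvature_form C B z e V)"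
      by (simp add: linear_sum[OF linear_curvature_form[OF z]] linear_cmul[OF linear_curvature_form[OF z]])
    then show ?thesis by (simp add: euclidean_representation)
  qed
  have "ricci_of_connection nabla z U V
      = (\<Sum>e\<in>Basis. \<Sum>C\<in>UNIV. \<Sum>B\<in>UNIV. (E C z \<bullet> e) * curvature_form C B z e V * \<theta> B z U)"
    unfolding ricci_of_connection_def curvature_const[OF z]
    by (simp add: inner_sum_left sum_distrib_right sum_distrib_left mult_ac)
  also have "\<dots> = (\<Sum>C\<in>UNIV. \<Sum>B\<in>UNIV. \<Sum>e\<in>Basis. (E C z \<bullet> e) * curvature_form C B z e V * \<theta> B z U)"
    by (subst sum.swap) (intro sum.cong refl sum.swap)
  finally show ?thesis by (simp add: expand sum_distrib_right)
qed

end

subsection \<open>The adapted frame of the jet space\<close>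

lemma sum_adapted_index:
  fixes f :: "('p::finite, 'n::finite) adapted_index \<Rightarrow> 'c::comm_monoid_add"
  shows "(\<Sum>A\<in>UNIV. f A) = (\<Sum>\<alpha>\<in>UNIV. f (tI \<alpha>)) + (\<Sum>i\<in>UNIV. f (xI i)) + (\<Sum>i\<in>UNIV. \<Sum>\<alpha>\<in>UNIV. f (vI i \<alpha>))"
proof -
  have "(\<Sum>A\<in>UNIV. f A) = (\<Sum>\<alpha>\<in>UNIV. f (Inl \<alpha>)) + (\<Sum>B\<in>UNIV. f (Inr B))"
    by (simp add: UNIV_Plus_UNIV[symmetric] sum.Plus del: UNIV_Plus_UNIV)
  also have "(\<Sum>B\<in>UNIV. f (Inr B)) = (\<Sum>i\<in>UNIV. f (xI i)) + (\<Sum>P\<in>UNIV. f (Inr (Inr P)))"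
    by (simp add: UNIV_Plus_UNIV[symmetric] sum.Plus del: UNIV_Plus_UNIV)
  also have "(\<Sum>P\<in>UNIV. f (Inr (Inr P))) = (\<Sum>i\<in>UNIV. \<Sum>\<alpha>\<in>UNIV. f (vI i \<alpha>))"
    by (simp add: UNIV_Times_UNIV[symmetric] sum.cartesian_product del: UNIV_Times_UNIV)
  finally show ?thesis by (simp add: add.assoc)
qed

lemma adapted_index_cases [case_names t x v]:
  obtains \<alpha> where "A = tI \<alpha>" | i where "A = xI i" | i \<alpha> where "A = vI i \<alpha>"
  by (metis old.sum.exhaust surj_pair)

lemma axis_nth_mult: "axis i (1::real) $ j * y = (if j = i then y else 0)"
  "y * axis i (1::real) $ j = (if j = i then y else 0)"
  by (auto simp: axis_def)

text \<open>M and N enter the vertical coframe with the sign opposite to that in the horizontal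
  frame vectors, so the former annihilates the latter.\<close>

lemma coframe_frame: "coframe h \<phi> X A z (frame h \<phi> X B z) = (if A = B then 1 else 0)"
proof -
  have entry: "axis j (axis \<beta> (1::real)) $ i $ \<alpha> = (if i = j \<and> \<alpha> = \<beta> then 1 else 0)" for i j :: 'b and \<alpha> \<beta> :: 'a
    by (auto simp: axis_def)
  show ?thesis
    by (cases A rule: adapted_index_cases; cases B rule: adapted_index_cases)
      (auto simp: axis_nth_mult entry, auto simp: axis_def)
qed

lemma linear_coframe: "linear (coframe h \<phi> X A z)"
proof (cases A rule: adapted_index_cases)
  case (v i \<alpha>)
  show ?thesis
    unfolding v by (rule linearI) (auto simp: split_paired_all algebra_simps sum.distrib sum_distrib_left)
qed (auto intro!: linearI simp: split_paired_all)

lemma frame_expansion: "(\<Sum>A\<in>UNIV. coframe h \<phi> X A z U *\<^sub>R frame h \<phi> X A z) = U"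
proof -
  obtain a b w where U: "U = (a, b, w)" by (metis surj_pair)
  let ?S = "\<Sum>A\<in>UNIV. coframe h \<phi> X A z U *\<^sub>R frame h \<phi> X A z"
  have "coframe h \<phi> X A z (?S - U) = 0" for A
    by (simp add: linear_diff[OF linear_coframe] linear_sum[OF linear_coframe] linear_cmul[OF linear_coframe]
        coframe_frame if_distrib[of "(*) _"] cong: if_cong)
  \<comment> \<open>The coframe separates vectors: once the t and x components vanish, so do the M
    and N terms, and the vertical forms read off the fibre component.\<close>
  moreover have "V = 0" if *: "\<And>A. coframe h \<phi> X A z V = 0" for V
  proof -
    obtain a b w where V: "V = (a, b, w)" by (metis surj_pair)
    have "a = 0" "b = 0"
      using *[of "tI _"] *[of "xI _"] by (auto simp: V vec_eq_iff)
    moreover from this have "w = 0"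
      using *[of "vI _ _"] by (auto simp: V vec_eq_iff)
    ultimately show ?thesis by (simp add: V zero_prod_def)
  qed
  ultimately have "?S - U = 0" by blast
  then show ?thesis by simp
qed

text \<open>The vertical frame vectors transform like TM tensored with the dual of TT. Hence the
  last block combines the form of \<phi> with the dual of the form of \<open>h\<close>, which
  accounts for the minus sign and the exchanged indices. Only the base components of Y
  occur.\<close>

fun connection_form ::
    "'p::finite local_metric \<Rightarrow> 'n::finite local_metric \<Rightarrow> ('p, 'n) adapted_index \<Rightarrow> ('p, 'n) adapted_index
      \<Rightarrow> ('p, 'n) jet \<Rightarrow> ('p, 'n) jet \<Rightarrow> real" where
  "connection_form h \<phi> (tI \<alpha>) (tI \<beta>) z Y = christoffel_matrix h (fst z) (fst Y) $ \<alpha> $ \<beta>"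
| "connection_form h \<phi> (xI i) (xI j) z Y = christoffel_matrix \<phi> (fst (snd z)) (fst (snd Y)) $ i $ j"
| "connection_form h \<phi> (vI i \<alpha>) (vI j \<beta>) z Y =
     (if \<alpha> = \<beta> then christoffel_matrix \<phi> (fst (snd z)) (fst (snd Y)) $ i $ j else 0)
     - (if i = j then christoffel_matrix h (fst z) (fst Y) $ \<beta> $ \<alpha> else 0)"
| "connection_form h \<phi> _ _ z Y = 0"

lemma cartan_frame_expansion:
  "(\<Sum>A\<in>UNIV. coframe h \<phi> X A z Y *\<^sub>R cartan_frame h \<phi> X A B z)
    = (\<Sum>C\<in>UNIV. connection_form h \<phi> C B z Y *\<^sub>R frame h \<phi> X C z)"
proof -
  obtain a b w where Y: "Y = (a, b, w)" by (metis surj_pair)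
  show ?thesis
  proof (cases B rule: adapted_index_cases)
    case (t \<beta>)
    have "(\<Sum>k\<in>UNIV. a $ k *\<^sub>R (\<Sum>i\<in>UNIV. christoffel h (fst z) i \<beta> k *\<^sub>R frame h \<phi> X (tI i) z))
        = (\<Sum>i\<in>UNIV. christoffel_matrix h (fst z) a $ i $ \<beta> *\<^sub>R frame h \<phi> X (tI i) z)"
      unfolding scaleR_sum_right
      by (subst sum.swap) (simp add: christoffel_matrix_def scaleR_sum_left mult.commute del: frame.simps)
    then show ?thesis
      unfolding t Y sum_adapted_index by (simp del: frame.simps)
  next
    case (x j)
    have "(\<Sum>k\<in>UNIV. b $ k *\<^sub>R (\<Sum>i\<in>UNIV. christoffel \<phi> (fst (snd z)) i j k *\<^sub>R frame h \<phi> X (xI i) z))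
        = (\<Sum>i\<in>UNIV. christoffel_matrix \<phi> (fst (snd z)) b $ i $ j *\<^sub>R frame h \<phi> X (xI i) z)"
      unfolding scaleR_sum_right
      by (subst sum.swap) (simp add: christoffel_matrix_def scaleR_sum_left mult.commute del: frame.simps)
    then show ?thesis
      unfolding x Y sum_adapted_index by (simp del: frame.simps)
  next
    case (v j \<beta>)
    have 1: "(\<Sum>\<gamma>\<in>UNIV. a $ \<gamma> *\<^sub>R (\<Sum>\<alpha>\<in>UNIV. christoffel h (fst z) \<beta> \<alpha> \<gamma> *\<^sub>R frame h \<phi> X (vI j \<alpha>) z))
        = (\<Sum>\<alpha>\<in>UNIV. christoffel_matrix h (fst z) a $ \<beta> $ \<alpha> *\<^sub>R frame h \<phi> X (vI j \<alpha>) z)"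
      unfolding scaleR_sum_right
      by (subst sum.swap) (simp add: christoffel_matrix_def scaleR_sum_left mult.commute del: frame.simps)
    have 2: "(\<Sum>k\<in>UNIV. b $ k *\<^sub>R (\<Sum>i\<in>UNIV. christoffel \<phi> (fst (snd z)) i j k *\<^sub>R frame h \<phi> X (vI i \<beta>) z))
        = (\<Sum>i\<in>UNIV. christoffel_matrix \<phi> (fst (snd z)) b $ i $ j *\<^sub>R frame h \<phi> X (vI i \<beta>) z)"
      unfolding scaleR_sum_right
      by (subst sum.swap) (simp add: christoffel_matrix_def scaleR_sum_left mult.commute del: frame.simps)
    have 3: "(\<Sum>i\<in>UNIV. \<Sum>\<alpha>\<in>UNIV. connection_form h \<phi> (vI i \<alpha>) (vI j \<beta>) z (a, b, w) *\<^sub>R frame h \<phi> X (vI i \<alpha>) z)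
      = (\<Sum>i\<in>UNIV. christoffel_matrix \<phi> (fst (snd z)) b $ i $ j *\<^sub>R frame h \<phi> X (vI i \<beta>) z)
       - (\<Sum>\<alpha>\<in>UNIV. christoffel_matrix h (fst z) a $ \<beta> $ \<alpha> *\<^sub>R frame h \<phi> X (vI j \<alpha>) z)"
    proof -
      have "(\<Sum>i\<in>UNIV. \<Sum>\<alpha>\<in>UNIV. (if \<alpha> = \<beta> then christoffel_matrix \<phi> (fst (snd z)) b $ i $ j else 0) *\<^sub>R frame h \<phi> X (vI i \<alpha>) z)
        = (\<Sum>i\<in>UNIV. christoffel_matrix \<phi> (fst (snd z)) b $ i $ j *\<^sub>R frame h \<phi> X (vI i \<beta>) z)"
        by (simp add: if_distrib[of "\<lambda>r. r *\<^sub>R _"] del: frame.simps cong: if_cong)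
      moreover have "(\<Sum>i\<in>UNIV. \<Sum>\<alpha>\<in>UNIV. (if i = j then christoffel_matrix h (fst z) a $ \<beta> $ \<alpha> else 0) *\<^sub>R frame h \<phi> X (vI i \<alpha>) z)
        = (\<Sum>\<alpha>\<in>UNIV. christoffel_matrix h (fst z) a $ \<beta> $ \<alpha> *\<^sub>R frame h \<phi> X (vI j \<alpha>) z)"
        by (subst sum.swap) (simp add: if_distrib[of "\<lambda>r. r *\<^sub>R _"] del: frame.simps cong: if_cong)
      ultimately show ?thesis
        by (simp add: scaleR_left_diff_distrib sum_subtractf del: frame.simps cong: if_cong)
    qed
    show ?thesis
      unfolding v Y sum_adapted_index 3
      by (simp add: 1 2 sum_negf del: frame.simps connection_form.simps(3))
  qed
qed

text \<open>Merges the derivative and the Christoffel part of \<open>cartan\<close> into one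
  coefficient for each frame vector, the shape that \<open>framed_connection\<close>
  requires.\<close>

lemma cartan_eq:
  "cartan h \<phi> X Y W z = (\<Sum>C\<in>UNIV. (frechet_derivative (\<lambda>z'. coframe h \<phi> X C z' (W z')) (at z) (Y z)
     + (\<Sum>B\<in>UNIV. connection_form h \<phi> C B z (Y z) * coframe h \<phi> X B z (W z))) *\<^sub>R frame h \<phi> X C z)"
proof -
  have "(\<Sum>A\<in>UNIV. \<Sum>B\<in>UNIV. (coframe h \<phi> X A z (Y z) * coframe h \<phi> X B z (W z)) *\<^sub>R cartan_frame h \<phi> X A B z)
      = (\<Sum>B\<in>UNIV. coframe h \<phi> X B z (W z) *\<^sub>R (\<Sum>A\<in>UNIV. coframe h \<phi> X A z (Y z) *\<^sub>R cartan_frame h \<phi> X A B z))"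
    by (subst sum.swap) (simp add: scaleR_sum_right mult.commute)
  also have "\<dots> = (\<Sum>C\<in>UNIV. (\<Sum>B\<in>UNIV. connection_form h \<phi> C B z (Y z) * coframe h \<phi> X B z (W z)) *\<^sub>R frame h \<phi> X C z)"
    unfolding cartan_frame_expansion
    by (simp only: scaleR_sum_right scaleR_sum_left, subst sum.swap) (simp add: mult.commute)
  finally show ?thesis
    unfolding cartan_def by (simp add: scaleR_left_distrib sum.distrib)
qed

section \<open>Calculus over one pair of charts\<close>

locale jet_chart = h: chart_metric h S + \<phi>: chart_metric \<phi> S'
  for h :: "real^'p::finite \<Rightarrow> real^'p^'p" and S
    and \<phi> :: "real^'n::finite \<Rightarrow> real^'n^'n" and S' +
  fixes X :: "('p, 'n) local_dtensor"
  assumes smooth_X: "smooth_on (S \<times> S' \<times> UNIV) X"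
    and X_vertical: "t \<in> S \<Longrightarrow> x \<in> S' \<Longrightarrow> X (t, x, v) = X (t, x, v')"
begin

abbreviation jets :: "('p, 'n) jet set" where "jets \<equiv> S \<times> S' \<times> UNIV"

lemma open_jets: "open jets"
  by (intro open_Times h.open_domain \<phi>.open_domain open_UNIV)

lemma smooth_on_fst: "smooth_on S f \<Longrightarrow> smooth_on jets (\<lambda>z. f (fst z))"
  by (rule smooth_on_compose_linear[OF _ bounded_linear_fst h.open_domain open_jets]) auto

lemma smooth_on_fst_snd: "smooth_on S' f \<Longrightarrow> smooth_on jets (\<lambda>z. f (fst (snd z)))"
  by (rule smooth_on_compose_linear[OF _ bounded_linear_compose[OF bounded_linear_fst bounded_linear_snd] \<phi>.open_domain open_jets]) auto

lemma smooth_on_snd_snd: "smooth_on jets (\<lambda>z. snd (snd z) $ i $ \<alpha>)"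
  by (intro smooth_on_vec_nth open_jets smooth_on_bounded_linear bounded_linear_compose[OF bounded_linear_snd bounded_linear_snd])

lemmas smooth_jet_intros = open_jets smooth_on_add[OF open_jets] smooth_on_diff[OF open_jets]
  smooth_on_minus[OF open_jets] smooth_on_mult[OF open_jets] smooth_on_sum[OF open_jets]
  smooth_on_const smooth_on_fst[OF h.smooth_christoffel] smooth_on_fst_snd[OF \<phi>.smooth_christoffel]
  smooth_on_snd_snd smooth_on_vec_nth[OF open_jets] smooth_on_fst_snd[OF \<phi>.smooth]
  smooth_on_fst_snd[OF \<phi>.smooth_inverse] smooth_on_fst[OF h.smooth] smooth_on_fst[OF h.smooth_inverse]

lemma smooth_X_cov: "smooth_on jets (\<lambda>z. X_cov \<phi> X z i \<alpha> j)"
  unfolding X_cov_def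
  by (intro smooth_jet_intros smooth_on_frechet_derivative smooth_X)

lemma smooth_M_conn: "smooth_on jets (\<lambda>z. M_conn h z i \<alpha> \<beta>)"
  unfolding M_conn_def case_prod_beta by (intro smooth_jet_intros)

lemma smooth_N_conn: "smooth_on jets (\<lambda>z. N_conn \<phi> X z i \<alpha> j)"
  unfolding N_conn_def case_prod_beta prod.collapse by (intro smooth_jet_intros smooth_X_cov)

lemma smooth_coframe: "smooth_on jets (\<lambda>z. coframe h \<phi> X A z U)"
proof -
  obtain a b w where U: "U = (a, b, w)" by (metis surj_pair)
  show ?thesis
    by (cases A rule: adapted_index_cases)
      (auto simp: U intro!: smooth_jet_intros smooth_M_conn smooth_N_conn)
qed

text \<open>The blocks are built from functions of t alone and of x alone, so their derivatives see
  the base components of V and never the fibre component.\<close>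

lemma connection_form_has_derivative:
  assumes "t \<in> S" "x \<in> S'"
  shows "((\<lambda>z. connection_form h \<phi> C B z Y) has_derivative (\<lambda>V.
    case (C, B) of
      (Inl \<alpha>, Inl \<beta>) \<Rightarrow> frechet_derivative (\<lambda>y. christoffel_matrix h y (fst Y)) (at t) (fst V) $ \<alpha> $ \<beta>
    | (Inr (Inl i), Inr (Inl j)) \<Rightarrow> frechet_derivative (\<lambda>y. christoffel_matrix \<phi> y (fst (snd Y))) (at x) (fst (snd V)) $ i $ j
    | (Inr (Inr (i, \<alpha>)), Inr (Inr (j, \<beta>))) \<Rightarrow>
       (if \<alpha> = \<beta> then frechet_derivative (\<lambda>y. christoffel_matrix \<phi> y (fst (snd Y))) (at x) (fst (snd V)) $ i $ j else 0)
       - (if i = j then frechet_derivative (\<lambda>y. christoffel_matrix h y (fst Y)) (at t) (fst V) $ \<beta> $ \<alpha> else 0)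
    | _ \<Rightarrow> 0)) (at (t, x, v))"
proof -
  have H: "((\<lambda>z. christoffel_matrix h (fst z) a $ \<alpha> $ \<beta>) has_derivative
      (\<lambda>V. frechet_derivative (\<lambda>y. christoffel_matrix h y a) (at t) (fst V) $ \<alpha> $ \<beta>)) (at (t, x, v))" for a \<alpha> \<beta>
    using assms
    by (intro bounded_linear.has_derivative[OF bounded_linear_vec_nth]
        has_derivative_compose[where f = fst and g = "\<lambda>y. christoffel_matrix h y a"]
        has_derivative_fst has_derivative_ident) (simp add: h.christoffel_matrix_has_derivative)
  have F: "((\<lambda>z. christoffel_matrix \<phi> (fst (snd z)) b $ i $ j) has_derivative
      (\<lambda>V. frechet_derivative (\<lambda>y. christoffel_matrix \<phi> y b) (at x) (fst (snd V)) $ i $ j)) (at (t, x, v))" for b i j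
    using assms
    by (intro bounded_linear.has_derivative[OF bounded_linear_vec_nth]
        has_derivative_compose[where f = "\<lambda>z. fst (snd z)" and g = "\<lambda>y. christoffel_matrix \<phi> y b"]
        has_derivative_fst has_derivative_snd has_derivative_ident) (simp add: \<phi>.christoffel_matrix_has_derivative)
  have cond: "((\<lambda>z. if P then f z else 0) has_derivative (\<lambda>V. if P then f' V else 0)) (at (t, x, v))"
    if "(f has_derivative f') (at (t, x, v))" for P and f f' :: "('p, 'n) jet \<Rightarrow> real"
    using that by (cases P) auto
  show ?thesis
    by (cases C rule: adapted_index_cases; cases B rule: adapted_index_cases)
      (auto intro!: cond H F has_derivative_diff)
qed

lemma smooth_connection_form: "smooth_on jets (\<lambda>z. connection_form h \<phi> C B z Y)"
proof -
  have H: "smooth_on jets (\<lambda>z. christoffel_matrix h (fst z) a $ \<alpha> $ \<beta>)" for a \<alpha> \<beta>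
    by (intro smooth_on_vec_nth open_jets smooth_on_fst h.smooth_christoffel_matrix)
  have F: "smooth_on jets (\<lambda>z. christoffel_matrix \<phi> (fst (snd z)) b $ i $ j)" for b i j
    by (intro smooth_on_vec_nth open_jets smooth_on_fst_snd \<phi>.smooth_christoffel_matrix)
  have cond: "smooth_on jets (\<lambda>z. if P then f z else 0)" if "smooth_on jets f"
    for P and f :: "('p, 'n) jet \<Rightarrow> real"
    using that by (cases P) auto
  show ?thesis
    by (cases C rule: adapted_index_cases; cases B rule: adapted_index_cases)
      (auto intro!: cond H F smooth_on_diff open_jets)
qed

lemma linear_connection_form: "linear (connection_form h \<phi> C B z)"
  by (cases C rule: adapted_index_cases; cases B rule: adapted_index_cases)
    (auto intro!: linearI simp: linear_add[OF linear_christoffel_matrix] linear_cmul[OF linear_christoffel_matrix] algebra_simps)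

sublocale framed_connection "frame h \<phi> X" "coframe h \<phi> X" "connection_form h \<phi>" jets "cartan h \<phi> X"
  by (rule framed_connection.intro)
    (rule open_jets coframe_frame linear_coframe smooth_coframe linear_connection_form smooth_connection_form cartan_eq)+

end

subsection \<open>The Einstein equations in the adapted frame\<close>

context chart_metric
begin

lemma linear_curvature_matrix: assumes "x \<in> S" shows "linear (curvature_matrix g x a)"
proof -
  note d = christoffel_matrix_has_derivative[OF assms]
  have 1: "linear (\<lambda>b. frechet_derivative (\<lambda>y. christoffel_matrix g y b) (at x) a)"
    using linear_frechet_derivative_family[OF linear_christoffel_matrix d] .
  have 2: "linear (\<lambda>b. frechet_derivative (\<lambda>y. christoffel_matrix g y a) (at x) b)"
    using d by (rule has_derivative_linear)
  have 3: "linear (\<lambda>b. christoffel_matrix g x a ** christoffel_matrix g x b)"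
    "linear (\<lambda>b. christoffel_matrix g x b ** christoffel_matrix g x a)"
    by (auto intro!: linearI simp: linear_add[OF linear_christoffel_matrix] linear_cmul[OF linear_christoffel_matrix]
        matrix_algebra matrix_mult.scaleR_left matrix_mult.scaleR_right)
  show ?thesis
    unfolding curvature_matrix_def by (intro linear_compose_add linear_compose_sub 1 2 3)
qed

lemma curvature_trace_eq_ricci:
  assumes "x \<in> S"
  shows "(\<Sum>i\<in>UNIV. \<Sum>j\<in>UNIV. curvature_matrix g x (axis i 1) w $ i $ j * u $ j)
    = (\<Sum>j\<in>UNIV. \<Sum>k\<in>UNIV. ricci g x j k * u $ j * w $ k)"
proof -
  have "curvature_matrix g x (axis i 1) w $ i $ j = (\<Sum>k\<in>UNIV. w $ k * curvature_matrix g x (axis i 1) (axis k 1) $ i $ j)" for i j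
    by (subst linear_axis_expansion[OF linear_curvature_matrix[OF assms]]) simp
  then have "(\<Sum>i\<in>UNIV. \<Sum>j\<in>UNIV. curvature_matrix g x (axis i 1) w $ i $ j * u $ j)
      = (\<Sum>i\<in>UNIV. \<Sum>j\<in>UNIV. \<Sum>k\<in>UNIV. curvature_matrix g x (axis i 1) (axis k 1) $ i $ j * u $ j * w $ k)"
    by (simp add: sum_distrib_left sum_distrib_right mult_ac)
  also have "\<dots> = (\<Sum>j\<in>UNIV. \<Sum>k\<in>UNIV. \<Sum>i\<in>UNIV. curvature_matrix g x (axis i 1) (axis k 1) $ i $ j * u $ j * w $ k)"
    by (subst sum.swap) (intro sum.cong refl sum.swap)
  finally show ?thesis
    by (simp add: ricci_eq_trace[OF assms] sum_distrib_right)
qed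

text \<open>In the application s is (H+r)/2, whose derivative along one factor is only half the
  derivative of that factor's own scalar curvature. Therefore \<open>dT\<close> is given separately
  from \<open>T\<close>, and s may be any number: a constant multiple of the identity is
  parallel.\<close>

lemma einstein_tensor_divergence:
  fixes s :: real
  assumes x: "x \<in> S"
  defines "T \<equiv> \<lambda>i j. raised_ricci g x i j - (if i = j then s else 0)"
    and "dT \<equiv> \<lambda>i j k. pd k (\<lambda>y. raised_ricci g y i j) x - (if i = j then pd k (scalar_curvature g) x / 2 else 0)"
  shows "(\<Sum>i\<in>UNIV. dT i j i + (\<Sum>c\<in>UNIV. T c j * christoffel g x i c i) - (\<Sum>c\<in>UNIV. T i c * christoffel g x c j i)) = 0"
proof -
  have 1: "(\<Sum>c\<in>UNIV. T c j * christoffel g x i c i)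
      = (\<Sum>c\<in>UNIV. raised_ricci g x c j * christoffel g x i c i) - s * christoffel g x i j i" for i
    by (simp add: T_def left_diff_distrib sum_subtractf if_distrib[of "\<lambda>r. r * _"] cong: if_cong)
  have 2: "(\<Sum>c\<in>UNIV. T i c * christoffel g x c j i)
      = (\<Sum>c\<in>UNIV. raised_ricci g x i c * christoffel g x c j i) - s * christoffel g x i j i" for i
    by (simp add: T_def left_diff_distrib sum_subtractf if_distrib[of "\<lambda>r. r * _"] cong: if_cong)
  have 3: "(\<Sum>i\<in>UNIV. dT i j i) = (\<Sum>i\<in>UNIV. pd i (\<lambda>y. raised_ricci g y i j) x) - pd j (scalar_curvature g) x / 2"
    by (simp add: dT_def sum_subtractf cong: if_cong)
  \<comment> \<open>P and Q are the derivative terms, A and B the Christoffel corrections of the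
    Ricci tensor. C is the contribution of s, which occurs in both corrections and cancels.\<close>
  have "P - Q / 2 + (A - C) - (B - C) = 0" if "Q = 2 * (P + (A - B))" for P Q A B C :: real
    using that by (simp add: field_simps)
  from this[OF contracted_bianchi[OF x, of j, unfolded sum.distrib sum_subtractf]] show ?thesis
    unfolding 1 2 sum.distrib sum_subtractf 3 .
qed

end

lemma matrix_inv_unique:
  fixes A B :: "real^'n::finite^'n"
  assumes "A ** B = mat 1"
  shows "matrix_inv A = B"
proof -
  have "invertible A"
    using assms invertible_right_inverse by blast
  then have "matrix_inv A ** (A ** B) = B"
    by (simp add: matrix_mul_assoc matrix_inv(2))
  then show ?thesis by (simp add: assms)
qed

lemma bilinearI:
  assumes "\<And>u u' v. f (u + u') v = f u v + f u' v" "\<And>r u v. f (r *\<^sub>R u) v = r *\<^sub>R f u v"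
    and "\<And>u v v'. f u (v + v') = f u v + f u v'" "\<And>r u v. f u (r *\<^sub>R v) = r *\<^sub>R f u v"
  shows "bilinear f"
  unfolding bilinear_def using assms by (auto intro!: linearI)

lemma bilinear_frame_expansion:
  fixes f :: "('p::finite, 'n::finite) jet \<Rightarrow> ('p, 'n) jet \<Rightarrow> real"
  assumes "bilinear f"
  shows "f U V = (\<Sum>A\<in>UNIV. \<Sum>B\<in>UNIV. coframe h \<phi> X A z U * coframe h \<phi> X B z V
    * f (frame h \<phi> X A z) (frame h \<phi> X B z))"
proof -
  have "f U V = f (\<Sum>A\<in>UNIV. coframe h \<phi> X A z U *\<^sub>R frame h \<phi> X A z) (\<Sum>B\<in>UNIV. coframe h \<phi> X B z V *\<^sub>R frame h \<phi> X B z)"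
    by (simp only: frame_expansion)
  also have "\<dots> = (\<Sum>A\<in>UNIV. \<Sum>B\<in>UNIV. coframe h \<phi> X A z U * coframe h \<phi> X B z V
    * f (frame h \<phi> X A z) (frame h \<phi> X B z))"
    by (simp add: bilinear_sum[OF assms] bilinear_lmul[OF assms] bilinear_rmul[OF assms] sum.cartesian_product mult_ac)
  finally show ?thesis .
qed

lemma bilinear_eq_on_frame:
  fixes f g :: "('p::finite, 'n::finite) jet \<Rightarrow> ('p, 'n) jet \<Rightarrow> real"
  assumes "bilinear f" "bilinear g"
  shows "(\<forall>U V. f U V = g U V) \<longleftrightarrow>
    (\<forall>A B. f (frame h \<phi> X A z) (frame h \<phi> X B z) = g (frame h \<phi> X A z) (frame h \<phi> X B z))"
proof (intro iffI allI)
  assume *: "\<forall>A B. f (frame h \<phi> X A z) (frame h \<phi> X B z) = g (frame h \<phi> X A z) (frame h \<phi> X B z)"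
  show "f U V = g U V" for U V
    using bilinear_frame_expansion[OF assms(1), of U V h \<phi> X z]
      bilinear_frame_expansion[OF assms(2), of U V h \<phi> X z]
    by (simp only: *)
qed blast

text \<open>The components of G in explicit form. They differ from
  \<open>potential_component\<close> in the vertical block, where the Hessian of the Lagrangian has
  been evaluated; \<open>potential_component_eq\<close> justifies this.\<close>

fun sasaki_component ::
    "'p::finite local_metric \<Rightarrow> 'n::finite local_metric \<Rightarrow> ('p, 'n) jet
      \<Rightarrow> ('p, 'n) adapted_index \<Rightarrow> ('p, 'n) adapted_index \<Rightarrow> real" where
  "sasaki_component h \<phi> z (tI \<alpha>) (tI \<beta>) = h (fst z) $ \<alpha> $ \<beta>"
| "sasaki_component h \<phi> z (xI i) (xI j) = \<phi> (fst (snd z)) $ i $ j"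
| "sasaki_component h \<phi> z (vI i \<alpha>) (vI j \<beta>) = matrix_inv (h (fst z)) $ \<alpha> $ \<beta> * \<phi> (fst (snd z)) $ i $ j"
| "sasaki_component h \<phi> z _ _ = 0"

fun sasaki_inverse_component ::
    "'p::finite local_metric \<Rightarrow> 'n::finite local_metric \<Rightarrow> ('p, 'n) jet
      \<Rightarrow> ('p, 'n) adapted_index \<Rightarrow> ('p, 'n) adapted_index \<Rightarrow> real" where
  "sasaki_inverse_component h \<phi> z (tI \<alpha>) (tI \<beta>) = matrix_inv (h (fst z)) $ \<alpha> $ \<beta>"
| "sasaki_inverse_component h \<phi> z (xI i) (xI j) = matrix_inv (\<phi> (fst (snd z))) $ i $ j"
| "sasaki_inverse_component h \<phi> z (vI i \<alpha>) (vI j \<beta>) = h (fst z) $ \<alpha> $ \<beta> * matrix_inv (\<phi> (fst (snd z))) $ i $ j"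
| "sasaki_inverse_component h \<phi> z _ _ = 0"

text \<open>A single sum over adapted indices, which duality of frame and coframe evaluates at
  once.\<close>

lemma sasaki_metric_eq:
  "sasaki_metric h \<phi> X z U V = (\<Sum>A\<in>UNIV. \<Sum>B\<in>UNIV.
     sasaki_component h \<phi> z A B * coframe h \<phi> X A z U * coframe h \<phi> X B z V)"
proof -
  have "(\<Sum>i\<in>UNIV. \<Sum>\<alpha>\<in>UNIV. \<Sum>j\<in>UNIV. \<Sum>\<beta>\<in>UNIV. F \<alpha> \<beta> i j)
      = (\<Sum>\<alpha>\<in>UNIV. \<Sum>\<beta>\<in>UNIV. \<Sum>i\<in>UNIV. \<Sum>j\<in>UNIV. F \<alpha> \<beta> i j)"
    for F :: "'a \<Rightarrow> 'a \<Rightarrow> 'b \<Rightarrow> 'b \<Rightarrow> real"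
  proof -
    have "(\<Sum>i\<in>UNIV. \<Sum>\<alpha>\<in>UNIV. \<Sum>j\<in>UNIV. \<Sum>\<beta>\<in>UNIV. F \<alpha> \<beta> i j)
        = (\<Sum>\<alpha>\<in>UNIV. \<Sum>i\<in>UNIV. \<Sum>j\<in>UNIV. \<Sum>\<beta>\<in>UNIV. F \<alpha> \<beta> i j)"
      by (rule sum.swap)
    also have "\<dots> = (\<Sum>\<alpha>\<in>UNIV. \<Sum>i\<in>UNIV. \<Sum>\<beta>\<in>UNIV. \<Sum>j\<in>UNIV. F \<alpha> \<beta> i j)"
      by (intro sum.cong refl sum.swap)
    also have "\<dots> = (\<Sum>\<alpha>\<in>UNIV. \<Sum>\<beta>\<in>UNIV. \<Sum>i\<in>UNIV. \<Sum>j\<in>UNIV. F \<alpha> \<beta> i j)"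
      by (intro sum.cong refl sum.swap)
    finally show ?thesis .
  qed
  then show ?thesis
    unfolding sasaki_metric_def sum_adapted_index Let_def
    by (simp del: coframe.simps add: sum.distrib)
qed

lemma sasaki_metric_frame:
  "sasaki_metric h \<phi> X z (frame h \<phi> X A z) (frame h \<phi> X B z) = sasaki_component h \<phi> z A B"
  unfolding sasaki_metric_eq coframe_frame
  by (simp add: if_distrib[of "(*) _"] if_distrib[of "\<lambda>r. r * _"] cong: if_cong)

lemma bilinear_sasaki_metric: "bilinear (sasaki_metric h \<phi> X z)"
  unfolding sasaki_metric_eq
  by (rule bilinearI) (simp_all add: linear_add[OF linear_coframe] linear_cmul[OF linear_coframe]
      algebra_simps sum.distrib sum_distrib_left)

section \<open>Ricci tensor and Einstein equations over one pair of charts\<close>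

context jet_chart
begin

text \<open>G is block diagonal on the frame, and the inverse of a Kronecker product is the
  Kronecker product of the inverses.\<close>

lemma sasaki_inverse:
  assumes "t \<in> S" "x \<in> S'"
  shows "matrix_inv (\<chi> A B. sasaki_component h \<phi> (t, x, v) A B) = (\<chi> A B. sasaki_inverse_component h \<phi> (t, x, v) A B)"
proof (rule matrix_inv_unique)
  have H: "(\<Sum>\<gamma>\<in>UNIV. h t $ \<alpha> $ \<gamma> * matrix_inv (h t) $ \<gamma> $ \<beta>) = (if \<alpha> = \<beta> then 1 else 0)"
    "(\<Sum>\<gamma>\<in>UNIV. matrix_inv (h t) $ \<alpha> $ \<gamma> * h t $ \<gamma> $ \<beta>) = (if \<alpha> = \<beta> then 1 else 0)" for \<alpha> \<beta>
    using arg_cong[OF h.inverse_right[OF assms(1)], of "\<lambda>A. A $ \<alpha> $ \<beta>"]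
      arg_cong[OF h.inverse_left[OF assms(1)], of "\<lambda>A. A $ \<alpha> $ \<beta>"]
    by (simp_all add: matrix_matrix_mult_def mat_def)
  have F: "(\<Sum>k\<in>UNIV. \<phi> x $ i $ k * matrix_inv (\<phi> x) $ k $ j) = (if i = j then 1 else 0)" for i j
    using arg_cong[OF \<phi>.inverse_right[OF assms(2)], of "\<lambda>A. A $ i $ j"]
    by (simp_all add: matrix_matrix_mult_def mat_def)
  have "(\<Sum>C\<in>UNIV. sasaki_component h \<phi> (t, x, v) A C * sasaki_inverse_component h \<phi> (t, x, v) C B) = (if A = B then 1 else 0)" for A B
  proof -
    have V: "(\<Sum>k\<in>UNIV. \<Sum>\<gamma>\<in>UNIV. matrix_inv (h t) $ \<alpha> $ \<gamma> * \<phi> x $ i $ k * (h t $ \<gamma> $ \<beta> * matrix_inv (\<phi> x) $ k $ j))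
        = (if i = j \<and> \<alpha> = \<beta> then 1 else 0)" for i \<alpha> j \<beta>
    proof -
      have "(\<Sum>k\<in>UNIV. \<Sum>\<gamma>\<in>UNIV. matrix_inv (h t) $ \<alpha> $ \<gamma> * \<phi> x $ i $ k * (h t $ \<gamma> $ \<beta> * matrix_inv (\<phi> x) $ k $ j))
        = (\<Sum>k\<in>UNIV. \<phi> x $ i $ k * matrix_inv (\<phi> x) $ k $ j * (\<Sum>\<gamma>\<in>UNIV. matrix_inv (h t) $ \<alpha> $ \<gamma> * h t $ \<gamma> $ \<beta>))"
        by (simp add: sum_distrib_left mult_ac)
      then show ?thesis by (simp add: H F sum_distrib_right[symmetric])
    qed
    show ?thesis
      unfolding sum_adapted_index
      by (cases A rule: adapted_index_cases; cases B rule: adapted_index_cases)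
        (simp_all add: H F V)
  qed
  then show "(\<chi> A B. sasaki_component h \<phi> (t, x, v) A B) ** (\<chi> A B. sasaki_inverse_component h \<phi> (t, x, v) A B) = mat 1"
    by (simp add: vec_eq_iff matrix_matrix_mult_def mat_def)
qed

lemma curvature_form_t:
  assumes "t \<in> S" "x \<in> S'"
  shows "curvature_form (tI \<alpha>) B (t, x, v) Y Z
    = (case B of Inl \<beta> \<Rightarrow> curvature_matrix h t (fst Y) (fst Z) $ \<alpha> $ \<beta> | Inr _ \<Rightarrow> 0)"
  unfolding curvature_form_def sum_adapted_index frechet_derivative_eqI[OF connection_form_has_derivative[OF assms]]
  by (cases B rule: adapted_index_cases)
    (simp_all add: curvature_matrix_def matrix_matrix_mult_def sum_subtractf)

lemma curvature_form_x:
  assumes "t \<in> S" "x \<in> S'"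
  shows "curvature_form (xI i) B (t, x, v) Y Z
    = (case B of Inr (Inl j) \<Rightarrow> curvature_matrix \<phi> x (fst (snd Y)) (fst (snd Z)) $ i $ j | _ \<Rightarrow> 0)"
  unfolding curvature_form_def sum_adapted_index frechet_derivative_eqI[OF connection_form_has_derivative[OF assms]]
  by (cases B rule: adapted_index_cases)
    (simp_all add: curvature_matrix_def matrix_matrix_mult_def sum_subtractf)

text \<open>The connection forms are pulled back from T and M, hence so are their curvatures, and
  these vanish on a vertical vector.\<close>

lemma curvature_form_vertical:
  assumes "t \<in> S" "x \<in> S'" and Y: "fst Y = 0" "fst (snd Y) = 0"
  shows "curvature_form C B (t, x, v) Y Z = 0"
proof -
  have form: "connection_form h \<phi> C B z Y = 0" for C B z
    by (cases C rule: adapted_index_cases; cases B rule: adapted_index_cases)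
      (simp_all add: Y linear_0[OF linear_christoffel_matrix])
  have D: "frechet_derivative (\<lambda>y. christoffel_matrix h y a) (at t) 0 = 0"
    "frechet_derivative (\<lambda>y. christoffel_matrix \<phi> y b) (at x) 0 = 0" for a b
    using h.christoffel_matrix_has_derivative[OF assms(1)] \<phi>.christoffel_matrix_has_derivative[OF assms(2)]
    by (auto intro!: linear_0 has_derivative_linear)
  have "frechet_derivative (\<lambda>z. connection_form h \<phi> C B z Z) (at (t, x, v)) Y = 0"
    unfolding frechet_derivative_eqI[OF connection_form_has_derivative[OF assms(1,2)]] Y D
    by (auto split: sum.splits)
  then show ?thesis
    by (simp add: curvature_form_def form)
qed

text \<open>In the frame trace the vertical terms vanish by \<open>curvature_form_vertical\<close>,
  and the other two blocks are the Ricci traces of \<open>h\<close> and \<phi>.\<close>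

lemma ricci_cartan:
  assumes "t \<in> S" "x \<in> S'"
  shows "ricci_of_connection (cartan h \<phi> X) (t, x, v) U V
    = (\<Sum>\<alpha>\<in>UNIV. \<Sum>\<beta>\<in>UNIV. ricci h t \<alpha> \<beta> * fst U $ \<alpha> * fst V $ \<beta>)
      + (\<Sum>i\<in>UNIV. \<Sum>j\<in>UNIV. ricci \<phi> x i j * fst (snd U) $ i * fst (snd V) $ j)"
proof -
  have z: "(t, x, v) \<in> jets" using assms by simp
  have co: "coframe h \<phi> X (tI \<alpha>) z U = fst U $ \<alpha>" "coframe h \<phi> X (xI i) z U = fst (snd U) $ i" for \<alpha> i z
    by (cases U; simp)+
  have "(\<Sum>B\<in>UNIV. curvature_form (tI \<alpha>) B (t, x, v) (frame h \<phi> X (tI \<alpha>) (t, x, v)) V * coframe h \<phi> X B (t, x, v) U)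
      = (\<Sum>\<beta>\<in>UNIV. curvature_matrix h t (axis \<alpha> 1) (fst V) $ \<alpha> $ \<beta> * fst U $ \<beta>)" for \<alpha>
    by (simp add: curvature_form_t[OF assms] sum_adapted_index co)
  moreover have "(\<Sum>B\<in>UNIV. curvature_form (xI i) B (t, x, v) (frame h \<phi> X (xI i) (t, x, v)) V * coframe h \<phi> X B (t, x, v) U)
      = (\<Sum>j\<in>UNIV. curvature_matrix \<phi> x (axis i 1) (fst (snd V)) $ i $ j * fst (snd U) $ j)" for i
    by (simp add: curvature_form_x[OF assms] sum_adapted_index co)
  moreover have "(\<Sum>B\<in>UNIV. curvature_form (vI i \<alpha>) B (t, x, v) (frame h \<phi> X (vI i \<alpha>) (t, x, v)) V * coframe h \<phi> X B (t, x, v) U) = 0" for i \<alpha>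
    by (simp add: curvature_form_vertical[OF assms])
  ultimately show ?thesis
    unfolding ricci_frame_trace[OF z] sum_adapted_index[of "\<lambda>C. \<Sum>B\<in>UNIV. _ C B"]
    by (simp add: h.curvature_trace_eq_ricci[OF assms(1)] \<phi>.curvature_trace_eq_ricci[OF assms(2)])
qed

fun ricci_component :: "('p, 'n) jet \<Rightarrow> ('p, 'n) adapted_index \<Rightarrow> ('p, 'n) adapted_index \<Rightarrow> real" where
  "ricci_component z (tI \<alpha>) (tI \<beta>) = ricci h (fst z) \<alpha> \<beta>"
| "ricci_component z (xI i) (xI j) = ricci \<phi> (fst (snd z)) i j"
| "ricci_component z _ _ = 0"

lemma ricci_cartan_frame:
  assumes "t \<in> S" "x \<in> S'"
  shows "ricci_of_connection (cartan h \<phi> X) (t, x, v) (frame h \<phi> X A (t, x, v)) (frame h \<phi> X B (t, x, v))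
    = ricci_component (t, x, v) A B"
  unfolding ricci_cartan[OF assms]
  by (cases A rule: adapted_index_cases; cases B rule: adapted_index_cases)
    (simp_all add: axis_def if_distrib[of "(*) _"] if_distrib[of "\<lambda>r. r * _"] cong: if_cong)

lemma bilinear_ricci_cartan:
  assumes "t \<in> S" "x \<in> S'"
  shows "bilinear (ricci_of_connection (cartan h \<phi> X) (t, x, v))"
  unfolding ricci_cartan[OF assms]
  by (rule bilinearI) (simp_all add: algebra_simps sum.distrib sum_distrib_left)

text \<open>Ric has no vertical block, so the vertical block of the inverse of G meets only
  zeros.\<close>

lemma cartan_scalar_eq:
  assumes "t \<in> S" "x \<in> S'"
  shows "cartan_scalar h \<phi> X (sasaki_metric h \<phi> X) (t, x, v) = scalar_curvature h t + scalar_curvature \<phi> x"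
  unfolding cartan_scalar_def adapted_component_def sasaki_metric_frame sasaki_inverse[OF assms] ricci_cartan_frame[OF assms]
  by (simp add: sum_adapted_index scalar_curvature_def sum.distrib)

lemma einstein_equations_on_frame:
  assumes T: "\<forall>z\<in>jets. bilinear (T z)"
  shows "einstein_equations h \<phi> X (sasaki_metric h \<phi> X) K T jets \<longleftrightarrow>
    (\<forall>t x v. (t, x, v) \<in> jets \<longrightarrow> (\<forall>A B. ricci_component (t, x, v) A B
       - (scalar_curvature h t + scalar_curvature \<phi> x) / 2 * sasaki_component h \<phi> (t, x, v) A B
       = K * adapted_component h \<phi> X T (t, x, v) A B))"
proof -
  have main: "(\<forall>U V. ricci_of_connection (cartan h \<phi> X) (t, x, v) U V
        - (1/2) * cartan_scalar h \<phi> X (sasaki_metric h \<phi> X) (t, x, v) * sasaki_metric h \<phi> X (t, x, v) U V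
        = K * T (t, x, v) U V) \<longleftrightarrow> (\<forall>A B. ricci_component (t, x, v) A B
       - (scalar_curvature h t + scalar_curvature \<phi> x) / 2 * sasaki_component h \<phi> (t, x, v) A B
       = K * adapted_component h \<phi> X T (t, x, v) A B)" if z: "(t, x, v) \<in> jets" for t x v
  proof -
    have tx: "t \<in> S" "x \<in> S'" using z by auto
    let ?s = "(1/2) * (scalar_curvature h t + scalar_curvature \<phi> x)"
    note R = bilinear_ricci_cartan[OF tx, of v] and G = bilinear_sasaki_metric[of h \<phi> X "(t, x, v)"] and Tz = bspec[OF T z]
    have L: "bilinear (\<lambda>U V. ricci_of_connection (cartan h \<phi> X) (t, x, v) U V - ?s * sasaki_metric h \<phi> X (t, x, v) U V)"
      by (rule bilinearI) (simp_all add: bilinear_ladd[OF R] bilinear_radd[OF R] bilinear_lmul[OF R] bilinear_rmul[OF R]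
          bilinear_ladd[OF G] bilinear_radd[OF G] bilinear_lmul[OF G] bilinear_rmul[OF G] algebra_simps)
    have Rt: "bilinear (\<lambda>U V. K * T (t, x, v) U V)"
      by (rule bilinearI) (simp_all add: bilinear_ladd[OF Tz] bilinear_radd[OF Tz] bilinear_lmul[OF Tz] bilinear_rmul[OF Tz] algebra_simps)
    show ?thesis
      unfolding cartan_scalar_eq[OF tx]
        bilinear_eq_on_frame[OF L Rt, where h = h and \<phi> = \<phi> and X = X and z = "(t, x, v)"]
        ricci_cartan_frame[OF tx] sasaki_metric_frame adapted_component_def by simp
  qed
  have split: "(\<forall>z\<in>jets. P z) \<longleftrightarrow> (\<forall>t x v. (t, x, v) \<in> jets \<longrightarrow> P (t, x, v))" for P
    by auto
  show ?thesis
    unfolding einstein_equations_def split by (intro iff_allI imp_cong refl) (rule main)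
qed

end

subsection \<open>Conservation laws\<close>

text \<open>Meant for c = 1/K and s = (H+r)/2: raising an index turns the metric term into a
  multiple of the identity.\<close>

lemma (in chart_metric) raised_einstein:
  assumes "x \<in> S"
  shows "(\<Sum>k\<in>UNIV. matrix_inv (g x) $ i $ k * (c * (ricci g x k j - s * g x $ k $ j)))
    = c * (raised_ricci g x i j - (if i = j then s else 0))"
proof -
  have "(\<Sum>k\<in>UNIV. matrix_inv (g x) $ i $ k * g x $ k $ j) = (if i = j then 1 else 0)"
    using arg_cong[OF inverse_left[OF assms], of "\<lambda>A. A $ i $ j"] by (simp add: matrix_matrix_mult_def mat_def)
  moreover have "(\<Sum>k\<in>UNIV. matrix_inv (g x) $ i $ k * (c * (ricci g x k j - s * g x $ k $ j)))
      = c * (raised_ricci g x i j - s * (\<Sum>k\<in>UNIV. matrix_inv (g x) $ i $ k * g x $ k $ j))"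
    by (simp add: raised_ricci_def algebra_simps sum_subtractf sum_distrib_left)
  ultimately show ?thesis by simp
qed

context jet_chart
begin

lemma has_derivative_fst_comp:
  assumes "smooth_on S f" "t \<in> S"
  shows "((\<lambda>z. f (fst z)) has_derivative (\<lambda>V. frechet_derivative f (at t) (fst V))) (at (t, x, v))"
  using assms smooth_on_has_derivative[OF assms(1) h.open_domain assms(2)]
  by (intro has_derivative_compose[where f = fst and g = f] has_derivative_fst has_derivative_ident) simp

lemma has_derivative_fst_snd_comp:
  assumes "smooth_on S' f" "x \<in> S'"
  shows "((\<lambda>z. f (fst (snd z))) has_derivative (\<lambda>V. frechet_derivative f (at x) (fst (snd V)))) (at (t, x, v))"
  using assms smooth_on_has_derivative[OF assms(1) \<phi>.open_domain assms(2)]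
  by (intro has_derivative_compose[where f = "\<lambda>z. fst (snd z)" and g = f] has_derivative_fst has_derivative_snd has_derivative_ident) simp

text \<open>After differentiation the sum H + r enters only as the number \<open>?s t x\<close>, so
  the identity of \<open>einstein_tensor_divergence\<close> for \<open>h\<close> alone applies. The
  factor c will be 1/K.\<close>

lemma t_divergence_einstein:
  assumes tx: "t \<in> S" "x \<in> S'"
    and T: "\<And>t x v \<alpha> \<beta>. t \<in> S \<Longrightarrow> x \<in> S' \<Longrightarrow> T (t, x, v) (tI \<alpha>) (tI \<beta>)
      = c * (ricci h t \<alpha> \<beta> - (scalar_curvature h t + scalar_curvature \<phi> x) / 2 * h t $ \<alpha> $ \<beta>)"
  shows "(\<Sum>\<mu>\<in>UNIV. t_cov h (t_raised h T) (t, x, v) \<mu> \<beta> \<mu>) = 0"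
proof -
  let ?s = "\<lambda>t x. (scalar_curvature h t + scalar_curvature \<phi> x) / 2"
  let ?D = "\<lambda>\<mu> V. c * (frechet_derivative (\<lambda>t. raised_ricci h t \<mu> \<beta>) (at t) (fst V)
        - (if \<mu> = \<beta> then 1 else 0) * (1/2 * (frechet_derivative (scalar_curvature h) (at t) (fst V)
           + frechet_derivative (scalar_curvature \<phi>) (at x) (fst (snd V)))))"
  have raised: "t_raised h T (t, x, v) \<mu> \<beta> = c * (raised_ricci h t \<mu> \<beta> - (if \<mu> = \<beta> then ?s t x else 0))"
    if "t \<in> S" "x \<in> S'" for t x v \<mu> \<beta>
    unfolding t_raised_def by (simp only: T that fst_conv h.raised_einstein)
  \<comment> \<open>A direction along T has no x component, so the derivative of r drops
    out.\<close>
  have zero: "frechet_derivative (scalar_curvature \<phi>) (at x) 0 = 0"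
    using smooth_on_has_derivative[OF \<phi>.smooth_scalar_curvature \<phi>.open_domain tx(2)]
    by (intro linear_0 has_derivative_linear)
  have "((\<lambda>z. c * (raised_ricci h (fst z) \<mu> \<beta> - (if \<mu> = \<beta> then 1 else 0) * (1/2 * (scalar_curvature h (fst z) + scalar_curvature \<phi> (fst (snd z))))))
      has_derivative (?D \<mu>)) (at (t, x, v))" for \<mu>
    by (intro has_derivative_mult_right has_derivative_diff has_derivative_add
        has_derivative_fst_comp[OF h.smooth_raised_ricci] has_derivative_fst_comp[OF h.smooth_scalar_curvature]
        has_derivative_fst_snd_comp[OF \<phi>.smooth_scalar_curvature] tx)
  then have "((\<lambda>z. t_raised h T z \<mu> \<beta>) has_derivative (?D \<mu>)) (at (t, x, v))" for \<mu>
    by (rule has_derivative_transform_within_open[OF _ open_jets]) (use tx in \<open>auto simp: raised\<close>)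
  note D = frechet_derivative_eqI[OF this]
  have "t_cov h (t_raised h T) (t, x, v) \<mu> \<beta> \<nu> =
      c * ((pd \<nu> (\<lambda>t. raised_ricci h t \<mu> \<beta>) t - (if \<mu> = \<beta> then pd \<nu> (scalar_curvature h) t / 2 else 0))
      + (\<Sum>\<kappa>\<in>UNIV. (raised_ricci h t \<kappa> \<beta> - (if \<kappa> = \<beta> then ?s t x else 0)) * christoffel h t \<mu> \<kappa> \<nu>)
      - (\<Sum>\<kappa>\<in>UNIV. (raised_ricci h t \<mu> \<kappa> - (if \<mu> = \<kappa> then ?s t x else 0)) * christoffel h t \<kappa> \<beta> \<nu>))" for \<mu> \<nu>
    unfolding t_cov_def D raised[OF tx] 
    by (simp only: mult.assoc sum_distrib_left[symmetric] distrib_left[symmetric] right_diff_distrib[symmetric])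
      (simp add: pd_def zero)
  then show ?thesis
    using h.einstein_tensor_divergence[OF tx(1), of \<beta> "?s t x"] by (simp only: sum_distrib_left[symmetric] mult_zero_right)
qed

lemma x_divergence_einstein:
  assumes tx: "t \<in> S" "x \<in> S'"
    and T: "\<And>t x v i j. t \<in> S \<Longrightarrow> x \<in> S' \<Longrightarrow> T (t, x, v) (xI i) (xI j)
      = c * (ricci \<phi> x i j - (scalar_curvature h t + scalar_curvature \<phi> x) / 2 * \<phi> x $ i $ j)"
  shows "(\<Sum>m\<in>UNIV. x_cov \<phi> (x_raised \<phi> T) (t, x, v) m j m) = 0"
proof -
  let ?s = "\<lambda>t x. (scalar_curvature h t + scalar_curvature \<phi> x) / 2"
  let ?D = "\<lambda>m V. c * (frechet_derivative (\<lambda>x. raised_ricci \<phi> x m j) (at x) (fst (snd V))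
        - (if m = j then 1 else 0) * (1/2 * (frechet_derivative (scalar_curvature h) (at t) (fst V)
           + frechet_derivative (scalar_curvature \<phi>) (at x) (fst (snd V)))))"
  have raised: "x_raised \<phi> T (t, x, v) m j = c * (raised_ricci \<phi> x m j - (if m = j then ?s t x else 0))"
    if "t \<in> S" "x \<in> S'" for t x v m j
    unfolding x_raised_def by (simp only: T that fst_conv snd_conv \<phi>.raised_einstein)
  \<comment> \<open>Likewise a direction along M has no t component, and the derivative of H drops
    out.\<close>
  have zero: "frechet_derivative (scalar_curvature h) (at t) 0 = 0"
    using smooth_on_has_derivative[OF h.smooth_scalar_curvature h.open_domain tx(1)]
    by (intro linear_0 has_derivative_linear)
  have "((\<lambda>z. c * (raised_ricci \<phi> (fst (snd z)) m j - (if m = j then 1 else 0) * (1/2 * (scalar_curvature h (fst z) + scalar_curvature \<phi> (fst (snd z))))))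
      has_derivative (?D m)) (at (t, x, v))" for m
    by (intro has_derivative_mult_right has_derivative_diff has_derivative_add
        has_derivative_fst_snd_comp[OF \<phi>.smooth_raised_ricci] has_derivative_fst_comp[OF h.smooth_scalar_curvature]
        has_derivative_fst_snd_comp[OF \<phi>.smooth_scalar_curvature] tx)
  then have "((\<lambda>z. x_raised \<phi> T z m j) has_derivative (?D m)) (at (t, x, v))" for m
    by (rule has_derivative_transform_within_open[OF _ open_jets]) (use tx in \<open>auto simp: raised\<close>)
  note D = frechet_derivative_eqI[OF this]
  have "x_cov \<phi> (x_raised \<phi> T) (t, x, v) m j k =
      c * ((pd k (\<lambda>x. raised_ricci \<phi> x m j) x - (if m = j then pd k (scalar_curvature \<phi>) x / 2 else 0))
      + (\<Sum>l\<in>UNIV. (raised_ricci \<phi> x l j - (if l = j then ?s t x else 0)) * christoffel \<phi> x m l k)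
      - (\<Sum>l\<in>UNIV. (raised_ricci \<phi> x m l - (if m = l then ?s t x else 0)) * christoffel \<phi> x l j k))" for m k
    unfolding x_cov_def D raised[OF tx] 
    by (simp only: mult.assoc sum_distrib_left[symmetric] distrib_left[symmetric] right_diff_distrib[symmetric])
      (simp add: pd_def zero)
  then show ?thesis
    using \<phi>.einstein_tensor_divergence[OF tx(2), of j "?s t x"] by (simp only: sum_distrib_left[symmetric] mult_zero_right)
qed

end

subsection \<open>The Sasakian-like metric\<close>

lemma sum_insert_quadratic:
  fixes a :: "'i \<Rightarrow> 'i \<Rightarrow> real"
  assumes "finite I" "p \<notin> I" and sym: "\<And>i j. a i j = a j i"
  shows "(\<Sum>i\<in>insert p I. \<Sum>j\<in>insert p I. a i j * u i * u j)
    = (\<Sum>i\<in>I. \<Sum>j\<in>I. a i j * u i * u j) + 2 * u p * (\<Sum>i\<in>I. a i p * u i) + a p p * (u p)\<^sup>2"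
proof -
  have "(\<Sum>j\<in>I. a p j * u p * u j) = u p * (\<Sum>i\<in>I. a i p * u i)"
    unfolding sum_distrib_left by (intro sum.cong refl) (simp add: sym[of p] mult_ac)
  moreover have "(\<Sum>i\<in>I. a i p * u i * u p) = u p * (\<Sum>i\<in>I. a i p * u i)"
    unfolding sum_distrib_left by (intro sum.cong refl) (simp add: mult_ac)
  ultimately show ?thesis
    using assms(1,2) by (simp add: sum.distrib power2_eq_square algebra_simps)
qed

text \<open>Cholesky decomposition: complete the square in one variable at a time.\<close>

lemma positive_definite_sum_of_squares:
  fixes a :: "'i \<Rightarrow> 'i \<Rightarrow> real"
  assumes "finite I" "\<And>i j. a i j = a j i"
    and "\<And>u. \<exists>i\<in>I. u i \<noteq> 0 \<Longrightarrow> (\<Sum>i\<in>I. \<Sum>j\<in>I. a i j * u i * u j) > 0"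
  shows "\<exists>b. \<forall>i\<in>I. \<forall>j\<in>I. a i j = (\<Sum>k\<in>I. b k i * b k j)"
  using assms
proof (induction I arbitrary: a rule: finite_induct)
  case empty
  then show ?case by simp
next
  case (insert p I)
  note quad = sum_insert_quadratic[OF insert.hyps insert.prems(1)]
  have pp: "a p p > 0"
  proof -
    let ?u = "\<lambda>i. if i = p then 1 else 0 :: real"
    have "(\<Sum>i\<in>I. \<Sum>j\<in>I. a i j * ?u i * ?u j) = 0" "(\<Sum>i\<in>I. a i p * ?u i) = 0"
      using insert.hyps(2) by (auto intro!: sum.neutral)
    with insert.prems(2)[of ?u] show ?thesis
      unfolding quad by simp
  qed
  \<comment> \<open>The Schur complement of the pivot \<open>a p p\<close>.\<close>
  define a' where "a' i j = a i j - a i p * a j p / a p p" for i j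
  have sym': "a' i j = a' j i" for i j
    by (simp add: a'_def insert.prems(1)[of i j])
  have pos': "(\<Sum>i\<in>I. \<Sum>j\<in>I. a' i j * u i * u j) > 0" if "\<exists>i\<in>I. u i \<noteq> 0" for u
  proof -
    let ?L = "\<Sum>i\<in>I. a i p * u i"
    \<comment> \<open>This value of the variable p makes the completed square vanish, so the form on
      the larger index set equals the Schur complement on u.\<close>
    let ?u = "u(p := - ?L / a p p)"
    have u: "(\<Sum>i\<in>I. \<Sum>j\<in>I. a i j * ?u i * ?u j) = (\<Sum>i\<in>I. \<Sum>j\<in>I. a i j * u i * u j)"
      "(\<Sum>i\<in>I. a i p * ?u i) = ?L"
      using insert.hyps(2) by (auto intro!: sum.cong)
    have "0 < (\<Sum>i\<in>insert p I. \<Sum>j\<in>insert p I. a i j * ?u i * ?u j)"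
      using that insert.hyps(2) by (intro insert.prems(2)) auto
    also have "\<dots> = (\<Sum>i\<in>I. \<Sum>j\<in>I. a i j * u i * u j) - ?L\<^sup>2 / a p p"
      unfolding quad u using pp by (simp add: power2_eq_square field_simps)
    also have "?L\<^sup>2 / a p p = (\<Sum>i\<in>I. \<Sum>j\<in>I. a i p * a j p / a p p * u i * u j)"
      by (simp add: power2_eq_square sum_product sum_divide_distrib mult_ac)
    also have "(\<Sum>i\<in>I. \<Sum>j\<in>I. a i j * u i * u j) - \<dots> = (\<Sum>i\<in>I. \<Sum>j\<in>I. a' i j * u i * u j)"
      by (simp add: a'_def sum_subtractf[symmetric] algebra_simps)
    finally show ?thesis .
  qed
  obtain b where b: "\<forall>i\<in>I. \<forall>j\<in>I. a' i j = (\<Sum>k\<in>I. b k i * b k j)"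
    using insert.IH[OF sym' pos'] by blast
  \<comment> \<open>Row p produces the rank-one term of the pivot. The other rows come from b and
    are set to 0 in column p, where the induction hypothesis says nothing about b.\<close>
  define c where "c k i = (if k = p then a i p / sqrt (a p p) else if i = p then 0 else b k i)" for k i
  have rest: "(\<Sum>k\<in>I. c k i * c k j) = (if i = p \<or> j = p then 0 else a' i j)"
    if "i \<in> insert p I" "j \<in> insert p I" for i j
  proof -
    have "(\<Sum>k\<in>I. c k i * c k j) = (\<Sum>k\<in>I. if i = p \<or> j = p then 0 else b k i * b k j)"
      using insert.hyps(2) by (intro sum.cong) (auto simp: c_def)
    then show ?thesis using that b by auto
  qed
  have pivot: "c p i * c p j = a i p * a j p / a p p" for i j
    using pp by (simp add: c_def)
  have "a i j = (\<Sum>k\<in>insert p I. c k i * c k j)" if ij: "i \<in> insert p I" "j \<in> insert p I" for i j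
  proof -
    have "(\<Sum>k\<in>insert p I. c k i * c k j)
        = a i p * a j p / a p p + (if i = p \<or> j = p then 0 else a' i j)"
      unfolding sum.insert[OF insert.hyps] pivot rest[OF ij] ..
    then show ?thesis
      using pp insert.prems(1)[of p j] by (cases "i = p"; cases "j = p") (simp_all add: a'_def)
  qed
  then show ?case by blast
qed

text \<open>For w = G u with G the inverse of g, the form of G at u is the form of g at w, so G is
  positive definite too. Its factorisation splits the vertical block of the metric into
  squares.\<close>

lemma (in chart_metric) inverse_sum_of_squares:
  assumes x: "x \<in> S"
  shows "\<exists>b :: 'i \<Rightarrow> 'i \<Rightarrow> real. \<forall>i j. matrix_inv (g x) $ i $ j = (\<Sum>k\<in>UNIV. b k i * b k j)"
proof -
  let ?G = "matrix_inv (g x)"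
  have "(\<Sum>i\<in>UNIV. \<Sum>j\<in>UNIV. ?G $ i $ j * u i * u j) > 0" if "\<exists>i. u i \<noteq> 0" for u
  proof -
    let ?u = "\<chi> i. u i" and ?w = "?G *v (\<chi> i. u i)"
    have gw: "g x *v ?w = ?u"
      by (simp add: matrix_vector_mul_assoc inverse_right x)
    have "?u \<noteq> 0" using that by (simp add: vec_eq_iff)
    then have "?w \<noteq> 0" using gw by (metis matrix_vector_mult_0_right)
    from positive[OF x this] have "0 < ?w \<bullet> ?u" by (simp only: gw)
    also have "\<dots> = (\<Sum>i\<in>UNIV. \<Sum>j\<in>UNIV. ?G $ i $ j * u i * u j)"
      by (simp add: inner_vec_def matrix_vector_mult_def sum_distrib_right sum_distrib_left mult_ac)
    finally show ?thesis .
  qed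
  then show ?thesis
    using positive_definite_sum_of_squares[of UNIV "\<lambda>i j. ?G $ i $ j"] inverse_entries_symmetric[OF x] by auto
qed

lemma sum_mult_delta:
  fixes f :: "'i::finite \<Rightarrow> real"
  shows "(\<Sum>j\<in>UNIV. f j * (if j = k then 1 else 0)) = f k"
    and "(\<Sum>j\<in>UNIV. f j * ((if j = k then 1 else 0) * r)) = f k * r"
proof -
  show 1: "(\<Sum>j\<in>UNIV. f j * (if j = k then 1 else 0)) = f k" for f :: "'i \<Rightarrow> real"
    by (simp add: if_distrib[of "(*) _"] cong: if_cong)
  from 1[of "\<lambda>j. f j * r"] show "(\<Sum>j\<in>UNIV. f j * ((if j = k then 1 else 0) * r)) = f k * r"
    by (simp add: mult_ac)
qed

context jet_chart
begin

definition vertical_part :: "('p, 'n) jet \<Rightarrow> ('p, 'n) jet \<Rightarrow> real^'p^'n" where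
  "vertical_part z U = (\<chi> i \<alpha>. coframe h \<phi> X (vI i \<alpha>) z U)"

text \<open>The inner product of matrices absorbs the fourfold sum, so invariance under changes of
  charts can be checked with matrix products.\<close>

lemma sasaki_metric_blocks:
  assumes "t \<in> S" "x \<in> S'"
  shows "sasaki_metric h \<phi> X (t, x, v) U V
    = fst U \<bullet> (h t *v fst V) + fst (snd U) \<bullet> (\<phi> x *v fst (snd V))
      + vertical_part (t, x, v) U \<bullet> (\<phi> x ** vertical_part (t, x, v) V ** matrix_inv (h t))"
proof -
  have co: "coframe h \<phi> X (tI \<alpha>) z U = fst U $ \<alpha>" "coframe h \<phi> X (xI i) z U = fst (snd U) $ i" for \<alpha> i z U
    by (cases U; simp)+
  have "(\<Sum>\<alpha>\<in>UNIV. \<Sum>\<beta>\<in>UNIV. \<Sum>i\<in>UNIV. \<Sum>j\<in>UNIV. matrix_inv (h t) $ \<alpha> $ \<beta> * \<phi> x $ i $ j * A $ i $ \<alpha> * B $ j $ \<beta>)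
      = A \<bullet> (\<phi> x ** B ** matrix_inv (h t))" for A B :: "real^'p^'n"
  proof -
    have "A \<bullet> (\<phi> x ** B ** matrix_inv (h t))
      = (\<Sum>i\<in>UNIV. \<Sum>\<alpha>\<in>UNIV. \<Sum>\<beta>\<in>UNIV. \<Sum>j\<in>UNIV. A $ i $ \<alpha> * (\<phi> x $ i $ j * B $ j $ \<beta>) * matrix_inv (h t) $ \<beta> $ \<alpha>)"
      by (simp add: inner_vec_def matrix_matrix_mult_def sum_distrib_left sum_distrib_right mult_ac)
    also have "\<dots> = (\<Sum>\<alpha>\<in>UNIV. \<Sum>i\<in>UNIV. \<Sum>\<beta>\<in>UNIV. \<Sum>j\<in>UNIV. A $ i $ \<alpha> * (\<phi> x $ i $ j * B $ j $ \<beta>) * matrix_inv (h t) $ \<beta> $ \<alpha>)"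
      by (rule sum.swap)
    also have "\<dots> = (\<Sum>\<alpha>\<in>UNIV. \<Sum>\<beta>\<in>UNIV. \<Sum>i\<in>UNIV. \<Sum>j\<in>UNIV. A $ i $ \<alpha> * (\<phi> x $ i $ j * B $ j $ \<beta>) * matrix_inv (h t) $ \<beta> $ \<alpha>)"
      by (intro sum.cong refl sum.swap)
    also have "\<dots> = (\<Sum>\<alpha>\<in>UNIV. \<Sum>\<beta>\<in>UNIV. \<Sum>i\<in>UNIV. \<Sum>j\<in>UNIV. matrix_inv (h t) $ \<alpha> $ \<beta> * \<phi> x $ i $ j * A $ i $ \<alpha> * B $ j $ \<beta>)"
      by (intro sum.cong refl) (simp add: h.inverse_entries_symmetric[OF assms(1)] mult_ac)
    finally show ?thesis by simp
  qed
  from this[of "vertical_part (t, x, v) U" "vertical_part (t, x, v) V"]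
  show ?thesis
    unfolding sasaki_metric_def Let_def
    by (simp add: vertical_part_def co inner_vec_def matrix_vector_mult_def sum_distrib_left mult_ac del: coframe.simps)
qed

lemma sasaki_component_symmetric:
  assumes "t \<in> S" "x \<in> S'"
  shows "sasaki_component h \<phi> (t, x, v) A B = sasaki_component h \<phi> (t, x, v) B A"
  by (cases A rule: adapted_index_cases; cases B rule: adapted_index_cases)
    (simp_all add: h.entries_symmetric[OF assms(1)] \<phi>.entries_symmetric[OF assms(2)] h.inverse_entries_symmetric[OF assms(1)])

lemma sasaki_metric_symmetric:
  assumes "t \<in> S" "x \<in> S'"
  shows "sasaki_metric h \<phi> X (t, x, v) U V = sasaki_metric h \<phi> X (t, x, v) V U"
  unfolding sasaki_metric_eq
  by (subst sum.swap) (intro sum.cong refl, simp add: sasaki_component_symmetric[OF assms, of v] mult_ac)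

text \<open>With the inverse of \<open>h\<close> written as B B^T, the block is the sum of the
  values of \<phi> on the columns of W B.\<close>

lemma vertical_block_positive:
  assumes tx: "t \<in> S" "x \<in> S'" and "W \<noteq> 0"
  shows "W \<bullet> (\<phi> x ** W ** matrix_inv (h t)) > 0"
proof -
  obtain b :: "'p \<Rightarrow> 'p \<Rightarrow> real" where b: "\<And>\<alpha> \<beta>. matrix_inv (h t) $ \<alpha> $ \<beta> = (\<Sum>k\<in>UNIV. b k \<alpha> * b k \<beta>)"
    using h.inverse_sum_of_squares[OF tx(1)] by blast
  define B :: "real^'p^'p" where "B = (\<chi> \<alpha> k. b k \<alpha>)"
  have G: "matrix_inv (h t) = B ** transpose B"
    by (simp add: vec_eq_iff B_def matrix_matrix_mult_def transpose_def b)
  have "W \<bullet> (\<phi> x ** W ** matrix_inv (h t)) = (W ** B) \<bullet> (\<phi> x ** (W ** B))"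
  proof -
    have "A \<bullet> (C ** transpose B) = (A ** B) \<bullet> C" for A C :: "real^'p^'n"
    proof -
      have "A \<bullet> (C ** transpose B) = (\<Sum>i\<in>UNIV. \<Sum>\<alpha>\<in>UNIV. \<Sum>k\<in>UNIV. A $ i $ \<alpha> * C $ i $ k * B $ \<alpha> $ k)"
        by (simp add: inner_vec_def matrix_matrix_mult_def transpose_def sum_distrib_left mult_ac)
      also have "\<dots> = (\<Sum>i\<in>UNIV. \<Sum>k\<in>UNIV. \<Sum>\<alpha>\<in>UNIV. A $ i $ \<alpha> * C $ i $ k * B $ \<alpha> $ k)"
        by (intro sum.cong refl sum.swap)
      also have "\<dots> = (A ** B) \<bullet> C"
        by (simp add: inner_vec_def matrix_matrix_mult_def sum_distrib_right sum_distrib_left mult_ac)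
      finally show ?thesis .
    qed
    from this[of W "\<phi> x ** W ** B"] show ?thesis by (simp add: G matrix_mul_assoc)
  qed
  also have "\<dots> = (\<Sum>k\<in>UNIV. column k (W ** B) \<bullet> (\<phi> x *v column k (W ** B)))"
  proof -
    have "C \<bullet> (\<phi> x ** C) = (\<Sum>i\<in>UNIV. \<Sum>k\<in>UNIV. C $ i $ k * (\<phi> x *v column k C) $ i)" for C :: "real^'p^'n"
      by (simp add: inner_vec_def matrix_matrix_mult_def matrix_vector_mult_def column_def)
    then show ?thesis
      by (subst (asm) sum.swap) (simp add: inner_vec_def column_def)
  qed
  also have "\<dots> > 0"
  proof -
    have "W ** B \<noteq> 0"
    proof
      assume "W ** B = 0"
      \<comment> \<open>B B^T is the inverse of \<open>h t\<close>, so multiplying by B^T and then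
        by \<open>h t\<close> recovers W.\<close>
      then have "W ** (B ** transpose B) ** h t = 0" by (simp add: matrix_mul_assoc matrix_algebra)
      then have "W = 0" by (simp add: G[symmetric] matrix_mul_assoc[symmetric] h.inverse_left[OF tx(1)])
      with \<open>W \<noteq> 0\<close> show False ..
    qed
    then obtain k where k: "column k (W ** B) \<noteq> 0"
      by (auto simp: vec_eq_iff column_def)
    have "column k (W ** B) \<bullet> (\<phi> x *v column k (W ** B)) \<ge> 0" for k
      using \<phi>.positive[OF tx(2), of "column k (W ** B)"] by (cases "column k (W ** B) = 0") auto
    then show ?thesis
      using \<phi>.positive[OF tx(2) k] by (intro sum_pos2[of UNIV k]) auto
  qed
  finally show ?thesis .
qed

lemma sasaki_metric_positive:
  assumes tx: "t \<in> S" "x \<in> S'" and U: "U \<noteq> 0"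
  shows "sasaki_metric h \<phi> X (t, x, v) U U > 0"
proof -
  obtain a b w where Uabw: "U = (a, b, w)" by (metis surj_pair)
  let ?W = "vertical_part (t, x, v) U"
  have 1: "a \<bullet> (h t *v a) \<ge> 0" "a \<noteq> 0 \<Longrightarrow> a \<bullet> (h t *v a) > 0"
    using h.positive[OF tx(1), of a] by (cases "a = 0"; force)+
  have 2: "b \<bullet> (\<phi> x *v b) \<ge> 0" "b \<noteq> 0 \<Longrightarrow> b \<bullet> (\<phi> x *v b) > 0"
    using \<phi>.positive[OF tx(2), of b] by (cases "b = 0"; force)+
  have 3: "?W \<bullet> (\<phi> x ** ?W ** matrix_inv (h t)) \<ge> 0" "?W \<noteq> 0 \<Longrightarrow> ?W \<bullet> (\<phi> x ** ?W ** matrix_inv (h t)) > 0"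
    using vertical_block_positive[OF tx, of ?W] by (cases "?W = 0"; force)+
  have "a \<noteq> 0 \<or> b \<noteq> 0 \<or> ?W \<noteq> 0"
  proof (rule ccontr)
    assume "\<not> (a \<noteq> 0 \<or> b \<noteq> 0 \<or> ?W \<noteq> 0)"
    then have "a = 0" "b = 0" "?W = 0" by auto
    then have "w = 0" by (simp add: vertical_part_def Uabw vec_eq_iff)
    then show False using U \<open>a = 0\<close> \<open>b = 0\<close> by (simp add: Uabw zero_prod_def)
  qed
  then have "a \<bullet> (h t *v a) + b \<bullet> (\<phi> x *v b) + ?W \<bullet> (\<phi> x ** ?W ** matrix_inv (h t)) > 0"
  proof (elim disjE)
    assume "a \<noteq> 0"
    then show ?thesis using 1(2) 2(1) 3(1) by linarith
  next
    assume "b \<noteq> 0"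
    then show ?thesis using 1(1) 2(2) 3(1) by linarith
  next
    assume "?W \<noteq> 0"
    then show ?thesis using 1(1) 2(1) 3(2) by linarith
  qed
  then show ?thesis
    unfolding sasaki_metric_blocks[OF tx] by (simp add: Uabw)
qed

lemma smooth_sasaki_metric: "smooth_on jets (\<lambda>z. sasaki_metric h \<phi> X z U V)"
proof -
  have "smooth_on jets (\<lambda>z. sasaki_component h \<phi> z A B)" for A B
    by (cases A rule: adapted_index_cases; cases B rule: adapted_index_cases)
      (auto intro!: smooth_jet_intros)
  then show ?thesis
    unfolding sasaki_metric_eq by (intro smooth_jet_intros smooth_coframe)
qed

section \<open>The vertical Hessian of the Lagrangian\<close>

lemma frechet_derivative_vertical:
  fixes f :: "('p, 'n) jet \<Rightarrow> real"
  assumes f: "smooth_on jets f" and indep: "\<And>t x v v'. t \<in> S \<Longrightarrow> x \<in> S' \<Longrightarrow> f (t, x, v) = f (t, x, v')"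
    and tx: "t \<in> S" "x \<in> S'"
  shows "frechet_derivative f (at (t, x, v)) (0, 0, w) = 0"
proof -
  have "(f has_derivative frechet_derivative f (at (t, x, v))) (at ((t, x, v) + 0 *\<^sub>R (0, 0, w)))"
    using smooth_on_has_derivative[OF f open_jets, of "(t, x, v)"] tx by simp
  from DERIV_along_line[OF this]
  have "DERIV (\<lambda>\<sigma>. f ((t, x, v) + \<sigma> *\<^sub>R (0, 0, w))) 0 :> frechet_derivative f (at (t, x, v)) (0, 0, w)" .
  moreover have "(\<lambda>\<sigma>. f ((t, x, v) + \<sigma> *\<^sub>R (0, 0, w))) = (\<lambda>\<sigma>. f (t, x, v))"
    using indep[OF tx] by (auto simp: fun_eq_iff)
  ultimately show ?thesis
    using DERIV_unique DERIV_const by metis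
qed

lemma vertical_metric_eq:
  assumes tx: "t \<in> S" "x \<in> S'"
  shows "vertical_metric h \<phi> X (t, x, v) i0 \<alpha>0 j0 \<beta>0 = matrix_inv (h t) $ \<alpha>0 $ \<beta>0 * \<phi> x $ i0 $ j0"
proof -
  \<comment> \<open>The Lagrangian is the quadratic form with coefficients c in the variables y.
    Vertical derivatives of c vanish, and those of y are Kronecker deltas because \<open>X\<close>
    is constant along the fibres.\<close>
  define c where "c \<alpha> \<beta> i j z = matrix_inv (h (fst z)) $ \<alpha> $ \<beta> * \<phi> (fst (snd z)) $ i $ j" for \<alpha> \<beta> i j and z :: "('p, 'n) jet"
  define y where "y i \<alpha> z = snd (snd z) $ i $ \<alpha> - X z $ i $ \<alpha>" for i \<alpha> and z :: "('p, 'n) jet"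
  let ?D = "\<lambda>f z. frechet_derivative f (at z)"
  have cs: "smooth_on jets (c \<alpha> \<beta> i j)" for \<alpha> \<beta> i j
    unfolding c_def by (intro smooth_jet_intros)
  have ys: "smooth_on jets (y i \<alpha>)" for i \<alpha>
    unfolding y_def by (intro smooth_jet_intros smooth_X)
  have cD: "?D (c \<alpha> \<beta> i j) (t, x, v) (vert k \<gamma>) = 0" if "t \<in> S" "x \<in> S'" for \<alpha> \<beta> i j t x v k \<gamma>
    using frechet_derivative_vertical[OF cs _ that] by (simp add: c_def)
  have yD: "?D (y i \<alpha>) (t, x, v) (vert k \<gamma>) = (if i = k then 1 else 0) * (if \<alpha> = \<gamma> then 1 else 0)"
    if "t \<in> S" "x \<in> S'" for i \<alpha> t x v k \<gamma>
  proof -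
    have Xs: "smooth_on jets (\<lambda>z. X z $ i $ \<alpha>)"
      by (intro smooth_jet_intros smooth_X)
    have lin: "((\<lambda>z::('p, 'n) jet. snd (snd z) $ i $ \<alpha>) has_derivative (\<lambda>V. snd (snd V) $ i $ \<alpha>)) (at (t, x, v))"
      by (intro bounded_linear.has_derivative[OF bounded_linear_vec_nth] has_derivative_snd has_derivative_ident)
    have Xd: "((\<lambda>z. X z $ i $ \<alpha>) has_derivative ?D (\<lambda>z. X z $ i $ \<alpha>) (t, x, v)) (at (t, x, v))"
      using smooth_on_has_derivative[OF Xs open_jets, of "(t, x, v)"] that by simp
    have "?D (\<lambda>z. X z $ i $ \<alpha>) (t, x, v) (vert k \<gamma>) = 0"
    proof (rule frechet_derivative_vertical[OF Xs _ that])
      show "X (t, x, v) $ i $ \<alpha> = X (t, x, v') $ i $ \<alpha>" if "t \<in> S" "x \<in> S'" for t x v v'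
        using X_vertical[OF that, of v v'] by simp
    qed
    then show ?thesis
      unfolding y_def frechet_derivative_eqI[OF has_derivative_diff[OF lin Xd]]
      by (simp add: axis_def)
  qed
  have cd: "(c \<alpha> \<beta> i j has_derivative ?D (c \<alpha> \<beta> i j) z) (at z)" if "z \<in> jets" for \<alpha> \<beta> i j z
    using smooth_on_has_derivative[OF cs open_jets that] .
  have yd: "(y i \<alpha> has_derivative ?D (y i \<alpha>) z) (at z)" if "z \<in> jets" for i \<alpha> z
    using smooth_on_has_derivative[OF ys open_jets that] .
  have L: "lagrangian h \<phi> X = (\<lambda>z. \<Sum>\<alpha>\<in>UNIV. \<Sum>\<beta>\<in>UNIV. \<Sum>i\<in>UNIV. \<Sum>j\<in>UNIV. c \<alpha> \<beta> i j z * y i \<alpha> z * y j \<beta> z)"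
    by (auto simp: lagrangian_def fun_eq_iff c_def y_def)
  have first: "?D (lagrangian h \<phi> X) z (vert j0 \<beta>0) = (\<Sum>\<alpha>\<in>UNIV. \<Sum>i\<in>UNIV. 2 * c \<alpha> \<beta>0 i j0 z * y i \<alpha> z)"
    if z: "z \<in> jets" for z
  proof -
    obtain t x v where ztx: "z = (t, x, v)" "t \<in> S" "x \<in> S'" using z by auto
    have "(lagrangian h \<phi> X has_derivative (\<lambda>V. \<Sum>\<alpha>\<in>UNIV. \<Sum>\<beta>\<in>UNIV. \<Sum>i\<in>UNIV. \<Sum>j\<in>UNIV.
        c \<alpha> \<beta> i j z * y i \<alpha> z * ?D (y j \<beta>) z V
        + (c \<alpha> \<beta> i j z * ?D (y i \<alpha>) z V + ?D (c \<alpha> \<beta> i j) z V * y i \<alpha> z) * y j \<beta> z)) (at z)"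
      unfolding L by (intro has_derivative_sum has_derivative_mult cd yd z)
    from frechet_derivative_eqI[OF this]
    have "?D (lagrangian h \<phi> X) z (vert j0 \<beta>0) = (\<Sum>\<alpha>\<in>UNIV. \<Sum>\<beta>\<in>UNIV. \<Sum>i\<in>UNIV. \<Sum>j\<in>UNIV.
        c \<alpha> \<beta> i j z * y i \<alpha> z * ((if j = j0 then 1 else 0) * (if \<beta> = \<beta>0 then 1 else 0))
        + c \<alpha> \<beta> i j z * ((if i = j0 then 1 else 0) * (if \<alpha> = \<beta>0 then 1 else 0)) * y j \<beta> z)"
      using ztx by (simp add: cD yD)
    also have "\<dots> = (\<Sum>\<alpha>\<in>UNIV. \<Sum>\<beta>\<in>UNIV. \<Sum>i\<in>UNIV. \<Sum>j\<in>UNIV.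
        c \<alpha> \<beta> i j z * y i \<alpha> z * ((if j = j0 then 1 else 0) * (if \<beta> = \<beta>0 then 1 else 0)))
      + (\<Sum>\<alpha>\<in>UNIV. \<Sum>\<beta>\<in>UNIV. \<Sum>i\<in>UNIV. \<Sum>j\<in>UNIV.
        c \<alpha> \<beta> i j z * y j \<beta> z * ((if i = j0 then 1 else 0) * (if \<alpha> = \<beta>0 then 1 else 0)))"
      unfolding sum.distrib[symmetric] by (intro sum.cong refl) (simp only: mult_ac)
    also have "\<dots> = (\<Sum>\<alpha>\<in>UNIV. \<Sum>i\<in>UNIV. c \<alpha> \<beta>0 i j0 z * y i \<alpha> z) + (\<Sum>\<beta>\<in>UNIV. \<Sum>j\<in>UNIV. c \<beta>0 \<beta> j0 j z * y j \<beta> z)"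
      by (simp only: sum_mult_delta sum_distrib_right[symmetric])
    \<comment> \<open>Symmetry of both metrics makes the contributions of the two factors y equal.
      This is the factor 2 that the 1/2 in \<open>vertical_metric\<close> cancels.\<close>
    also have "(\<Sum>\<beta>\<in>UNIV. \<Sum>j\<in>UNIV. c \<beta>0 \<beta> j0 j z * y j \<beta> z) = (\<Sum>\<alpha>\<in>UNIV. \<Sum>i\<in>UNIV. c \<alpha> \<beta>0 i j0 z * y i \<alpha> z)"
      unfolding c_def ztx(1) using h.inverse_entries_symmetric[OF ztx(2), of \<beta>0] \<phi>.entries_symmetric[OF ztx(3), of j0] by simp
    finally show ?thesis by (simp add: sum.distrib[symmetric] mult_ac)
  qed
  have z: "(t, x, v) \<in> jets" using tx by simp
  let ?P = "\<lambda>V. \<Sum>\<alpha>\<in>UNIV. \<Sum>i\<in>UNIV. 2 * c \<alpha> \<beta>0 i j0 (t, x, v) * ?D (y i \<alpha>) (t, x, v) V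
        + 2 * ?D (c \<alpha> \<beta>0 i j0) (t, x, v) V * y i \<alpha> (t, x, v)"
  have "((\<lambda>z. \<Sum>\<alpha>\<in>UNIV. \<Sum>i\<in>UNIV. 2 * c \<alpha> \<beta>0 i j0 z * y i \<alpha> z) has_derivative
      ?P) (at (t, x, v))"
    by (intro has_derivative_sum has_derivative_mult has_derivative_mult_right cd yd z)
  then have "((\<lambda>z. ?D (lagrangian h \<phi> X) z (vert j0 \<beta>0)) has_derivative
      ?P) (at (t, x, v))"
    using open_jets z by (rule has_derivative_transform_within_open) (rule first[symmetric])
  from frechet_derivative_eqI[OF this]
  have "?D (\<lambda>z. ?D (lagrangian h \<phi> X) z (vert j0 \<beta>0)) (t, x, v) (vert i0 \<alpha>0)
      = (\<Sum>\<alpha>\<in>UNIV. \<Sum>i\<in>UNIV. 2 * c \<alpha> \<beta>0 i j0 (t, x, v) * ((if i = i0 then 1 else 0) * (if \<alpha> = \<alpha>0 then 1 else 0)))"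
    by (simp add: cD yD tx)
  also have "\<dots> = 2 * c \<alpha>0 \<beta>0 i0 j0 (t, x, v)"
    by (simp only: sum_mult_delta)
  finally show ?thesis
    by (simp add: vertical_metric_def c_def)
qed

lemma potential_component_eq:
  assumes "t \<in> S" "x \<in> S'"
  shows "potential_component h \<phi> X (t, x, v) A B = sasaki_component h \<phi> (t, x, v) A B"
  by (cases A rule: adapted_index_cases; cases B rule: adapted_index_cases)
    (simp_all add: vertical_metric_eq[OF assms])

end

subsection \<open>Behaviour under changes of charts\<close>

text \<open>The contravariant transformation law of the inverse metric.\<close>

lemma matrix_inv_congruence:
  fixes A B J :: "real^'n::finite^'n"
  assumes A: "A = transpose J ** B ** J" and inv: "invertible J" "invertible A"
  shows "matrix_inv B = J ** matrix_inv A ** transpose J"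
proof (rule matrix_inv_unique)
  let ?P = "B ** (J ** matrix_inv A ** transpose J)"
  have "transpose J ** ?P = A ** matrix_inv A ** transpose J"
    by (simp add: A matrix_mul_assoc)
  then have "transpose J ** ?P = transpose J"
    by (simp add: matrix_inv(1)[OF inv(2)])
  then have "matrix_inv (transpose J) ** transpose J ** ?P = matrix_inv (transpose J) ** transpose J"
    by (simp add: matrix_mul_assoc[symmetric])
  then show "?P = mat 1"
    by (simp add: matrix_inv(2)[OF transpose_invertible[OF inv(1)]])
qed

lemma inner_matrix_mult_left:
  fixes A :: "real^'n::finite^'m::finite" and W :: "real^'k::finite^'n"
  shows "(A ** W) \<bullet> Y = W \<bullet> (transpose A ** Y)"
proof -
  have "(A ** W) \<bullet> Y = (\<Sum>i\<in>UNIV. \<Sum>k\<in>UNIV. \<Sum>j\<in>UNIV. A $ i $ j * W $ j $ k * Y $ i $ k)"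
    by (simp add: inner_vec_def matrix_matrix_mult_def sum_distrib_right)
  also have "\<dots> = (\<Sum>i\<in>UNIV. \<Sum>j\<in>UNIV. \<Sum>k\<in>UNIV. A $ i $ j * W $ j $ k * Y $ i $ k)"
    by (intro sum.cong refl sum.swap)
  also have "\<dots> = (\<Sum>j\<in>UNIV. \<Sum>i\<in>UNIV. \<Sum>k\<in>UNIV. A $ i $ j * W $ j $ k * Y $ i $ k)"
    by (rule sum.swap)
  also have "\<dots> = (\<Sum>j\<in>UNIV. \<Sum>k\<in>UNIV. \<Sum>i\<in>UNIV. A $ i $ j * W $ j $ k * Y $ i $ k)"
    by (intro sum.cong refl sum.swap)
  also have "\<dots> = W \<bullet> (transpose A ** Y)"
    by (simp add: inner_vec_def matrix_matrix_mult_def transpose_def sum_distrib_left mult_ac)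
  finally show ?thesis .
qed

lemma inner_matrix_mult_right:
  fixes W :: "real^'n::finite^'m::finite" and B :: "real^'k::finite^'n"
  shows "(W ** B) \<bullet> Y = W \<bullet> (Y ** transpose B)"
proof -
  have "(W ** B) \<bullet> Y = (\<Sum>i\<in>UNIV. \<Sum>k\<in>UNIV. \<Sum>j\<in>UNIV. W $ i $ j * B $ j $ k * Y $ i $ k)"
    by (simp add: inner_vec_def matrix_matrix_mult_def sum_distrib_right)
  also have "\<dots> = (\<Sum>i\<in>UNIV. \<Sum>j\<in>UNIV. \<Sum>k\<in>UNIV. W $ i $ j * B $ j $ k * Y $ i $ k)"
    by (intro sum.cong refl sum.swap)
  also have "\<dots> = W \<bullet> (Y ** transpose B)"
    by (simp add: inner_vec_def matrix_matrix_mult_def transpose_def sum_distrib_left mult_ac)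
  finally show ?thesis .
qed

lemma vector_matrix_eqI:
  fixes A B :: "real^'k::finite^'n::finite"
  assumes "\<And>c. c v* A = c v* B"
  shows "A = B"
proof -
  have "transpose A *v c = transpose B *v c" for c using assms[of c] by simp
  then have "transpose A = transpose B" using matrix_eq by blast
  then show ?thesis by simp
qed

lemma vector_matrix_mult_assoc:
  fixes A :: "real^'n::finite^'m::finite" and B :: "real^'k::finite^'n"
  shows "c v* (A ** B) = (c v* A) v* B"
  by (metis matrix_transpose_mul matrix_vector_mul_assoc transpose_matrix_vector)

section \<open>The vertical part of a tangent vector in matrix form\<close>

context jet_chart
begin

definition X_cov_matrix :: "('p, 'n) jet \<Rightarrow> real^'n \<Rightarrow> real^'p^'n" where
  "X_cov_matrix z b = frechet_derivative X (at z) (0, b, 0) + christoffel_matrix \<phi> (fst (snd z)) b ** X z"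

text \<open>The adjoint of the covariant derivative of \<open>X\<close> with respect to \<phi>, with
  its index still lowered; the inverse of \<phi> times it is the last term of N contracted with b.
  \<open>X_cov_adjoint\<close> characterises it by duality.\<close>

definition X_cov_adjoint :: "('p, 'n) jet \<Rightarrow> real^'n \<Rightarrow> real^'p^'n" where
  "X_cov_adjoint z b = (\<chi> r \<alpha>. ((\<phi> (fst (snd z)) *v b) v* X_cov_matrix z (axis r 1)) $ \<alpha>)"

lemma X_has_derivative:
  "t \<in> S \<Longrightarrow> x \<in> S' \<Longrightarrow> (X has_derivative frechet_derivative X (at (t, x, v))) (at (t, x, v))"
  using smooth_on_has_derivative[OF smooth_X open_jets] by simp

lemma X_component_derivative:
  assumes "t \<in> S" "x \<in> S'"
  shows "frechet_derivative (\<lambda>z. X z $ i $ \<alpha>) (at (t, x, v)) V = frechet_derivative X (at (t, x, v)) V $ i $ \<alpha>"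
  by (rule frechet_derivative_vec_nth)
    (rule bounded_linear.has_derivative[OF bounded_linear_vec_nth X_has_derivative[OF assms]])

lemma X_derivative_vertical:
  assumes "t \<in> S" "x \<in> S'"
  shows "frechet_derivative X (at (t, x, v)) (0, 0, w) = 0"
proof -
  have "smooth_on jets (\<lambda>z. X z $ i $ \<alpha>)" for i \<alpha>
    by (intro smooth_jet_intros smooth_X)
  moreover have "X (t, x, v) $ i $ \<alpha> = X (t, x, v') $ i $ \<alpha>" if "t \<in> S" "x \<in> S'" for i \<alpha> t x v v'
    using X_vertical[OF that, of v v'] by simp
  ultimately have "frechet_derivative X (at (t, x, v)) (0, 0, w) $ i $ \<alpha> = 0" for i \<alpha>
    using frechet_derivative_vertical[of "\<lambda>z. X z $ i $ \<alpha>" t x v w] X_component_derivative[OF assms] assms by simp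
  then show ?thesis by (simp add: vec_eq_iff)
qed

lemma linear_X_cov_matrix:
  assumes "t \<in> S" "x \<in> S'" shows "linear (X_cov_matrix (t, x, v))"
proof -
  note D = has_derivative_linear[OF X_has_derivative[OF assms, of v]]
  have 1: "linear (\<lambda>b. frechet_derivative X (at (t, x, v)) (0, b, 0))"
    using linear_add[OF D, of "(0, _, 0)" "(0, _, 0)"] linear_cmul[OF D, of _ "(0, _, 0)"]
    by (intro linearI) simp_all
  have 2: "linear (\<lambda>b. christoffel_matrix \<phi> x b ** X (t, x, v))"
    by (auto intro!: linearI simp: linear_add[OF linear_christoffel_matrix] linear_cmul[OF linear_christoffel_matrix]
        matrix_mult.add_left matrix_mult.scaleR_left)
  show ?thesis
    using linear_compose_add[OF 1 2] by (simp add: X_cov_matrix_def[abs_def])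
qed

lemma X_cov_eq:
  assumes "t \<in> S" "x \<in> S'"
  shows "X_cov \<phi> X (t, x, v) i \<alpha> j = X_cov_matrix (t, x, v) (axis j 1) $ i $ \<alpha>"
  by (simp add: X_cov_def X_cov_matrix_def X_component_derivative[OF assms] matrix_matrix_mult_def
      christoffel_matrix_axis mult.commute)

lemma X_cov_matrix_nth:
  assumes "t \<in> S" "x \<in> S'"
  shows "X_cov_matrix (t, x, v) b $ i $ \<alpha> = (\<Sum>j\<in>UNIV. X_cov \<phi> X (t, x, v) i \<alpha> j * b $ j)"
  by (subst linear_axis_expansion[OF linear_X_cov_matrix[OF assms]]) (simp add: X_cov_eq[OF assms] mult.commute)

lemma X_cov_adjoint:
  assumes "t \<in> S" "x \<in> S'"
  shows "c v* X_cov_adjoint (t, x, v) b = (\<phi> x *v b) v* X_cov_matrix (t, x, v) c"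
proof -
  let ?u = "\<phi> x *v b"
  have "(c v* X_cov_adjoint (t, x, v) b) $ \<alpha> = (?u v* X_cov_matrix (t, x, v) c) $ \<alpha>" for \<alpha>
  proof -
    have "(c v* X_cov_adjoint (t, x, v) b) $ \<alpha>
        = (\<Sum>r\<in>UNIV. \<Sum>s\<in>UNIV. X_cov \<phi> X (t, x, v) s \<alpha> r * c $ r * ?u $ s)"
      by (simp add: X_cov_adjoint_def vector_matrix_mult_def X_cov_eq[OF assms] sum_distrib_left sum_distrib_right mult_ac)
    also have "\<dots> = (\<Sum>s\<in>UNIV. \<Sum>r\<in>UNIV. X_cov \<phi> X (t, x, v) s \<alpha> r * c $ r * ?u $ s)"
      by (rule sum.swap)
    also have "\<dots> = (?u v* X_cov_matrix (t, x, v) c) $ \<alpha>"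
      by (simp add: vector_matrix_mult_def X_cov_matrix_nth[OF assms] sum_distrib_left sum_distrib_right mult_ac)
    finally show ?thesis .
  qed
  then show ?thesis by (simp add: vec_eq_iff)
qed

text \<open>Every term becomes a matrix product, so the chart change can be checked term by
  term.\<close>

lemma vertical_part_eq:
  assumes tx: "t \<in> S" "x \<in> S'"
  shows "vertical_part (t, x, v) (a, b, w) = w - v ** christoffel_matrix h t a + christoffel_matrix \<phi> x b ** v
    - (1/2) *\<^sub>R (X_cov_matrix (t, x, v) b - matrix_inv (\<phi> x) ** X_cov_adjoint (t, x, v) b)"
proof -
  have M: "(\<Sum>\<beta>\<in>UNIV. M_conn h (t, x, v) i \<alpha> \<beta> * a $ \<beta>) = - (v ** christoffel_matrix h t a) $ i $ \<alpha>" for i \<alpha>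
  proof -
    have "(\<Sum>\<beta>\<in>UNIV. \<Sum>\<gamma>\<in>UNIV. christoffel h t \<gamma> \<alpha> \<beta> * v $ i $ \<gamma> * a $ \<beta>) = (v ** christoffel_matrix h t a) $ i $ \<alpha>"
      by (subst sum.swap) (simp add: matrix_matrix_mult_def christoffel_matrix_def sum_distrib_left mult_ac)
    then show ?thesis by (simp add: M_conn_def sum_negf sum_distrib_right)
  qed
  have N1: "(\<Sum>j\<in>UNIV. (\<Sum>k\<in>UNIV. christoffel \<phi> x i j k * v $ k $ \<alpha>) * b $ j) = (christoffel_matrix \<phi> x b ** v) $ i $ \<alpha>" for i \<alpha>
    unfolding sum_distrib_right
    by (subst sum.swap)
      (simp add: matrix_matrix_mult_def christoffel_matrix_def sum_distrib_right sum_distrib_left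
        \<phi>.christoffel_symmetric[OF tx(2), of i] mult_ac)
  have N2: "(\<Sum>j\<in>UNIV. (\<Sum>r\<in>UNIV. \<Sum>s\<in>UNIV. matrix_inv (\<phi> x) $ i $ r * X_cov \<phi> X (t, x, v) s \<alpha> r * \<phi> x $ s $ j) * b $ j)
      = (matrix_inv (\<phi> x) ** X_cov_adjoint (t, x, v) b) $ i $ \<alpha>" for i \<alpha>
  proof -
    have "(\<Sum>j\<in>UNIV. (\<Sum>r\<in>UNIV. \<Sum>s\<in>UNIV. matrix_inv (\<phi> x) $ i $ r * X_cov \<phi> X (t, x, v) s \<alpha> r * \<phi> x $ s $ j) * b $ j)
        = (\<Sum>r\<in>UNIV. \<Sum>j\<in>UNIV. \<Sum>s\<in>UNIV. matrix_inv (\<phi> x) $ i $ r * X_cov \<phi> X (t, x, v) s \<alpha> r * \<phi> x $ s $ j * b $ j)"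
      unfolding sum_distrib_right by (rule sum.swap)
    also have "\<dots> = (\<Sum>r\<in>UNIV. \<Sum>s\<in>UNIV. \<Sum>j\<in>UNIV. matrix_inv (\<phi> x) $ i $ r * X_cov \<phi> X (t, x, v) s \<alpha> r * \<phi> x $ s $ j * b $ j)"
      by (intro sum.cong refl sum.swap)
    also have "\<dots> = (matrix_inv (\<phi> x) ** X_cov_adjoint (t, x, v) b) $ i $ \<alpha>"
      by (simp add: matrix_matrix_mult_def X_cov_adjoint_def vector_matrix_mult_def matrix_vector_mult_def
          X_cov_eq[OF tx] sum_distrib_left sum_distrib_right mult_ac)
    finally show ?thesis .
  qed
  have N: "(\<Sum>j\<in>UNIV. N_conn \<phi> X (t, x, v) i \<alpha> j * b $ j)
      = (christoffel_matrix \<phi> x b ** v) $ i $ \<alpha>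
        - (1/2) * (X_cov_matrix (t, x, v) b $ i $ \<alpha> - (matrix_inv (\<phi> x) ** X_cov_adjoint (t, x, v) b) $ i $ \<alpha>)" for i \<alpha>
    unfolding N1[symmetric] N2[symmetric] X_cov_matrix_nth[OF tx]
    by (simp only: N_conn_def case_prod_conv left_diff_distrib sum_subtractf mult.assoc sum_distrib_left[symmetric] right_diff_distrib)
  show ?thesis
    by (simp add: vec_eq_iff vertical_part_def M N)
qed

end

text \<open>Two overlapping pairs of charts with the atlas stripped away: F and G play the
  transition maps. An inverse matrix replaces the Jacobian of the reverse transition, so that
  everything is evaluated at the old point.\<close>

locale jet_change = old: jet_chart h S \<phi> S' X + new: jet_chart h2 S2 \<phi>2 S2' X2
  for h :: "real^'p::finite \<Rightarrow> real^'p^'p" and S and \<phi> :: "real^'n::finite \<Rightarrow> real^'n^'n" and S' and X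
    and h2 :: "real^'p::finite \<Rightarrow> real^'p^'p" and S2 and \<phi>2 :: "real^'n::finite \<Rightarrow> real^'n^'n" and S2' and X2 +
  fixes F :: "real^'p \<Rightarrow> real^'p" and U and G :: "real^'n \<Rightarrow> real^'n" and W
  assumes U: "open U" "U \<subseteq> S" and F: "smooth_on U F" "\<And>t. t \<in> U \<Longrightarrow> F t \<in> S2"
    and F_inv: "\<And>t. t \<in> U \<Longrightarrow> invertible (jacobian F (at t))"
    and h_pull: "\<And>t. t \<in> U \<Longrightarrow> h t = transpose (jacobian F (at t)) ** h2 (F t) ** jacobian F (at t)"
    and W: "open W" "W \<subseteq> S'" and G: "smooth_on W G" "\<And>x. x \<in> W \<Longrightarrow> G x \<in> S2'"
    and G_inv: "\<And>x. x \<in> W \<Longrightarrow> invertible (jacobian G (at x))"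
    and \<phi>_pull: "\<And>x. x \<in> W \<Longrightarrow> \<phi> x = transpose (jacobian G (at x)) ** \<phi>2 (G x) ** jacobian G (at x)"
    and X_change: "\<And>t x v. t \<in> U \<Longrightarrow> x \<in> W \<Longrightarrow>
      X2 (F t, G x, jacobian G (at x) ** v ** matrix_inv (jacobian F (at t)))
        = jacobian G (at x) ** X (t, x, v) ** matrix_inv (jacobian F (at t))"
begin

definition jet_map :: "('p, 'n) jet \<Rightarrow> ('p, 'n) jet" where
  "jet_map z = (F (fst z), G (fst (snd z)),
     jacobian G (at (fst (snd z))) ** snd (snd z) ** matrix_inv (jacobian F (at (fst z))))"

text \<open>The term with K on both sides is the derivative of the inverse Jacobian K.\<close>

definition jet_map_derivative :: "('p, 'n) jet \<Rightarrow> ('p, 'n) jet \<Rightarrow> ('p, 'n) jet" where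
  "jet_map_derivative z V = (let t = fst z; x = fst (snd z); K = matrix_inv (jacobian F (at t)) in
    (jacobian F (at t) *v fst V, jacobian G (at x) *v fst (snd V),
     jacobian G (at x) ** snd (snd z) ** - (K ** frechet_derivative (\<lambda>t. jacobian F (at t)) (at t) (fst V) ** K)
     + (jacobian G (at x) ** snd (snd V)
        + frechet_derivative (\<lambda>x. jacobian G (at x)) (at x) (fst (snd V)) ** snd (snd z)) ** K))"

context
  fixes t x and v :: "real^'p^'n"
  assumes tU: "t \<in> U" and xW: "x \<in> W"
begin

abbreviation "J \<equiv> jacobian F (at t)"
abbreviation "K \<equiv> matrix_inv J"
abbreviation "L \<equiv> jacobian G (at x)"
abbreviation "J' \<equiv> frechet_derivative (\<lambda>t. jacobian F (at t)) (at t)"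
abbreviation "L' \<equiv> frechet_derivative (\<lambda>x. jacobian G (at x)) (at x)"

lemma dom: "t \<in> S" "x \<in> S'" "F t \<in> S2" "G x \<in> S2'"
  using tU xW U W F G by auto

lemma K_J: "J ** K = mat 1" "K ** J = mat 1"
  using matrix_inv[OF F_inv[OF tU]] .

lemma L_has_derivative: "((\<lambda>z. jacobian G (at (fst (snd z)))) has_derivative (\<lambda>V. L' (fst (snd V)))) (at (t, x, v))"
  using smooth_on_has_derivative[OF smooth_on_jacobian[OF W(1) G(1)] W(1) xW]
  by (intro has_derivative_compose[where f = "\<lambda>z. fst (snd z)" and g = "\<lambda>x. jacobian G (at x)"]
      has_derivative_fst has_derivative_snd has_derivative_ident) simp

lemma K_has_derivative:
  "((\<lambda>z. matrix_inv (jacobian F (at (fst z)))) has_derivative (\<lambda>V. - (K ** J' (fst V) ** K))) (at (t, x, v))"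
  using matrix_inv_has_derivative[OF U(1) tU smooth_on_jacobian[OF U(1) F(1)] F_inv]
  by (intro has_derivative_compose[where f = fst and g = "\<lambda>t. matrix_inv (jacobian F (at t))"]
      has_derivative_fst has_derivative_ident) simp

lemma jet_map_has_derivative: "(jet_map has_derivative jet_map_derivative (t, x, v)) (at (t, x, v))"
proof -
  have 1: "((\<lambda>z. F (fst z)) has_derivative (\<lambda>V. J *v fst V)) (at (t, x, v))"
    using smooth_on_has_derivative_jacobian[OF U(1) F(1) tU]
    by (intro has_derivative_compose[where f = fst and g = F] has_derivative_fst has_derivative_ident) simp
  have 2: "((\<lambda>z. G (fst (snd z))) has_derivative (\<lambda>V. L *v fst (snd V))) (at (t, x, v))"
    using smooth_on_has_derivative_jacobian[OF W(1) G(1) xW]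
    by (intro has_derivative_compose[where f = "\<lambda>z. fst (snd z)" and g = G]
        has_derivative_fst has_derivative_snd has_derivative_ident) simp
  have 3: "((\<lambda>z. snd (snd z)) has_derivative (\<lambda>V. snd (snd V))) (at (t, x, v))"
    by (intro has_derivative_snd has_derivative_ident)
  have "(jet_map has_derivative (\<lambda>V. (J *v fst V, L *v fst (snd V),
      L ** snd (snd (t, x, v)) ** - (K ** J' (fst V) ** K)
      + (L ** snd (snd V) + L' (fst (snd V)) ** snd (snd (t, x, v))) ** K))) (at (t, x, v))"
    unfolding jet_map_def
    using has_derivative_Pair[OF 1 has_derivative_Pair[OF 2
          matrix_mult.FDERIV[OF matrix_mult.FDERIV[OF L_has_derivative 3] K_has_derivative]]] by simp
  then show ?thesis
    by (simp add: jet_map_derivative_def[abs_def] Let_def)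
qed

lemma christoffel_t: "christoffel_matrix h2 (F t) (J *v a) ** J = J ** christoffel_matrix h t a - J' a"
  using christoffel_matrix_transform[OF old.h.chart_metric_axioms new.h.chart_metric_axioms U tU F F_inv[OF tU] h_pull]
  by simp

lemma christoffel_x: "christoffel_matrix \<phi>2 (G x) (L *v b) ** L = L ** christoffel_matrix \<phi> x b - L' b"
  using christoffel_matrix_transform[OF old.\<phi>.chart_metric_axioms new.\<phi>.chart_metric_axioms W xW G G_inv[OF xW] \<phi>_pull]
  by simp

lemma X_change_map: "X2 (jet_map (t, x, v)) = L ** X (t, x, v) ** K"
  by (simp add: jet_map_def X_change tU xW)

text \<open>Differentiate the transformation law of \<open>X\<close> along a vector with zero t
  component; only the Hessian of G contributes an inhomogeneous term.\<close>

lemma X_derivative_change: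
  "frechet_derivative X2 (at (jet_map (t, x, v))) (0, L *v b, 0)
    = (L ** frechet_derivative X (at (t, x, v)) (0, b, 0) + L' b ** X (t, x, v)) ** K"
proof -
  let ?D2 = "frechet_derivative X2 (at (jet_map (t, x, v)))"
  have D2: "(X2 has_derivative ?D2) (at (jet_map (t, x, v)))"
    using new.X_has_derivative[OF dom(3,4)] by (simp add: jet_map_def)
  have "((\<lambda>z. jacobian G (at (fst (snd z))) ** X z ** matrix_inv (jacobian F (at (fst z)))) has_derivative
      (\<lambda>V. L ** X (t, x, v) ** - (K ** J' (fst V) ** K)
        + (L ** frechet_derivative X (at (t, x, v)) V + L' (fst (snd V)) ** X (t, x, v)) ** K)) (at (t, x, v))"
    using matrix_mult.FDERIV[OF matrix_mult.FDERIV[OF L_has_derivative old.X_has_derivative[OF dom(1,2)]] K_has_derivative]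
    by simp
  moreover have "open (U \<times> W \<times> (UNIV :: (real^'p^'n) set))"
    by (intro open_Times U(1) W(1) open_UNIV)
  moreover have "(t, x, v) \<in> U \<times> W \<times> UNIV" using tU xW by simp
  moreover have "jacobian G (at (fst (snd z))) ** X z ** matrix_inv (jacobian F (at (fst z))) = X2 (jet_map z)"
    if "z \<in> U \<times> W \<times> UNIV" for z
    using that by (auto simp: jet_map_def X_change)
  ultimately have "((\<lambda>z. X2 (jet_map z)) has_derivative
      (\<lambda>V. L ** X (t, x, v) ** - (K ** J' (fst V) ** K)
        + (L ** frechet_derivative X (at (t, x, v)) V + L' (fst (snd V)) ** X (t, x, v)) ** K)) (at (t, x, v))"
    by (rule has_derivative_transform_within_open)
  from has_derivative_unique[OF has_derivative_compose[OF jet_map_has_derivative D2] this]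
  have eq: "?D2 (jet_map_derivative (t, x, v) V) = L ** X (t, x, v) ** - (K ** J' (fst V) ** K)
        + (L ** frechet_derivative X (at (t, x, v)) V + L' (fst (snd V)) ** X (t, x, v)) ** K" for V
    by metis
  have J'0: "J' 0 = 0"
    using smooth_on_has_derivative[OF smooth_on_jacobian[OF U(1) F(1)] U(1) tU]
    by (intro linear_0 has_derivative_linear)
  \<comment> \<open>The image of a vector along M acquires a vertical component w, which the
    derivative of \<open>X2\<close> does not see.\<close>
  obtain w where w: "jet_map_derivative (t, x, v) (0, b, 0) = (0, L *v b, w)"
    by (simp add: jet_map_derivative_def Let_def)
  have "?D2 (0, L *v b, w) = ?D2 (0, L *v b, 0) + ?D2 (0, 0, w)"
    using linear_add[OF has_derivative_linear[OF D2], of "(0, L *v b, 0)" "(0, 0, w)"] by simp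
  also have "?D2 (0, 0, w) = 0"
    using new.X_derivative_vertical[OF dom(3,4)] by (simp add: jet_map_def)
  finally show ?thesis
    using eq[of "(0, b, 0)"] by (simp add: w J'0 matrix_algebra)
qed

text \<open>The Hessian of G from the derivative of \<open>X\<close> cancels the one from the
  Christoffel symbols, so the covariant derivative is tensorial.\<close>

lemma X_cov_matrix_change: "new.X_cov_matrix (jet_map (t, x, v)) (L *v b) = L ** old.X_cov_matrix (t, x, v) b ** K"
proof -
  have "new.X_cov_matrix (jet_map (t, x, v)) (L *v b)
      = (L ** frechet_derivative X (at (t, x, v)) (0, b, 0) + L' b ** X (t, x, v)) ** K
        + (christoffel_matrix \<phi>2 (G x) (L *v b) ** L) ** X (t, x, v) ** K"
    unfolding new.X_cov_matrix_def X_derivative_change X_change_map by (simp add: jet_map_def matrix_mul_assoc)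
  then show ?thesis
    unfolding christoffel_x by (simp add: old.X_cov_matrix_def matrix_algebra)
qed

text \<open>Both sides are compared by pairing with an arbitrary c, which moves the claim to the
  known law for the covariant derivative.\<close>

lemma X_cov_adjoint_change:
  "transpose L ** new.X_cov_adjoint (jet_map (t, x, v)) (L *v b) = old.X_cov_adjoint (t, x, v) b ** K"
proof (rule vector_matrix_eqI)
  fix c
  have jm: "jet_map (t, x, v) = (F t, G x, snd (snd (jet_map (t, x, v))))"
    by (simp add: jet_map_def)
  have "c v* (transpose L ** new.X_cov_adjoint (jet_map (t, x, v)) (L *v b))
      = (L *v c) v* new.X_cov_adjoint (jet_map (t, x, v)) (L *v b)"
    by (simp add: vector_matrix_mult_assoc)
  also have "\<dots> = (\<phi>2 (G x) *v (L *v b)) v* new.X_cov_matrix (jet_map (t, x, v)) (L *v c)"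
    by (subst (1 2) jm) (rule new.X_cov_adjoint[OF dom(3,4)])
  also have "\<dots> = (((\<phi>2 (G x) *v (L *v b)) v* L) v* old.X_cov_matrix (t, x, v) c) v* K"
    by (simp add: X_cov_matrix_change vector_matrix_mult_assoc)
  also have "(\<phi>2 (G x) *v (L *v b)) v* L = \<phi> x *v b"
    unfolding \<phi>_pull[OF xW] by (simp add: matrix_vector_mul_assoc[symmetric])
  also have "((\<phi> x *v b) v* old.X_cov_matrix (t, x, v) c) v* K = c v* (old.X_cov_adjoint (t, x, v) b ** K)"
    by (simp add: vector_matrix_mult_assoc old.X_cov_adjoint[OF dom(1,2)])
  finally show "c v* (transpose L ** new.X_cov_adjoint (jet_map (t, x, v)) (L *v b)) = c v* (old.X_cov_adjoint (t, x, v) b ** K)" .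
qed

lemma \<phi>_inverse_change: "matrix_inv (\<phi>2 (G x)) = L ** matrix_inv (\<phi> x) ** transpose L"
  by (rule matrix_inv_congruence[OF \<phi>_pull[OF xW] G_inv[OF xW] old.\<phi>.invertible[OF dom(2)]])

lemma h_inverse_change: "matrix_inv (h2 (F t)) = J ** matrix_inv (h t) ** transpose J"
  by (rule matrix_inv_congruence[OF h_pull[OF tU] F_inv[OF tU] old.h.invertible[OF dom(1)]])

text \<open>The second derivatives of F and G in the derivative of \<open>jet_map\<close> cancel
  against those in the transformation of the Christoffel terms.\<close>

lemma vertical_part_change:
  "new.vertical_part (jet_map (t, x, v)) (jet_map_derivative (t, x, v) V) = L ** old.vertical_part (t, x, v) V ** K"
proof -
  obtain a b w where V: "V = (a, b, w)" by (metis surj_pair)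
  let ?v = "L ** v ** K"
  have jm: "jet_map (t, x, v) = (F t, G x, ?v)"
    by (simp add: jet_map_def)
  have jd: "jet_map_derivative (t, x, v) (a, b, w) = (J *v a, L *v b, ?v ** - (J' a ** K) + (L ** w + L' b ** v) ** K)"
    by (simp add: jet_map_derivative_def Let_def matrix_algebra)
  \<comment> \<open>Insert J K = 1 on the right to reach the form in which
    \<open>christoffel_t\<close> applies.\<close>
  have t1: "A ** K ** christoffel_matrix h2 (F t) (J *v a) = A ** christoffel_matrix h t a ** K - A ** K ** J' a ** K"
    for A :: "real^'p^'n"
  proof -
    have "A ** K ** christoffel_matrix h2 (F t) (J *v a) = A ** K ** (christoffel_matrix h2 (F t) (J *v a) ** J) ** K"
      by (simp add: matrix_mul_assoc[symmetric] K_J)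
    also have "\<dots> = A ** (K ** J) ** christoffel_matrix h t a ** K - A ** K ** J' a ** K"
      unfolding christoffel_t by (simp add: matrix_algebra)
    finally show ?thesis by (simp add: K_J)
  qed
  have x1: "christoffel_matrix \<phi>2 (G x) (L *v b) ** ?v = L ** christoffel_matrix \<phi> x b ** v ** K - L' b ** v ** K"
    unfolding matrix_mul_assoc christoffel_x by (simp add: matrix_algebra)
  have adj: "matrix_inv (\<phi>2 (G x)) ** new.X_cov_adjoint (F t, G x, ?v) (L *v b)
      = L ** (matrix_inv (\<phi> x) ** old.X_cov_adjoint (t, x, v) b) ** K"
    using X_cov_adjoint_change[of b] unfolding \<phi>_inverse_change jm by (simp add: matrix_mul_assoc[symmetric])
  have cov: "new.X_cov_matrix (F t, G x, ?v) (L *v b) = L ** old.X_cov_matrix (t, x, v) b ** K"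
    using X_cov_matrix_change[of b] unfolding jm .
  show ?thesis
    unfolding V jm jd old.vertical_part_eq[OF dom(1,2)] new.vertical_part_eq[OF dom(3,4)] adj cov t1 x1
    by (simp add: matrix_algebra matrix_mult.scaleR_left matrix_mult.scaleR_right algebra_simps)
qed

text \<open>Each block is invariant by itself. In the vertical one the factors K meet the factors J
  in the new inverse of \<open>h\<close>, and the factors L are absorbed by the pullback of
  \<open>\<phi>2\<close>.\<close>

lemma sasaki_metric_change:
  "sasaki_metric h2 \<phi>2 X2 (jet_map (t, x, v)) (jet_map_derivative (t, x, v) V) (jet_map_derivative (t, x, v) V')
    = sasaki_metric h \<phi> X (t, x, v) V V'"
proof -
  have jm: "jet_map (t, x, v) = (F t, G x, L ** v ** K)"
    by (simp add: jet_map_def)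
  have ht: "(J *v a) \<bullet> (h2 (F t) *v (J *v a')) = a \<bullet> (h t *v a')" for a a'
    unfolding h_pull[OF tU] by (metis inner_matrix_transpose matrix_vector_mul_assoc)
  have \<phi>x: "(L *v b) \<bullet> (\<phi>2 (G x) *v (L *v b')) = b \<bullet> (\<phi> x *v b')" for b b'
    unfolding \<phi>_pull[OF xW] by (metis inner_matrix_transpose matrix_vector_mul_assoc)
  have KJt: "transpose J ** transpose K = mat 1"
    using K_J(2) by (metis matrix_transpose_mul transpose_mat)
  have vv: "(L ** A ** K) \<bullet> (\<phi>2 (G x) ** (L ** B ** K) ** matrix_inv (h2 (F t)))
      = A \<bullet> (\<phi> x ** B ** matrix_inv (h t))" for A B :: "real^'p^'n"
  proof -
    have "(L ** A ** K) \<bullet> (\<phi>2 (G x) ** (L ** B ** K) ** matrix_inv (h2 (F t)))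
        = A \<bullet> (transpose L ** (\<phi>2 (G x) ** (L ** B ** K) ** (J ** matrix_inv (h t) ** transpose J) ** transpose K))"
      by (simp only: inner_matrix_mult_right[of "L ** A" K] inner_matrix_mult_left[of L A] h_inverse_change matrix_mul_assoc)
    also have "transpose L ** (\<phi>2 (G x) ** (L ** B ** K) ** (J ** matrix_inv (h t) ** transpose J) ** transpose K)
        = (transpose L ** \<phi>2 (G x) ** L) ** B ** (K ** J) ** matrix_inv (h t) ** (transpose J ** transpose K)"
      by (simp add: matrix_mul_assoc)
    finally show ?thesis by (simp add: K_J KJt \<phi>_pull[OF xW])
  qed
  show ?thesis
    using vertical_part_change[of V] vertical_part_change[of V']
    unfolding jm new.sasaki_metric_blocks[OF dom(3,4)] old.sasaki_metric_blocks[OF dom(1,2)]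
    by (simp add: vv) (simp add: jet_map_derivative_def Let_def ht \<phi>x)
qed

end

end

subsection \<open>From manifolds to charts\<close>

lemma manifold_chart:
  assumes "connected_smooth_manifold \<A>" "c \<in> \<A>"
  shows "open (fst c)" "open (chart_image c)"
    "homeomorphism (fst c) (chart_image c) (snd c) (inv_into (fst c) (snd c))"
  using assms unfolding connected_smooth_manifold_def by blast+

lemma overlap_subset: "overlap c c' \<subseteq> chart_image c"
  by (auto simp: overlap_def)

lemma open_overlap:
  assumes "connected_smooth_manifold \<A>" "c \<in> \<A>" "c' \<in> \<A>"
  shows "open (overlap c c')"
proof -
  have "openin (top_of_set (chart_image c)) (overlap c c')"
    unfolding overlap_def using manifold_chart(1)[OF assms(1,3)]
    by (intro homeomorphism_imp_open_map[OF manifold_chart(3)[OF assms(1,2)]] openin_open_Int)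
  then show ?thesis
    using manifold_chart(2)[OF assms(1,2)] by (simp add: openin_open_eq)
qed

lemma transition_overlap:
  assumes "connected_smooth_manifold \<A>" "c \<in> \<A>" "c' \<in> \<A>" "t \<in> overlap c c'"
  shows "transition c c' t \<in> overlap c' c" "transition c' c (transition c c' t) = t"
proof -
  obtain p where p: "t = snd c p" "p \<in> fst c" "p \<in> fst c'"
    using assms(4) by (auto simp: overlap_def)
  have "inv_into (fst c) (snd c) (snd c p) = p" "inv_into (fst c') (snd c') (snd c' p) = p"
    using homeomorphism_apply1[OF manifold_chart(3)[OF assms(1,2)] p(2)]
      homeomorphism_apply1[OF manifold_chart(3)[OF assms(1,3)] p(3)] .
  then show "transition c c' t \<in> overlap c' c" "transition c' c (transition c c' t) = t"
    using p by (auto simp: overlap_def transition_def)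
qed

lemma smooth_transition:
  "connected_smooth_manifold \<A> \<Longrightarrow> c \<in> \<A> \<Longrightarrow> c' \<in> \<A> \<Longrightarrow> smooth_on (overlap c c') (transition c c')"
  unfolding connected_smooth_manifold_def by blast

text \<open>The chain rule for the two transitions. It turns the Jacobian of the reverse transition
  in \<open>vertical_change\<close> into an inverse matrix.\<close>

lemma jacobian_transition_inverse:
  assumes "connected_smooth_manifold \<A>" "c \<in> \<A>" "c' \<in> \<A>" "t \<in> overlap c c'"
  shows "jacobian (transition c c') (at t) ** jacobian (transition c' c) (at (transition c c' t)) = mat 1"
proof -
  let ?J = "jacobian (transition c c') (at t)" and ?K = "jacobian (transition c' c) (at (transition c c' t))"
  note F = smooth_on_has_derivative_jacobian[OF open_overlap smooth_transition]
  note D = has_derivative_compose[OF F[OF assms(1-3,1-3,4)] F[OF assms(1,3,2,1,3,2) transition_overlap(1)[OF assms]]]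
  have "((\<lambda>t. t) has_derivative (\<lambda>a. ?K *v (?J *v a))) (at t)"
    using D open_overlap[OF assms(1-3)] assms(4)
    by (rule has_derivative_transform_within_open) (rule transition_overlap(2)[OF assms(1-3)])
  then have "?K *v (?J *v a) = a" for a
    using has_derivative_unique[OF _ has_derivative_ident] by metis
  then have "?K ** ?J = mat 1"
    by (simp add: matrix_eq matrix_vector_mul_assoc[symmetric])
  then show ?thesis using matrix_left_right_inverse by blast
qed

lemma chart_metric_riemannian:
  assumes "connected_smooth_manifold \<A>" "riemannian_metric \<A> g" "c \<in> \<A>"
  shows "chart_metric (g c) (chart_image c)"
  using assms manifold_chart(2)[OF assms(1,3)] unfolding riemannian_metric_def chart_metric_def by blast

text \<open>The nine blocks are listed in the order of the component equations, so that after
  rewriting the two sides of the equivalence coincide.\<close>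

lemma adapted_index_pairs:
  "(\<forall>A B. P A B) \<longleftrightarrow>
    (\<forall>\<alpha> \<beta>. P (tI \<alpha>) (tI \<beta>)) \<and> (\<forall>i j. P (xI i) (xI j)) \<and> (\<forall>\<alpha> \<beta> i j. P (vI i \<alpha>) (vI j \<beta>)) \<and>
    (\<forall>\<alpha> i. P (tI \<alpha>) (xI i)) \<and> (\<forall>\<alpha> i. P (xI i) (tI \<alpha>)) \<and> (\<forall>\<alpha> \<beta> i. P (vI i \<alpha>) (tI \<beta>)) \<and>
    (\<forall>\<alpha> \<beta> i. P (tI \<alpha>) (vI i \<beta>)) \<and> (\<forall>\<alpha> i j. P (xI i) (vI j \<alpha>)) \<and> (\<forall>\<alpha> i j. P (vI i \<alpha>) (xI j))"
  (is "?L \<longleftrightarrow> ?R")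
proof
  assume R: ?R
  show ?L
  proof (intro allI)
    show "P A B" for A B
      using R by (cases A rule: adapted_index_cases; cases B rule: adapted_index_cases) simp_all
  qed
qed simp

context jet_chart
begin

lemma conservation_laws:
  assumes T: "\<forall>z\<in>jets. bilinear (T z)" and K: "K \<noteq> 0"
    and E: "einstein_equations h \<phi> X (sasaki_metric h \<phi> X) K T jets" and z: "z \<in> jets"
  defines "Tc \<equiv> adapted_component h \<phi> X T"
  shows "(\<Sum>\<mu>\<in>UNIV. t_cov h (t_raised h Tc) z \<mu> \<beta> \<mu>) = 0" "(\<Sum>m\<in>UNIV. x_cov \<phi> (x_raised \<phi> Tc) z m j m) = 0"
proof -
  \<comment> \<open>Dividing the Einstein equations by K gives the stress-energy components with c =
    1/K in the divergence lemmas.\<close>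
  have solve: "T = 1 / K * R" if "R = K * T" for R T
    using that K by simp
  have E': "ricci_component (t, x, v) A B
      - (scalar_curvature h t + scalar_curvature \<phi> x) / 2 * sasaki_component h \<phi> (t, x, v) A B = K * Tc (t, x, v) A B"
    if "t \<in> S" "x \<in> S'" for t x v A B
    using E that unfolding einstein_equations_on_frame[OF T] Tc_def by simp
  obtain t x v where ztx: "z = (t, x, v)" "t \<in> S" "x \<in> S'"
    using z by auto
  show "(\<Sum>\<mu>\<in>UNIV. t_cov h (t_raised h Tc) z \<mu> \<beta> \<mu>) = 0"
    unfolding ztx(1) by (rule t_divergence_einstein[OF ztx(2,3)]) (rule solve[OF E'[of _ _ _ "tI _" "tI _", unfolded ricci_component.simps sasaki_component.simps fst_conv snd_conv]])
  show "(\<Sum>m\<in>UNIV. x_cov \<phi> (x_raised \<phi> Tc) z m j m) = 0"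
    unfolding ztx(1) by (rule x_divergence_einstein[OF ztx(2,3)]) (rule solve[OF E'[of _ _ _ "xI _" "xI _", unfolded ricci_component.simps sasaki_component.simps fst_conv snd_conv]])
qed

end

locale pde_space =
  fixes \<A> :: "('a::{t2_space,second_countable_topology}, 'p::finite) chart set"
    and \<B> :: "('b::{t2_space,second_countable_topology}, 'n::finite) chart set"
    and h :: "('a, 'p) chart \<Rightarrow> real^'p \<Rightarrow> real^'p^'p"
    and \<phi> :: "('b, 'n) chart \<Rightarrow> real^'n \<Rightarrow> real^'n^'n"
    and X :: "('a, 'p) chart \<Rightarrow> ('b, 'n) chart \<Rightarrow> ('p, 'n) jet \<Rightarrow> real^'p^'n"
  assumes T: "connected_smooth_manifold \<A>" "riemannian_metric \<A> h"
    and M: "connected_smooth_manifold \<B>" "riemannian_metric \<B> \<phi>"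
    and X: "vertical_dtensor \<A> \<B> X"
    and X_indep: "\<And>c d t x v v'. c \<in> \<A> \<Longrightarrow> d \<in> \<B> \<Longrightarrow> t \<in> chart_image c \<Longrightarrow> x \<in> chart_image d
                    \<Longrightarrow> X c d (t, x, v) = X c d (t, x, v')"
begin

lemma jet_chart: "c \<in> \<A> \<Longrightarrow> d \<in> \<B> \<Longrightarrow> jet_chart (h c) (chart_image c) (\<phi> d) (chart_image d) (X c d)"
  using chart_metric_riemannian[OF T] chart_metric_riemannian[OF M] X X_indep
  by (auto simp: jet_chart_def jet_chart_axioms_def vertical_dtensor_def jet_dom_def)

context
  fixes c c' :: "('a, 'p) chart" and d d' :: "('b, 'n) chart"
  assumes cd: "c \<in> \<A>" "c' \<in> \<A>" "d \<in> \<B>" "d' \<in> \<B>"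
begin

lemma vertical_change_eq:
  assumes "t \<in> overlap c c'" "x \<in> overlap d d'"
  shows "vertical_change c d c' d' t x w
    = jacobian (transition d d') (at x) ** w ** matrix_inv (jacobian (transition c c') (at t))"
  using matrix_inv_unique[OF jacobian_transition_inverse[OF T(1) cd(1,2) assms(1)]]
  by (simp add: vertical_change_def)

lemma jet_change:
  "jet_change (h c) (chart_image c) (\<phi> d) (chart_image d) (X c d)
    (h c') (chart_image c') (\<phi> d') (chart_image d') (X c' d')
    (transition c c') (overlap c c') (transition d d') (overlap d d')"
proof (intro jet_change.intro jet_change_axioms.intro jet_chart cd open_overlap[OF T(1)] open_overlap[OF M(1)]
    overlap_subset smooth_transition[OF T(1)] smooth_transition[OF M(1)])
  show "transition c c' t \<in> chart_image c'" if "t \<in> overlap c c'" for t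
    using transition_overlap(1)[OF T(1) cd(1,2) that] overlap_subset by blast
  show "transition d d' x \<in> chart_image d'" if "x \<in> overlap d d'" for x
    using transition_overlap(1)[OF M(1) cd(3,4) that] overlap_subset by blast
  show "invertible (jacobian (transition c c') (at t))" if "t \<in> overlap c c'" for t
    using jacobian_transition_inverse[OF T(1) cd(1,2) that] invertible_right_inverse by blast
  show "invertible (jacobian (transition d d') (at x))" if "x \<in> overlap d d'" for x
    using jacobian_transition_inverse[OF M(1) cd(3,4) that] invertible_right_inverse by blast
  show "h c t = transpose (jacobian (transition c c') (at t)) ** h c' (transition c c' t) ** jacobian (transition c c') (at t)"
    if "t \<in> overlap c c'" for t
    using T(2) cd that unfolding riemannian_metric_def by blast
  show "\<phi> d x = transpose (jacobian (transition d d') (at x)) ** \<phi> d' (transition d d' x) ** jacobian (transition d d') (at x)"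
    if "x \<in> overlap d d'" for x
    using M(2) cd that unfolding riemannian_metric_def by blast
  show "X c' d' (transition c c' t, transition d d' x, jacobian (transition d d') (at x) ** v ** matrix_inv (jacobian (transition c c') (at t)))
      = jacobian (transition d d') (at x) ** X c d (t, x, v) ** matrix_inv (jacobian (transition c c') (at t))"
    if tx: "t \<in> overlap c c'" "x \<in> overlap d d'" for t x v
  proof -
    have "(t, x, v) \<in> jet_overlap c d c' d'"
      using tx by (simp add: jet_overlap_def)
    then have "X c' d' (jet_transition c d c' d' (t, x, v)) = vertical_change c d c' d' t x (X c d (t, x, v))"
      using X cd unfolding vertical_dtensor_def by blast
    then show ?thesis
      by (simp add: jet_transition_def vertical_change_eq[OF tx])
  qed
qed

interpretation ch: jet_change "h c" "chart_image c" "\<phi> d" "chart_image d" "X c d"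
    "h c'" "chart_image c'" "\<phi> d'" "chart_image d'" "X c' d'"
    "transition c c'" "overlap c c'" "transition d d'" "overlap d d'"
  by (rule jet_change)

lemma jet_transition_eq: "z \<in> jet_overlap c d c' d' \<Longrightarrow> ch.jet_map z = jet_transition c d c' d' z"
  by (auto simp: jet_overlap_def ch.jet_map_def jet_transition_def vertical_change_eq)

lemma sasaki_metric_transition:
  assumes z: "z \<in> jet_overlap c d c' d'"
  shows "sasaki_metric (h c) (\<phi> d) (X c d) z V V'
    = sasaki_metric (h c') (\<phi> d') (X c' d') (jet_transition c d c' d' z)
       (frechet_derivative (jet_transition c d c' d') (at z) V) (frechet_derivative (jet_transition c d c' d') (at z) V')"
proof -
  obtain t x v where ztx: "z = (t, x, v)" "t \<in> overlap c c'" "x \<in> overlap d d'"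
    using z by (auto simp: jet_overlap_def)
  have "open (jet_overlap c d c' d')"
    unfolding jet_overlap_def using cd
    by (intro open_Times open_overlap[OF T(1)] open_overlap[OF M(1)] open_UNIV)
  with ch.jet_map_has_derivative[OF ztx(2,3), of v]
  have "(jet_transition c d c' d' has_derivative ch.jet_map_derivative z) (at z)"
    using z unfolding ztx(1)[symmetric] by (rule has_derivative_transform_within_open) (rule jet_transition_eq)
  note D = frechet_derivative_eqI[OF this]
  show ?thesis
    unfolding D jet_transition_eq[OF z, symmetric] using ch.sasaki_metric_change[OF ztx(2,3)] by (simp add: ztx(1))
qed

end

lemma jet_transition_dom:
  assumes "c \<in> \<A>" "c' \<in> \<A>" "d \<in> \<B>" "d' \<in> \<B>" "z \<in> jet_overlap c d c' d'"
  shows "z \<in> jet_dom c d" "jet_transition c d c' d' z \<in> jet_dom c' d'"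
  using assms(5) overlap_subset[of c c'] overlap_subset[of d d'] overlap_subset[of c' c] overlap_subset[of d' d]
    transition_overlap(1)[OF T(1) assms(1,2)] transition_overlap(1)[OF M(1) assms(3,4)]
  by (auto simp: jet_overlap_def jet_dom_def jet_transition_def)

text \<open>Forward, bilinearity and the values on the frame determine g. Backward, the explicit
  metric has to be a global Riemannian metric: smooth, positive and compatible with the jet
  transitions.\<close>

lemma gravitational_h_potential_iff:
  "gravitational_h_potential \<A> \<B> h \<phi> X g \<longleftrightarrow>
    (\<forall>c\<in>\<A>. \<forall>d\<in>\<B>. \<forall>z\<in>jet_dom c d. g c d z = sasaki_metric (h c) (\<phi> d) (X c d) z)"
proof
  assume g: "gravitational_h_potential \<A> \<B> h \<phi> X g"
  show "\<forall>c\<in>\<A>. \<forall>d\<in>\<B>. \<forall>z\<in>jet_dom c d. g c d z = sasaki_metric (h c) (\<phi> d) (X c d) z"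
  proof (intro ballI ext)
    fix c d z U V assume cd: "c \<in> \<A>" "d \<in> \<B>" and z: "z \<in> jet_dom c d"
    interpret jet_chart "h c" "chart_image c" "\<phi> d" "chart_image d" "X c d"
      using jet_chart[OF cd] .
    obtain t x v where ztx: "z = (t, x, v)" "t \<in> chart_image c" "x \<in> chart_image d"
      using z by (auto simp: jet_dom_def)
    have bil: "bilinear (g c d z)"
      using g cd z unfolding gravitational_h_potential_def riemannian_metric_jet_def covariant_2tensor_def by blast
    have "g c d z (frame (h c) (\<phi> d) (X c d) A z) (frame (h c) (\<phi> d) (X c d) B z)
        = potential_component (h c) (\<phi> d) (X c d) z A B" for A B
      using g cd z unfolding gravitational_h_potential_def by blast
    then have "\<forall>A B. g c d z (frame (h c) (\<phi> d) (X c d) A z) (frame (h c) (\<phi> d) (X c d) B z)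
        = sasaki_metric (h c) (\<phi> d) (X c d) z (frame (h c) (\<phi> d) (X c d) A z) (frame (h c) (\<phi> d) (X c d) B z)"
      unfolding sasaki_metric_frame by (simp add: ztx(1) potential_component_eq[OF ztx(2,3)])
    then show "g c d z U V = sasaki_metric (h c) (\<phi> d) (X c d) z U V"
      unfolding bilinear_eq_on_frame[OF bil bilinear_sasaki_metric, symmetric] by blast
  qed
next
  assume g: "\<forall>c\<in>\<A>. \<forall>d\<in>\<B>. \<forall>z\<in>jet_dom c d. g c d z = sasaki_metric (h c) (\<phi> d) (X c d) z"
  have local: "bilinear (g c d z)" "g c d z U V = g c d z V U" "U \<noteq> 0 \<Longrightarrow> g c d z U U > 0"
    "g c d z (frame (h c) (\<phi> d) (X c d) A z) (frame (h c) (\<phi> d) (X c d) B z) = potential_component (h c) (\<phi> d) (X c d) z A B"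
    if cd: "c \<in> \<A>" "d \<in> \<B>" and z: "z \<in> jet_dom c d" for c d z U V A B
  proof -
    interpret jet_chart "h c" "chart_image c" "\<phi> d" "chart_image d" "X c d"
      using jet_chart[OF cd] .
    obtain t x v where ztx: "z = (t, x, v)" "t \<in> chart_image c" "x \<in> chart_image d"
      using z by (auto simp: jet_dom_def)
    have gz: "g c d z = sasaki_metric (h c) (\<phi> d) (X c d) z" using g cd z by blast
    show "bilinear (g c d z)"
      unfolding gz by (rule bilinear_sasaki_metric)
    show "g c d z U V = g c d z V U"
      unfolding gz unfolding ztx(1) by (rule sasaki_metric_symmetric[OF ztx(2,3)])
    show "U \<noteq> 0 \<Longrightarrow> g c d z U U > 0"
      unfolding gz unfolding ztx(1) by (rule sasaki_metric_positive[OF ztx(2,3)])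
    show "g c d z (frame (h c) (\<phi> d) (X c d) A z) (frame (h c) (\<phi> d) (X c d) B z) = potential_component (h c) (\<phi> d) (X c d) z A B"
      unfolding gz sasaki_metric_frame unfolding ztx(1) by (rule potential_component_eq[OF ztx(2,3), symmetric])
  qed
  have smooth: "smooth_on (jet_dom c d) (\<lambda>z. g c d z U V)" if cd: "c \<in> \<A>" "d \<in> \<B>" for c d U V
  proof -
    interpret jet_chart "h c" "chart_image c" "\<phi> d" "chart_image d" "X c d"
      using jet_chart[OF cd] .
    have eq: "g c d z U V = sasaki_metric (h c) (\<phi> d) (X c d) z U V" if "z \<in> jets" for z
      using g cd that unfolding jet_dom_def by metis
    have "smooth_on jets (\<lambda>z. g c d z U V) \<longleftrightarrow> smooth_on jets (\<lambda>z. sasaki_metric (h c) (\<phi> d) (X c d) z U V)"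
      using open_jets by (rule smooth_on_cong) (rule eq)
    then have "smooth_on jets (\<lambda>z. g c d z U V)"
      using smooth_sasaki_metric by (rule iffD2)
    then show ?thesis by (simp add: jet_dom_def)
  qed
  have change: "g c d z U V = (let F = jet_transition c d c' d'; D = frechet_derivative F (at z) in g c' d' (F z) (D U) (D V))"
    if cd: "c \<in> \<A>" "d \<in> \<B>" "c' \<in> \<A>" "d' \<in> \<B>" and z: "z \<in> jet_overlap c d c' d'" for c d c' d' z U V
    using g cd jet_transition_dom[OF cd(1,3,2,4) z] sasaki_metric_transition[OF cd(1,3,2,4) z]
    by (simp add: Let_def)
  show "gravitational_h_potential \<A> \<B> h \<phi> X g"
    unfolding gravitational_h_potential_def riemannian_metric_jet_def covariant_2tensor_def
    by (intro conjI ballI allI impI) (rule local smooth change; assumption)+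
qed

end

theorem theorem2p4:
  fixes \<A> :: "('a::{t2_space,second_countable_topology}, 'p::finite) chart set"
    and \<B> :: "('b::{t2_space,second_countable_topology}, 'n::finite) chart set"
    and h :: "('a, 'p) chart \<Rightarrow> real^'p \<Rightarrow> real^'p^'p"
    and \<phi> :: "('b, 'n) chart \<Rightarrow> real^'n \<Rightarrow> real^'n^'n"
    and X :: "('a, 'p) chart \<Rightarrow> ('b, 'n) chart \<Rightarrow> ('p, 'n) jet \<Rightarrow> real^'p^'n"
    and \<K> :: real
    and \<T> :: "('a, 'p) chart \<Rightarrow> ('b, 'n) chart
                 \<Rightarrow> ('p, 'n) jet \<Rightarrow> ('p, 'n) jet \<Rightarrow> ('p, 'n) jet \<Rightarrow> real"
  assumes T: "connected_smooth_manifold \<A>" "riemannian_metric \<A> h"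
    and M: "connected_smooth_manifold \<B>" "riemannian_metric \<B> \<phi>"
    and X: "vertical_dtensor \<A> \<B> X"
    and X_indep: "\<And>c d t x v v'. c \<in> \<A> \<Longrightarrow> d \<in> \<B> \<Longrightarrow> t \<in> chart_image c \<Longrightarrow> x \<in> chart_image d
                    \<Longrightarrow> X c d (t, x, v) = X c d (t, x, v')"
    and K: "\<K> \<noteq> 0"
    and stress_energy: "covariant_2tensor \<A> \<B> \<T>"
  shows
    "(\<forall>g. gravitational_h_potential \<A> \<B> h \<phi> X g \<longleftrightarrow>
        (\<forall>c\<in>\<A>. \<forall>d\<in>\<B>. \<forall>z\<in>jet_dom c d. g c d z = sasaki_metric (h c) (\<phi> d) (X c d) z))
     \<and>
     (\<forall>c\<in>\<A>. \<forall>d\<in>\<B>.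
        let G = sasaki_metric (h c) (\<phi> d) (X c d);
            \<T>c = adapted_component (h c) (\<phi> d) (X c d) (\<T> c d)
        in einstein_equations (h c) (\<phi> d) (X c d) G \<K> (\<T> c d) (jet_dom c d) \<longleftrightarrow>
           (\<forall>t x v. (t, x, v) \<in> jet_dom c d \<longrightarrow>
              (let H = scalar_curvature (h c) t; r = scalar_curvature (\<phi> d) x; z = (t, x, v) in
                (\<forall>\<alpha> \<beta>. ricci (h c) t \<alpha> \<beta> - (H + r) / 2 * h c t $ \<alpha> $ \<beta> = \<K> * \<T>c z (tI \<alpha>) (tI \<beta>)) \<and>
                (\<forall>i j. ricci (\<phi> d) x i j - (H + r) / 2 * \<phi> d x $ i $ j = \<K> * \<T>c z (xI i) (xI j)) \<and>
                (\<forall>\<alpha> \<beta> i j. - ((H + r) / 2) * matrix_inv (h c t) $ \<alpha> $ \<beta> * \<phi> d x $ i $ j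
                              = \<K> * \<T>c z (vI i \<alpha>) (vI j \<beta>)) \<and>
                (\<forall>\<alpha> i. 0 = \<T>c z (tI \<alpha>) (xI i)) \<and>
                (\<forall>\<alpha> i. 0 = \<T>c z (xI i) (tI \<alpha>)) \<and>
                (\<forall>\<alpha> \<beta> i. 0 = \<T>c z (vI i \<alpha>) (tI \<beta>)) \<and>
                (\<forall>\<alpha> \<beta> i. 0 = \<T>c z (tI \<alpha>) (vI i \<beta>)) \<and>
                (\<forall>\<alpha> i j. 0 = \<T>c z (xI i) (vI j \<alpha>)) \<and>
                (\<forall>\<alpha> i j. 0 = \<T>c z (vI i \<alpha>) (xI j)))))
     \<and>
     (\<forall>c\<in>\<A>. \<forall>d\<in>\<B>.
        let G = sasaki_metric (h c) (\<phi> d) (X c d);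
            \<T>c = adapted_component (h c) (\<phi> d) (X c d) (\<T> c d)
        in einstein_equations (h c) (\<phi> d) (X c d) G \<K> (\<T> c d) (jet_dom c d) \<longrightarrow>
           (\<forall>z\<in>jet_dom c d.
              (\<forall>\<beta>. (\<Sum>\<mu>\<in>UNIV. t_cov (h c) (t_raised (h c) \<T>c) z \<mu> \<beta> \<mu>) = 0) \<and>
              (\<forall>j. (\<Sum>m\<in>UNIV. x_cov (\<phi> d) (x_raised (\<phi> d) \<T>c) z m j m) = 0)))"
proof -
  interpret pde_space \<A> \<B> h \<phi> X
    using T M X X_indep by (rule pde_space.intro)
  have bilinear: "\<forall>z\<in>jet_dom c d. bilinear (\<T> c d z)" if "c \<in> \<A>" "d \<in> \<B>" for c d
    using stress_energy that unfolding covariant_2tensor_def by blast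
  show ?thesis
  proof (intro conjI allI ballI, goal_cases)
    case (1 g)
    show ?case by (rule gravitational_h_potential_iff)
  next
    case (2 c d)
    interpret jet_chart "h c" "chart_image c" "\<phi> d" "chart_image d" "X c d"
      using jet_chart[OF 2] .
    \<comment> \<open>The six mixed equations have left side 0, and a nonzero constant may be
      cancelled.\<close>
    have mixed: "0 - s * 0 = \<K> * r \<longleftrightarrow> 0 = r" for s r
      using K by auto
    have vertical: "0 - s * (a * b) = - s * a * b" for s a b :: real
      by simp
    show ?case
      unfolding Let_def jet_dom_def einstein_equations_on_frame[OF bilinear[OF 2, unfolded jet_dom_def]]
        adapted_index_pairs ricci_component.simps sasaki_component.simps fst_conv snd_conv mixed vertical ..
  next
    case (3 c d)
    interpret jet_chart "h c" "chart_image c" "\<phi> d" "chart_image d" "X c d"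
      using jet_chart[OF 3] .
    show ?case
      unfolding Let_def jet_dom_def
      by (intro impI ballI conjI allI)
        (rule conservation_laws[OF bilinear[OF 3, unfolded jet_dom_def] K]; assumption)+
  qed
qed

end
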